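(* Let $\mathcal{A}$ be an essential central arrangement of $n$ hyperplanes of rank $\ell$ which is not Boolean. Then $$h(S/I;t,u)=\sum_{i=1}^{\ell}\frac{t_{i0}}{(1-t)^i(1-u)^{n-i}}+Q(t,u),$$ where $Q(t,u)$ has total pole order strictly less than $n$, i.e. $Q(t,u)=\sum_{i,j\ge0,\ i+j<n}\frac{c_{ij}}{(1-t)^i(1-u)^j}$ with $c_{ij}\in\mathbb{Z}$ for $i,j\ge1$, $c_{0j}\in\mathbb{Z}[t]$ for $j\ge1$, $c_{i0}\in\mathbb{Z}[u]$ for $i\ge1$, and $c_{00}\in\mathbb{Z}[t,u]$.
   Context: Let $V$ be a complex vector space and $\mathcal{A}=\{H_1,\dots,H_n\}$ a central arrangement: a set of $n$ distinct linear hyperplanes $H_i=\ker f_i$, $f_i\in V^*$ nonzero; $f=f_1\cdots f_n$. Its rank is $\ell=\operatorname{codim}_V\bigcap_iH_i$; $\mathcal{A}$ is essential if $\bigcap_i H_i=\{0\}$, so that $\ell=\dim V$. $\mathcal{A}$ is Boolean if $f_1,\dots,f_n$ are linearly independent (equivalently $n=\ell$). Let $R=\mathbb{C}[V]$, $C=\mathbb{C}[a_1,\dots,a_n]$, and $S=R\otimes_{\mathbb{C}}C$, bigraded by degree in the $R$-variables and degree in the $C$-variables. Let $D(\mathcal{A})=\{\theta\in\operatorname{Der}_{\mathbb{C}}(R):\theta(f)\in(f)\}$ be the module of logarithmic derivations, and $\omega_{\mathbf a}=\sum_i a_i\frac{df_i}{f_i}$. The logarithmic ideal $I=I(\mathcal{A})\subseteq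 S$ is the bihomogeneous ideal generated by all contractions $\langle\theta,\omega_{\mathbf a}\rangle=\sum_i a_i\frac{\theta(f_i)}{f_i}$, $\theta\in D(\mathcal{A})$. Write $h(S/I;t,u)=\sum_{p,q\ge0}\dim_{\mathbb{C}}(S/I)_{p,q}\,t^pu^q$ for the bigraded Hilbert series. The integers $t_{ij}$ are the coefficients of $x^iy^j$ in the Tutte polynomial $T_{\mathcal{A}}(x,y)$ of the matroid of $\mathcal{A}$. With the characteristic polynomial $\chi(\mathcal{A},t)=\sum_{X\in L(\mathcal{A})}\mu(V,X)t^{\ell-\operatorname{codim}X}$ (where $L(\mathcal A)$ is the intersection lattice ordered by reverse inclusion and $\mu$ its Möbius function), one has $T_{\mathcal{A}}(x,0)=\sum_i t_{i0}x^i=(-1)^\ell\chi(\mathcal{A},1-x)$. *)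

theory Defs
  imports
    Complex_Main
    "HOL-Library.Function_Algebras"
    "HOL-Library.Poly_Mapping"
    "HOL-Computational_Algebra.Polynomial_FPS"
begin

text \<open>
  Throughout, the complex vector space \<open>V\<close> is the type \<open>'v\<close> with scalar multiplication
  \<open>scl\<close>, and the arrangement consists of the kernels of \<open>f 1, \<dots>, f n\<close>. Functions are added and
  multiplied pointwise.
\<close>

section \<open>Central arrangements\<close>

definition linear_forms :: "(complex \<Rightarrow> 'v::ab_group_add \<Rightarrow> 'v) \<Rightarrow> ('v \<Rightarrow> complex) set" where
  "linear_forms scl = {\<phi>. Vector_Spaces.linear scl (*) \<phi>}"

definition hyperplane :: "('v \<Rightarrow> complex) \<Rightarrow> 'v set" where
  "hyperplane \<phi> = {v. \<phi> v = 0}"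

definition central_arrangement ::
    "(complex \<Rightarrow> 'v::ab_group_add \<Rightarrow> 'v) \<Rightarrow> nat \<Rightarrow> (nat \<Rightarrow> 'v \<Rightarrow> complex) \<Rightarrow> bool" where
  "central_arrangement scl n f \<longleftrightarrow>
     vector_space scl \<and>
     (\<forall>i\<in>{1..n}. f i \<in> linear_forms scl \<and> f i \<noteq> 0) \<and>
     inj_on (\<lambda>i. hyperplane (f i)) {1..n}"

definition center :: "nat \<Rightarrow> (nat \<Rightarrow> 'v \<Rightarrow> complex) \<Rightarrow> 'v set" where
  "center n f = (\<Inter>i\<in>{1..n}. hyperplane (f i))"

definition essential :: "nat \<Rightarrow> (nat \<Rightarrow> 'v::ab_group_add \<Rightarrow> complex) \<Rightarrow> bool" where
  "essential n f \<longleftrightarrow> center n f = {0}"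

text \<open>
  The difference of dimensions is the codimension only when \<open>V\<close> is finite-dimensional
  (\<^const>\<open>vector_space.dim\<close> is 0 otherwise). This holds whenever the arrangement is essential.
\<close>
definition arrangement_rank ::
    "(complex \<Rightarrow> 'v::ab_group_add \<Rightarrow> 'v) \<Rightarrow> nat \<Rightarrow> (nat \<Rightarrow> 'v \<Rightarrow> complex) \<Rightarrow> nat" where
  "arrangement_rank scl n f = vector_space.dim scl UNIV - vector_space.dim scl (center n f)"

definition boolean_arrangement :: "nat \<Rightarrow> (nat \<Rightarrow> 'v \<Rightarrow> complex) \<Rightarrow> bool" where
  "boolean_arrangement n f \<longleftrightarrow>
     (\<forall>c :: nat \<Rightarrow> complex.
        (\<forall>v. (\<Sum>i = 1..n. c i * f i v) = 0) \<longrightarrow> (\<forall>i\<in>{1..n}. c i = 0))"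

section \<open>The Tutte polynomial\<close>

definition fun_scale :: "complex \<Rightarrow> ('v \<Rightarrow> complex) \<Rightarrow> 'v \<Rightarrow> complex" where
  "fun_scale c g = (\<lambda>v. c * g v)"

lemma vector_space_fun_scale: "vector_space fun_scale"
  by unfold_locales (auto simp: fun_scale_def fun_eq_iff algebra_simps)

definition matroid_rank :: "(nat \<Rightarrow> 'v \<Rightarrow> complex) \<Rightarrow> nat set \<Rightarrow> nat" where
  "matroid_rank f X = vector_space.dim fun_scale (f ` X)"

text \<open>
  Corank-nullity expansion, as a polynomial in \<open>x\<close> with coefficients in \<open>\<int>[y]\<close>.
\<close>
definition tutte_polynomial :: "nat \<Rightarrow> (nat \<Rightarrow> 'v \<Rightarrow> complex) \<Rightarrow> int poly poly" where
  "tutte_polynomial n f =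
     (\<Sum>X\<in>Pow {1..n}.
        [:-1, 1:] ^ (matroid_rank f {1..n} - matroid_rank f X) *
        [:[:-1, 1:]:] ^ (card X - matroid_rank f X))"

definition tutte_coeff :: "nat \<Rightarrow> (nat \<Rightarrow> 'v \<Rightarrow> complex) \<Rightarrow> nat \<Rightarrow> nat \<Rightarrow> int" where
  "tutte_coeff n f i j = coeff (coeff (tutte_polynomial n f) i) j"

section \<open>The rings \<open>R = \<complex>[V]\<close> and \<open>S = R[a\<^sub>1, \<dots>, a\<^sub>n]\<close>\<close>

inductive_set poly_functions :: "(complex \<Rightarrow> 'v::ab_group_add \<Rightarrow> 'v) \<Rightarrow> ('v \<Rightarrow> complex) set"
  for scl :: "complex \<Rightarrow> 'v::ab_group_add \<Rightarrow> 'v" where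
  const: "(\<lambda>_. c) \<in> poly_functions scl"
| linear: "\<phi> \<in> linear_forms scl \<Longrightarrow> \<phi> \<in> poly_functions scl"
| add: "g \<in> poly_functions scl \<Longrightarrow> h \<in> poly_functions scl \<Longrightarrow> g + h \<in> poly_functions scl"
| mult: "g \<in> poly_functions scl \<Longrightarrow> h \<in> poly_functions scl \<Longrightarrow> g * h \<in> poly_functions scl"

definition homogeneous_functions ::
    "(complex \<Rightarrow> 'v::ab_group_add \<Rightarrow> 'v) \<Rightarrow> nat \<Rightarrow> ('v \<Rightarrow> complex) set" where
  "homogeneous_functions scl p =
     module.span fun_scale {\<Prod>k<p. \<phi> k | \<phi>. \<forall>k<p. \<phi> k \<in> linear_forms scl}"

text \<open>
  An element of \<open>S = R \<otimes> \<complex>[a\<^sub>1, \<dots>, a\<^sub>n]\<close> is a polynomial in the \<open>a\<^sub>i\<close> with coefficients in \<open>R\<close>: a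
  finitely supported function from monomials in the \<open>a\<^sub>i\<close> (finitely supported exponent
  functions) to functions on \<open>V\<close>.
\<close>
type_synonym 'v bipoly = "(nat \<Rightarrow>\<^sub>0 nat) \<Rightarrow>\<^sub>0 ('v \<Rightarrow> complex)"

definition S_ring :: "(complex \<Rightarrow> 'v::ab_group_add \<Rightarrow> 'v) \<Rightarrow> nat \<Rightarrow> 'v bipoly set" where
  "S_ring scl n =
     {s. \<forall>m\<in>Poly_Mapping.keys s. Poly_Mapping.keys m \<subseteq> {1..n} \<and> Poly_Mapping.lookup s m \<in> poly_functions scl}"

definition S_bideg :: "(complex \<Rightarrow> 'v::ab_group_add \<Rightarrow> 'v) \<Rightarrow> nat \<Rightarrow> nat \<Rightarrow> nat \<Rightarrow> 'v bipoly set" where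
  "S_bideg scl n p q =
     {s. \<forall>m\<in>Poly_Mapping.keys s. Poly_Mapping.keys m \<subseteq> {1..n} \<and> (\<Sum>i\<in>Poly_Mapping.keys m. Poly_Mapping.lookup m i) = q \<and>
           Poly_Mapping.lookup s m \<in> homogeneous_functions scl p}"

definition S_scale :: "complex \<Rightarrow> 'v bipoly \<Rightarrow> 'v bipoly" where
  "S_scale c s = Poly_Mapping.single 0 (\<lambda>_. c) * s"

lemma vector_space_S_scale: "vector_space S_scale"
proof unfold_locales
  fix a b :: complex and x y :: "'v bipoly"
  have add: "(\<lambda>_::'v. a + b) = (\<lambda>_. a) + (\<lambda>_. b)"
    and mult: "(\<lambda>_::'v. a * b) = (\<lambda>_. a) * (\<lambda>_. b)"
    and one: "(\<lambda>_::'v. 1::complex) = 1"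
    by (simp_all add: fun_eq_iff)
  show "S_scale a (x + y) = S_scale a x + S_scale a y"
    by (simp add: S_scale_def algebra_simps)
  show "S_scale (a + b) x = S_scale a x + S_scale b x"
    unfolding S_scale_def add by (simp add: Poly_Mapping.single_add algebra_simps)
  show "S_scale a (S_scale b x) = S_scale (a * b) x"
    unfolding S_scale_def mult by (simp add: Poly_Mapping.mult_single mult.assoc [symmetric])
  show "S_scale 1 x = x"
    unfolding S_scale_def one by simp
qed

section \<open>Logarithmic derivations and the logarithmic ideal\<close>

text \<open>
  A derivation of \<open>R\<close> is represented by a map on all functions; only its values on \<open>R\<close> matter.
\<close>
definition derivations ::
    "(complex \<Rightarrow> 'v::ab_group_add \<Rightarrow> 'v) \<Rightarrow> (('v \<Rightarrow> complex) \<Rightarrow> 'v \<Rightarrow> complex) set" where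
  "derivations scl =
     {\<theta>. (\<forall>g\<in>poly_functions scl. \<theta> g \<in> poly_functions scl) \<and>
         (\<forall>g\<in>poly_functions scl. \<forall>h\<in>poly_functions scl. \<theta> (g + h) = \<theta> g + \<theta> h) \<and>
         (\<forall>c. \<forall>g\<in>poly_functions scl. \<theta> (fun_scale c g) = fun_scale c (\<theta> g)) \<and>
         (\<forall>g\<in>poly_functions scl. \<forall>h\<in>poly_functions scl. \<theta> (g * h) = \<theta> g * h + g * \<theta> h)}"

definition log_derivations ::
    "(complex \<Rightarrow> 'v::ab_group_add \<Rightarrow> 'v) \<Rightarrow> nat \<Rightarrow> (nat \<Rightarrow> 'v \<Rightarrow> complex) \<Rightarrow>
     (('v \<Rightarrow> complex) \<Rightarrow> 'v \<Rightarrow> complex) set" where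
  "log_derivations scl n f =
     {\<theta> \<in> derivations scl. \<exists>g\<in>poly_functions scl. \<theta> (\<Prod>i = 1..n. f i) = g * (\<Prod>i = 1..n. f i)}"

text \<open>
  The contractions \<open>\<Sum>\<^sub>i a\<^sub>i \<theta>(f\<^sub>i)/f\<^sub>i\<close>: here \<open>g i\<close> is the quotient \<open>\<theta>(f\<^sub>i)/f\<^sub>i\<close>, which lies in \<open>R\<close>
  because \<open>f\<^sub>i\<close> divides \<open>\<theta>(f\<^sub>i)\<close> when \<open>\<theta>\<close> is logarithmic, and is unique because \<open>R\<close> is a domain.
\<close>
definition contractions ::
    "(complex \<Rightarrow> 'v::ab_group_add \<Rightarrow> 'v) \<Rightarrow> nat \<Rightarrow> (nat \<Rightarrow> 'v \<Rightarrow> complex) \<Rightarrow> 'v bipoly set" where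
  "contractions scl n f =
     {\<Sum>i = 1..n. Poly_Mapping.single (Poly_Mapping.single i 1) (g i) | g.
        \<exists>\<theta>\<in>log_derivations scl n f.
          \<forall>i\<in>{1..n}. g i \<in> poly_functions scl \<and> \<theta> (f i) = g i * f i}"

inductive_set log_ideal ::
    "(complex \<Rightarrow> 'v::ab_group_add \<Rightarrow> 'v) \<Rightarrow> nat \<Rightarrow> (nat \<Rightarrow> 'v \<Rightarrow> complex) \<Rightarrow> 'v bipoly set"
  for scl :: "complex \<Rightarrow> 'v::ab_group_add \<Rightarrow> 'v" and n :: nat and f :: "nat \<Rightarrow> 'v \<Rightarrow> complex" where
  zero: "0 \<in> log_ideal scl n f"
| step: "s \<in> S_ring scl n \<Longrightarrow> w \<in> contractions scl n f \<Longrightarrow> z \<in> log_ideal scl n f \<Longrightarrow>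
           s * w + z \<in> log_ideal scl n f"

section \<open>Bigraded Hilbert series and pole order\<close>

text \<open>
  \<open>(S/I)\<^sub>p\<^sub>q = S\<^sub>p\<^sub>q / (I \<inter> S\<^sub>p\<^sub>q)\<close> since \<open>I\<close> is bihomogeneous, and \<open>S\<^sub>p\<^sub>q\<close> is finite-dimensional when \<open>V\<close> is.
\<close>
definition quotient_dim ::
    "(complex \<Rightarrow> 'v::ab_group_add \<Rightarrow> 'v) \<Rightarrow> nat \<Rightarrow> (nat \<Rightarrow> 'v \<Rightarrow> complex) \<Rightarrow> nat \<Rightarrow> nat \<Rightarrow> nat" where
  "quotient_dim scl n f p q =
     vector_space.dim S_scale (S_bideg scl n p q) -
     vector_space.dim S_scale (log_ideal scl n f \<inter> S_bideg scl n p q)"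

text \<open>
  Power series in \<open>t\<close> and \<open>u\<close> are power series in \<open>t\<close> with coefficients in \<open>\<rat>[[u]]\<close>; the
  coefficients are taken rational so that \<^const>\<open>inverse\<close> is available.
\<close>
definition var_t :: "rat fps fps" where "var_t = fps_X"

definition var_u :: "rat fps fps" where "var_u = fps_const fps_X"

lemma inverse_pole:
  "inverse ((1 - var_t) ^ i * (1 - var_u) ^ j) * ((1 - var_t) ^ i * (1 - var_u) ^ j) = 1"
proof -
  let ?g = "(1 - fps_X) ^ j :: rat fps"
  let ?h = "(1 - var_t) ^ i * (1 - var_u) ^ j"
  have g0: "fps_nth ?g 0 \<noteq> 0"
    by (simp add: fps_power_zeroth)
  have "fps_nth ?h 0 = ?g"
    by (simp add: var_t_def var_u_def fps_power_zeroth)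
  then have "inverse (fps_nth ?h 0) * fps_nth ?h 0 = 1" "fps_nth ?h 0 * inverse (fps_nth ?h 0) = 1"
    using inverse_mult_eq_1 [OF g0] by (simp_all add: mult.commute)
  from fps_left_inverse' [OF this] show ?thesis
    by (simp add: fps_inverse_def)
qed

definition hilbert_series ::
    "(complex \<Rightarrow> 'v::ab_group_add \<Rightarrow> 'v) \<Rightarrow> nat \<Rightarrow> (nat \<Rightarrow> 'v \<Rightarrow> complex) \<Rightarrow> rat fps fps" where
  "hilbert_series scl n f = Abs_fps (\<lambda>p. Abs_fps (\<lambda>q. of_nat (quotient_dim scl n f p q)))"

definition int_polys_t :: "rat fps fps set" where
  "int_polys_t = range (\<lambda>P :: int poly. fps_of_poly (map_poly of_int P))"

definition int_polys_u :: "rat fps fps set" where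
  "int_polys_u = range (\<lambda>P :: int poly. fps_const (fps_of_poly (map_poly of_int P)))"

definition int_polys_tu :: "rat fps fps set" where
  "int_polys_tu =
     range (\<lambda>P :: int poly poly. fps_of_poly (map_poly (\<lambda>q. fps_of_poly (map_poly of_int q)) P))"

definition pole_order_less :: "nat \<Rightarrow> rat fps fps \<Rightarrow> bool" where
  "pole_order_less n Q \<longleftrightarrow>
     (\<exists>c :: nat \<Rightarrow> nat \<Rightarrow> rat fps fps.
        (\<forall>i\<ge>1. \<forall>j\<ge>1. c i j \<in> \<int>) \<and>
        (\<forall>j\<ge>1. c 0 j \<in> int_polys_t) \<and>
        (\<forall>i\<ge>1. c i 0 \<in> int_polys_u) \<and>
        c 0 0 \<in> int_polys_tu \<and>
        Q = (\<Sum>(i, j)\<in>{(i, j). i + j < n}. c i j * inverse ((1 - var_t) ^ i * (1 - var_u) ^ j)))"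

end

theory Submission
  imports Defs
begin

text \<open>
  Up to terms of lower pole order, the bigraded dimensions of \<open>S/I\<close> are squeezed between two bounds
  that satisfy the same deletion-contraction recursion as \<open>T(x, 0)\<close>. Upper bound: \<open>I\<close> contains the
  contractions of the Euler derivation and of the derivations \<open>(\<Prod>j\<in>D. f j) \<partial>\<^sub>v\<close> with
  \<open>D = {j. f j v \<noteq> 0}\<close>, and the ideals \<open>J(M)\<close> generated by such elements for a minor \<open>M\<close> satisfy
  \<open>f e J(M \ e) \<subseteq> J(M) + (a e)\<close> and \<open>J(M / e) \<subseteq> J(M) + (a e) + (f e)\<close>. Lower bound: \<open>I\<close> vanishes at
  the points \<open>(x, (b i f i(x)))\<close> with \<open>\<Sum>i. b i f i = 0\<close>. Modulo the elements vanishing at these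
  points, independent sets of the deletion, \<open>a e\<close> times those of \<open>M\<close>, and \<open>z\<close> times those of the
  contraction stay jointly independent, where \<open>z\<close> is an element restricting to
  \<open>b e (\<Prod>j\<in>D. f j)\<close>. Finally, by Dickson's lemma applied to standard monomials, the Hilbert series
  is a finite sum of terms \<open>t\<^sup>a u\<^sup>b / ((1 - t)\<^sup>i (1 - u)\<^sup>j)\<close>. All of them have positive coefficients, so the
  growth of the dimensions bounds each pole order by \<open>n\<close> and determines the terms of order \<open>n\<close>.
\<close>

section \<open>Growth of bigraded functions\<close>

text \<open>Nothing is proved about logarithmic ideals of minors. Both recursions stay inside the
  one ring S, and only for the whole arrangement is I sandwiched between J and the ideal of all
  elements vanishing at the special points. Multiplication by \<open>f e\<close> or by z shifts
  bidegrees, so the recursions do not match that of T(x, 0) exactly. A shift changes a term by lower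
  order only if the term has poles in both variables. This is why the constant coefficient of T(x,
  0) must vanish for nonempty minors, and the top one as well; for the whole arrangement the latter
  is where the failure of being Boolean enters, as rank < n. The squeeze controls growth only;
  integrality and the shape of Q come from the finite sum of positive terms. Along a ray (l s, s)
  the terms of order n contribute a polynomial in the slope l, which separates their exponents.
  Terms with a pole in one variable only are invisible on such rays and are bounded in a fixed row
  or column instead.\<close>

primrec geo_coeff :: "nat \<Rightarrow> nat \<Rightarrow> nat" where
  "geo_coeff 0 p = of_bool (p = 0)"
| "geo_coeff (Suc i) p = (\<Sum>p'\<le>p. geo_coeff i p')"

text \<open>\<open>geo_coeff i p\<close> is the coefficient of t^p in 1/(1-t)^i. Its definition by
  partial sums fits the recursions below, each of which sums over one degree and so raises a pole
  order by one.\<close>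

lemma geo_coeff_Suc_Suc: "geo_coeff (Suc i) (Suc p) = geo_coeff (Suc i) p + geo_coeff i (Suc p)"
  by simp

lemma geo_coeff_at_0 [simp]: "geo_coeff i 0 = 1"
  by (induction i) auto

lemma geo_coeff_mono:
  assumes "i \<ge> 1" "p \<le> p'"
  shows "geo_coeff i p \<le> geo_coeff i p'"
  using assms by (cases i) (auto intro!: sum_mono2)

lemma geo_coeff_le_power: "geo_coeff (Suc i) p \<le> (p + 1) ^ i"
proof (induction i arbitrary: p)
  case (Suc i)
  have "geo_coeff (Suc (Suc i)) p \<le> (\<Sum>p'\<le>p. (p + 1) ^ i)"
    unfolding geo_coeff.simps(2)[of "Suc i"]
    by (intro sum_mono order_trans[OF Suc] power_mono) auto
  then show ?case by simp
qed (auto simp: sum.delta)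

lemma geo_coeff_Suc_eq_binomial: "geo_coeff (Suc i) p = (p + i) choose i"
proof (induction i arbitrary: p)
  case (Suc i)
  note IH = Suc
  show ?case
  proof (induction p)
    case (Suc p)
    then show ?case
      using geo_coeff_Suc_Suc[of "Suc i" p] IH[of "Suc p"] by (simp del: geo_coeff.simps)
  qed simp
qed (auto simp: sum.delta)

text \<open>The exponent i - 1 is the growth rate of the coefficients of 1/(1-t)^i. One number N
  serves as cut-off for i = 0 and, in \<open>err_bounded\<close>, as constant factor, so that two
  bounds merge by adding their N.\<close>

definition err_term :: "nat \<Rightarrow> nat \<Rightarrow> nat \<Rightarrow> real" where
  "err_term N i p = (if i = 0 then of_bool (p \<le> N) else (real p + 1) ^ (i - 1))"

text \<open>
  \<open>err_bounded k g\<close>: \<open>g\<close> is dominated by the coefficients of a series of total pole order at most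
  \<open>k\<close>. In \<^term>\<open>err_term N 0\<close> the indicator of \<open>p \<le> N\<close> accounts for polynomial coefficients.
\<close>
definition err_bounded :: "nat \<Rightarrow> (nat \<Rightarrow> nat \<Rightarrow> real) \<Rightarrow> bool" where
  "err_bounded k g \<longleftrightarrow>
     (\<exists>N. \<forall>p q. g p q \<le> real N * (\<Sum>i\<le>k. err_term N i p * err_term N (k - i) q))"

lemma err_term_nonneg [simp]: "0 \<le> err_term N i p"
  by (simp add: err_term_def)

lemma err_term_mono: "N \<le> N' \<Longrightarrow> err_term N i p \<le> err_term N' i p"
  by (auto simp: err_term_def)

lemma err_term_le_Suc: "err_term N i p \<le> err_term N (Suc i) p"
proof (cases i)
  case (Suc k)
  have "(real p + 1) ^ k \<le> (real p + 1) ^ Suc k" by (rule power_increasing) auto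
  then show ?thesis by (simp add: Suc err_term_def)
qed (auto simp: err_term_def)

lemma err_term_shift: "err_term N i (p - a) \<le> err_term (N + a) i p"
  by (auto simp: err_term_def intro!: power_mono)

text \<open>Summation raises the order by one. A factor is needed only for i = 0, where the at most
  N + 1 ones below the cut-off add up to a constant.\<close>

lemma err_term_sum: "(\<Sum>p'\<le>p. err_term N i p') \<le> real (N + 1) * err_term N (Suc i) p"
proof (cases i)
  case 0
  have "(\<Sum>p'\<le>p. err_term N i p') = real (card ({..p} \<inter> {..N}))"
    by (simp add: 0 err_term_def sum.If_cases of_bool_def atMost_def)
  also have "\<dots> \<le> real (card {..N})"
    by (intro of_nat_mono card_mono) auto
  finally show ?thesis by (simp add: 0 err_term_def)
next
  case (Suc k)
  have "(\<Sum>p'\<le>p. err_term N i p') \<le> (\<Sum>p'\<le>p. (real p + 1) ^ k)"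
    by (intro sum_mono) (auto simp: err_term_def Suc intro!: power_mono)
  also have "\<dots> = 1 * err_term N (Suc i) p"
    by (simp add: err_term_def Suc)
  also have "\<dots> \<le> real (N + 1) * err_term N (Suc i) p"
    by (intro mult_right_mono) auto
  finally show ?thesis .
qed

text \<open>The bound is one-sided, so any smaller function inherits it, however negative. The two
  halves of the squeeze are therefore separate \<open>err_bounded\<close> statements.\<close>

lemma err_bounded_le:
  assumes "err_bounded k g" "\<And>p q. h p q \<le> g p q"
  shows "err_bounded k h"
  using assms unfolding err_bounded_def by (meson order_trans)

lemma err_boundedI:
  assumes "\<And>p q. g p q \<le> real N * (\<Sum>i\<le>k. err_term N i p * err_term N (k - i) q)"
  shows "err_bounded k g"
  using assms unfolding err_bounded_def by blast

lemma err_bounded_zero [simp]: "err_bounded k (\<lambda>p q. 0)"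
  by (rule err_boundedI[of _ 0]) simp

lemma err_sum_mono:
  assumes "N \<le> N'"
  shows "(\<Sum>i\<le>k. err_term N i p * err_term N (k - i) q) \<le> (\<Sum>i\<le>k. err_term N' i p * err_term N' (k - i) q)"
  using assms by (intro sum_mono mult_mono err_term_mono) auto

lemma err_bounded_add:
  assumes "err_bounded k g" "err_bounded k h"
  shows "err_bounded k (\<lambda>p q. g p q + h p q)"
proof -
  obtain N where N: "\<And>p q. g p q \<le> real N * (\<Sum>i\<le>k. err_term N i p * err_term N (k - i) q)"
    using assms(1) by (auto simp: err_bounded_def)
  obtain M where M: "\<And>p q. h p q \<le> real M * (\<Sum>i\<le>k. err_term M i p * err_term M (k - i) q)"
    using assms(2) by (auto simp: err_bounded_def)
  show ?thesis
  proof (rule err_boundedI[of _ "N + M"])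
    fix p q
    let ?T = "\<lambda>N. \<Sum>i\<le>k. err_term N i p * err_term N (k - i) q"
    have "real N * ?T N \<le> real N * ?T (N + M)" "real M * ?T M \<le> real M * ?T (N + M)"
      by (intro mult_left_mono err_sum_mono; simp)+
    with N[of p q] M[of p q] show "g p q + h p q \<le> real (N + M) * ?T (N + M)"
      by (simp add: algebra_simps)
  qed
qed

lemma err_bounded_sum:
  "(\<And>i. i \<in> I \<Longrightarrow> err_bounded k (g i)) \<Longrightarrow> err_bounded k (\<lambda>p q. \<Sum>i\<in>I. g i p q)"
  by (induction I rule: infinite_finite_induct) (auto intro: err_bounded_add)

lemma err_bounded_cmult:
  assumes "err_bounded k g" "0 \<le> c"
  shows "err_bounded k (\<lambda>p q. c * g p q)"
proof -
  obtain N where N: "\<And>p q. g p q \<le> real N * (\<Sum>i\<le>k. err_term N i p * err_term N (k - i) q)"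
    using assms(1) by (auto simp: err_bounded_def)
  obtain m :: nat where m: "c \<le> real m" using real_arch_simple by blast
  show ?thesis
  proof (rule err_boundedI[of _ "(m + 1) * N"])
    fix p q
    let ?T = "\<lambda>N. \<Sum>i\<le>k. err_term N i p * err_term N (k - i) q"
    have T: "0 \<le> ?T N" by (intro sum_nonneg) auto
    have "c * g p q \<le> c * (real N * ?T N)" using N assms(2) by (intro mult_left_mono)
    also have "\<dots> \<le> real (m + 1) * (real N * ?T N)"
      using m T by (intro mult_right_mono) auto
    also have "\<dots> \<le> real (m + 1) * (real N * ?T ((m + 1) * N))"
      by (intro mult_left_mono err_sum_mono) auto
    finally show "c * g p q \<le> real ((m + 1) * N) * ?T ((m + 1) * N)"
      by (simp only: of_nat_mult mult.assoc)
  qed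
qed

lemma err_bounded_swap:
  assumes "err_bounded k g"
  shows "err_bounded k (\<lambda>p q. g q p)"
proof -
  obtain N where N: "\<And>p q. g p q \<le> real N * (\<Sum>i\<le>k. err_term N i p * err_term N (k - i) q)"
    using assms(1) by (auto simp: err_bounded_def)
  have "(\<Sum>i\<le>k. err_term N i q * err_term N (k - i) p) = (\<Sum>i\<le>k. err_term N i p * err_term N (k - i) q)" for p q
    by (rule sum.reindex_bij_witness[of _ "\<lambda>i. k - i" "\<lambda>i. k - i"]) auto
  with N show ?thesis by (intro err_boundedI[of _ N]) metis
qed

lemma err_bounded_sum_snd:
  assumes "err_bounded k g"
  shows "err_bounded (Suc k) (\<lambda>p q. \<Sum>q'\<le>q. g p q')"
proof -
  obtain N where N: "\<And>p q. g p q \<le> real N * (\<Sum>i\<le>k. err_term N i p * err_term N (k - i) q)"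
    using assms(1) by (auto simp: err_bounded_def)
  show ?thesis
  proof (rule err_boundedI[of _ "N * (N + 1)"])
    fix p q
    let ?M = "N * (N + 1)"
    have "(\<Sum>q'\<le>q. g p q') \<le> (\<Sum>q'\<le>q. real N * (\<Sum>i\<le>k. err_term N i p * err_term N (k - i) q'))"
      by (intro sum_mono N)
    also have "\<dots> = real N * (\<Sum>i\<le>k. err_term N i p * (\<Sum>q'\<le>q. err_term N (k - i) q'))"
      by (simp add: sum_distrib_left sum.swap[of _ "{..q}"])
    also have "\<dots> \<le> real N * (\<Sum>i\<le>k. err_term N i p * (real (N + 1) * err_term N (Suc (k - i)) q))"
      by (intro mult_left_mono sum_mono err_term_sum) auto
    also have "\<dots> = real ?M * (\<Sum>i\<le>k. err_term N i p * err_term N (Suc k - i) q)"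
      by (simp add: sum_distrib_left Suc_diff_le algebra_simps)
    also have "\<dots> \<le> real ?M * (\<Sum>i\<le>Suc k. err_term N i p * err_term N (Suc k - i) q)"
      by (intro mult_left_mono sum_mono2) auto
    also have "\<dots> \<le> real ?M * (\<Sum>i\<le>Suc k. err_term ?M i p * err_term ?M (Suc k - i) q)"
      by (intro mult_left_mono err_sum_mono) auto
    finally show "(\<Sum>q'\<le>q. g p q') \<le> real ?M * (\<Sum>i\<le>Suc k. err_term ?M i p * err_term ?M (Suc k - i) q)" .
  qed
qed

lemma err_bounded_sum_fst:
  assumes "err_bounded k g"
  shows "err_bounded (Suc k) (\<lambda>p q. \<Sum>p'\<le>p. g p' q)"
  using err_bounded_swap[OF err_bounded_sum_snd[OF err_bounded_swap[OF assms]]] .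

lemma err_bounded_Suc:
  assumes "err_bounded k g"
  shows "err_bounded (Suc k) g"
proof -
  obtain N where N: "\<And>p q. g p q \<le> real N * (\<Sum>i\<le>k. err_term N i p * err_term N (k - i) q)"
    using assms(1) by (auto simp: err_bounded_def)
  show ?thesis
  proof (rule err_boundedI[of _ N])
    fix p q
    have "(\<Sum>i\<le>k. err_term N i p * err_term N (k - i) q) \<le> (\<Sum>i\<le>k. err_term N i p * err_term N (Suc k - i) q)"
      by (intro sum_mono mult_left_mono) (auto simp: Suc_diff_le err_term_le_Suc)
    also have "\<dots> \<le> (\<Sum>i\<le>Suc k. err_term N i p * err_term N (Suc k - i) q)"
      by (intro sum_mono2) auto
    finally show "g p q \<le> real N * (\<Sum>i\<le>Suc k. err_term N i p * err_term N (Suc k - i) q)"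
      by (intro order_trans[OF N] mult_left_mono) auto
  qed
qed

definition shifted :: "nat \<Rightarrow> nat \<Rightarrow> (nat \<Rightarrow> nat \<Rightarrow> 'a::zero) \<Rightarrow> nat \<Rightarrow> nat \<Rightarrow> 'a" where
  "shifted a b g p q = (if a \<le> p \<and> b \<le> q then g (p - a) (q - b) else 0)"

lemma err_bounded_shift:
  assumes "err_bounded k g"
  shows "err_bounded k (shifted a b g)"
proof -
  obtain N where N: "\<And>p q. g p q \<le> real N * (\<Sum>i\<le>k. err_term N i p * err_term N (k - i) q)"
    using assms(1) by (auto simp: err_bounded_def)
  show ?thesis
  proof (rule err_boundedI[of _ "N + a + b"])
    fix p q
    let ?M = "N + a + b"
    let ?T = "\<Sum>i\<le>k. err_term ?M i p * err_term ?M (k - i) q"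
    have T: "0 \<le> ?T" by (intro sum_nonneg) auto
    have "err_term N i (p - a) \<le> err_term ?M i p" for i
      by (rule order_trans[OF err_term_shift err_term_mono]) auto
    moreover have "err_term N i (q - b) \<le> err_term ?M i q" for i
      by (rule order_trans[OF err_term_shift err_term_mono]) auto
    ultimately have "(\<Sum>i\<le>k. err_term N i (p - a) * err_term N (k - i) (q - b)) \<le> ?T"
      by (intro sum_mono mult_mono) auto
    then have "real N * (\<Sum>i\<le>k. err_term N i (p - a) * err_term N (k - i) (q - b)) \<le> real ?M * ?T"
      by (intro mult_mono) (auto intro!: sum_nonneg)
    then have "g (p - a) (q - b) \<le> real ?M * ?T"
      using N[of "p - a" "q - b"] by linarith
    then show "shifted a b g p q \<le> real ?M * ?T"
      using T by (auto simp: shifted_def)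
  qed
qed

lemma geo_coeff_le_err_term: "real (geo_coeff i p) \<le> err_term N i p"
proof (cases i)
  case (Suc k)
  have "real (geo_coeff i p) \<le> real ((p + 1) ^ k)"
    unfolding Suc by (intro of_nat_mono geo_coeff_le_power)
  then show ?thesis by (simp add: Suc err_term_def add.commute)
qed (auto simp: err_term_def)

lemma err_bounded_geo:
  "err_bounded (i + j) (\<lambda>p q. real (geo_coeff i p * geo_coeff j q))"
proof (rule err_boundedI[of _ 1])
  fix p q
  have "real (geo_coeff i p * geo_coeff j q) \<le> err_term 1 i p * err_term 1 (i + j - i) q"
    by (simp add: mult_mono geo_coeff_le_err_term)
  also have "\<dots> \<le> (\<Sum>k\<le>i + j. err_term 1 k p * err_term 1 (i + j - k) q)"
    by (rule member_le_sum) auto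
  finally show "real (geo_coeff i p * geo_coeff j q) \<le> real 1 * (\<Sum>k\<le>i + j. err_term 1 k p * err_term 1 (i + j - k) q)"
    by simp
qed

lemma err_bounded_geo_le:
  assumes "i + j \<le> k"
  shows "err_bounded k (\<lambda>p q. real (geo_coeff i p * geo_coeff j q))"
  using assms by (induction k rule: dec_induct) (auto intro: err_bounded_Suc err_bounded_geo simp del: of_nat_mult)

text \<open>Since (1-t) (1-t)^-i = (1-t)^-(i-1), the difference with the unit shift is again a pole,
  of order one less.\<close>

lemma err_bounded_geo_fst_step:
  assumes "1 \<le> i" 
  shows "err_bounded (i + j - 1) (\<lambda>p q. real (geo_coeff i p * geo_coeff j q) - shifted 1 0 (\<lambda>p q. real (geo_coeff i p * geo_coeff j q)) p q)"
proof -
  obtain k where k: "i = Suc k" using assms by (cases i) auto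
  have "real (geo_coeff i p * geo_coeff j q) - shifted 1 0 (\<lambda>p q. real (geo_coeff i p * geo_coeff j q)) p q
    = real (geo_coeff k p * geo_coeff j q)" for p q
    by (cases p) (auto simp: shifted_def k algebra_simps)
  then show ?thesis
    using err_bounded_geo[of k j] by (simp add: k del: of_nat_mult)
qed

text \<open>A shift by (a, b) telescopes into unit shifts, each costing a term of lower order. Both
  i and j have to be positive: shifting a series without t-pole in the direction of t is not a small
  change.\<close>

lemma err_bounded_geo_shift:
  assumes "1 \<le> i" "1 \<le> j"
  shows "err_bounded (i + j - 1) (\<lambda>p q. real (geo_coeff i p * geo_coeff j q) - shifted a b (\<lambda>p q. real (geo_coeff i p * geo_coeff j q)) p q)"
proof -
  let ?g = "\<lambda>p q. real (geo_coeff i p * geo_coeff j q)"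
  have fst: "err_bounded (i + j - 1) (\<lambda>p q. ?g p q - shifted a 0 ?g p q)" for a
  proof (induction a)
    case 0
    then show ?case by (simp add: shifted_def)
  next
    case (Suc a)
    have "?g p q - shifted (Suc a) 0 ?g p q = (?g p q - shifted a 0 ?g p q) + shifted a 0 (\<lambda>p q. ?g p q - shifted 1 0 ?g p q) p q" for p q
      by (auto simp: shifted_def not_le less_Suc_eq_le Suc_le_eq)
    moreover have "err_bounded (i + j - 1) (shifted a 0 (\<lambda>p q. ?g p q - shifted 1 0 ?g p q))"
      using err_bounded_shift[OF err_bounded_geo_fst_step[OF assms(1), of j], of a 0] .
    ultimately show ?case using err_bounded_add[OF Suc] by presburger
  qed
  have snd1: "err_bounded (i + j - 1) (\<lambda>p q. ?g p q - shifted 0 1 ?g p q)"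
    using err_bounded_swap[OF err_bounded_geo_fst_step[OF assms(2), of i]]
    by (simp add: shifted_def[abs_def] add.commute mult.commute)
  have snd: "err_bounded (i + j - 1) (\<lambda>p q. ?g p q - shifted 0 b ?g p q)" for b
  proof (induction b)
    case 0
    then show ?case by (simp add: shifted_def)
  next
    case (Suc b)
    have "?g p q - shifted 0 (Suc b) ?g p q = (?g p q - shifted 0 b ?g p q) + shifted 0 b (\<lambda>p q. ?g p q - shifted 0 1 ?g p q) p q" for p q
      by (auto simp: shifted_def not_le less_Suc_eq_le Suc_le_eq)
    moreover have "err_bounded (i + j - 1) (shifted 0 b (\<lambda>p q. ?g p q - shifted 0 1 ?g p q))"
      using err_bounded_shift[OF snd1, of 0 b] .
    ultimately show ?case using err_bounded_add[OF Suc] by presburger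
  qed
  have "?g p q - shifted a b ?g p q = (?g p q - shifted a 0 ?g p q) + shifted a 0 (\<lambda>p q. ?g p q - shifted 0 b ?g p q) p q" for p q
    by (auto simp: shifted_def)
  moreover have "err_bounded (i + j - 1) (shifted a 0 (\<lambda>p q. ?g p q - shifted 0 b ?g p q))"
    by (rule err_bounded_shift[OF snd])
  ultimately show ?thesis using err_bounded_add[OF fst] by presburger
qed

section \<open>Series with poles along \<open>t = 1\<close> and \<open>u = 1\<close>\<close>

definition pole :: "nat \<Rightarrow> nat \<Rightarrow> rat fps fps" where
  "pole i j = Abs_fps (\<lambda>p. Abs_fps (\<lambda>q. of_nat (geo_coeff i p * geo_coeff j q)))"

lemma var_t_mult_nth: "fps_nth (var_t * g) p = (if p = 0 then 0 else fps_nth g (p - 1))"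
  by (simp add: var_t_def)

lemma var_u_mult_nth: "fps_nth (fps_nth (var_u * g) p) q = (if q = 0 then 0 else fps_nth (fps_nth g p) (q - 1))"
  by (simp add: var_u_def)

lemma var_t_pole: "var_t * pole (Suc i) j = pole (Suc i) j - pole i j"
proof (intro fps_ext)
  fix p q
  show "fps_nth (fps_nth (var_t * pole (Suc i) j) p) q = fps_nth (fps_nth (pole (Suc i) j - pole i j) p) q"
    unfolding fps_sub_nth var_t_mult_nth by (cases p) (simp_all add: pole_def algebra_simps)
qed

lemma var_u_pole: "var_u * pole i (Suc j) = pole i (Suc j) - pole i j"
proof (intro fps_ext)
  fix p q
  show "fps_nth (fps_nth (var_u * pole i (Suc j)) p) q = fps_nth (fps_nth (pole i (Suc j) - pole i j) p) q"
    unfolding fps_sub_nth var_u_mult_nth by (cases q) (simp_all add: pole_def algebra_simps)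
qed

lemma pole_0_0: "pole 0 0 = 1"
  by (intro fps_ext) (auto simp: pole_def)

lemma pole_mult: "pole i j * ((1 - var_t) ^ i * (1 - var_u) ^ j) = 1"
proof (induction i arbitrary: j)
  case 0
  show ?case
  proof (induction j)
    case (Suc j)
    have "pole 0 (Suc j) * (1 - var_u) = pole 0 j"
      using var_u_pole[of 0 j] by (simp add: algebra_simps)
    then show ?case using Suc by (metis (no_types, lifting) mult.assoc mult.commute power_Suc power_0 mult_1_left)
  qed (simp add: pole_0_0)
next
  case (Suc i)
  have "pole (Suc i) j * (1 - var_t) = pole i j"
    using var_t_pole[of i j] by (simp add: algebra_simps)
  then have "pole (Suc i) j * ((1 - var_t) ^ Suc i * (1 - var_u) ^ j) = pole i j * ((1 - var_t) ^ i * (1 - var_u) ^ j)"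
    by (metis (no_types, lifting) mult.assoc power_Suc)
  then show ?case using Suc by simp
qed

lemma inverse_eq_pole: "inverse ((1 - var_t) ^ i * (1 - var_u) ^ j) = pole i j"
proof -
  let ?h = "(1 - var_t) ^ i * (1 - var_u) ^ j :: rat fps fps"
  have "inverse ?h = inverse ?h * (pole i j * ?h)" by (simp add: pole_mult)
  also have "\<dots> = pole i j * (inverse ?h * ?h)" by (simp only: ac_simps)
  finally show ?thesis by (simp add: inverse_pole)
qed

lemma monomial_mult_nth:
  "fps_nth (fps_nth (var_t ^ a * (var_u ^ b * g)) p) q = shifted a b (\<lambda>p q. fps_nth (fps_nth g p) q) p q"
proof -
  have u: "fps_nth (fps_nth (var_u ^ b * g) p) q = shifted 0 b (\<lambda>p q. fps_nth (fps_nth g p) q) p q" for p q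
    by (induction b arbitrary: q)
      (auto simp: shifted_def mult.assoc var_u_mult_nth Suc_le_eq not_le split: nat_diff_split)
  have "fps_nth (fps_nth (var_t ^ a * h) p) q = shifted a 0 (\<lambda>p q. fps_nth (fps_nth h p) q) p q" for h p
    by (induction a arbitrary: p)
      (auto simp: shifted_def mult.assoc var_t_mult_nth Suc_le_eq not_le split: nat_diff_split)
  then show ?thesis by (auto simp: u shifted_def)
qed

definition pole_sum :: "nat \<Rightarrow> (nat \<Rightarrow> nat \<Rightarrow> rat fps fps) \<Rightarrow> rat fps fps" where
  "pole_sum n c = (\<Sum>(i, j)\<in>{(i, j). i + j < n}. c i j * pole i j)"

lemma pole_order_less_altdef:
  "pole_order_less n Q \<longleftrightarrow>
     (\<exists>c. (\<forall>i\<ge>1. \<forall>j\<ge>1. c i j \<in> \<int>) \<and> (\<forall>j\<ge>1. c 0 j \<in> int_polys_t) \<and>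
        (\<forall>i\<ge>1. c i 0 \<in> int_polys_u) \<and> c 0 0 \<in> int_polys_tu \<and> Q = pole_sum n c)"
  unfolding pole_order_less_def pole_sum_def inverse_eq_pole ..

lemma int_poly_hom_add:
  "fps_of_poly (map_poly of_int (P + Q)) = (fps_of_poly (map_poly of_int P) + fps_of_poly (map_poly of_int Q) :: 'a::comm_ring_1 fps)"
  by (intro fps_ext) (simp add: coeff_map_poly)

lemma int_poly_hom_uminus:
  "fps_of_poly (map_poly of_int (- P)) = - (fps_of_poly (map_poly of_int P) :: 'a::comm_ring_1 fps)"
  by (intro fps_ext) (simp add: coeff_map_poly)

lemma int_polys_t_add: "x \<in> int_polys_t \<Longrightarrow> y \<in> int_polys_t \<Longrightarrow> x + y \<in> int_polys_t"
  unfolding int_polys_t_def by (auto simp flip: int_poly_hom_add)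

lemma int_polys_t_uminus: "x \<in> int_polys_t \<Longrightarrow> - x \<in> int_polys_t"
  unfolding int_polys_t_def by (auto simp flip: int_poly_hom_uminus)

lemma int_polys_u_add: "x \<in> int_polys_u \<Longrightarrow> y \<in> int_polys_u \<Longrightarrow> x + y \<in> int_polys_u"
  unfolding int_polys_u_def by (auto simp flip: int_poly_hom_add)

lemma int_polys_u_uminus: "x \<in> int_polys_u \<Longrightarrow> - x \<in> int_polys_u"
  unfolding int_polys_u_def by (auto simp flip: int_poly_hom_uminus)

lemma int_polys_tu_add:
  assumes "x \<in> int_polys_tu" "y \<in> int_polys_tu"
  shows "x + y \<in> int_polys_tu"
proof -
  let ?h = "\<lambda>q :: int poly. fps_of_poly (map_poly of_int q) :: rat fps"
  obtain P Q where PQ: "x = fps_of_poly (map_poly ?h P)" "y = fps_of_poly (map_poly ?h Q)"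
    using assms unfolding int_polys_tu_def by blast
  have "x + y = fps_of_poly (map_poly ?h (P + Q))"
    unfolding PQ by (intro fps_ext) (simp add: coeff_map_poly int_poly_hom_add)
  then show ?thesis unfolding int_polys_tu_def by blast
qed

lemma int_polys_tu_uminus:
  assumes "x \<in> int_polys_tu"
  shows "- x \<in> int_polys_tu"
proof -
  let ?h = "\<lambda>q :: int poly. fps_of_poly (map_poly of_int q) :: rat fps"
  obtain P where P: "x = fps_of_poly (map_poly ?h P)"
    using assms unfolding int_polys_tu_def by blast
  have "- x = fps_of_poly (map_poly ?h (- P))"
    unfolding P by (intro fps_ext) (simp add: coeff_map_poly int_poly_hom_uminus)
  then show ?thesis unfolding int_polys_tu_def by blast
qed

lemma fps_of_int_monom: "fps_of_poly (map_poly of_int (monom 1 b)) = (fps_X ^ b :: rat fps)"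
  by (intro fps_ext) (auto simp: coeff_map_poly)

lemma monomial_in_int_polys:
  "var_t ^ a \<in> int_polys_t" "var_u ^ b \<in> int_polys_u" "var_t ^ a * var_u ^ b \<in> int_polys_tu"
proof -
  have "var_t ^ a = fps_of_poly (map_poly of_int (monom 1 a))"
    by (intro fps_ext) (auto simp: coeff_map_poly var_t_def)
  then show "var_t ^ a \<in> int_polys_t" unfolding int_polys_t_def by blast
  have u: "var_u ^ b = fps_const (fps_X ^ b)" by (simp add: var_u_def fps_const_power)
  then show "var_u ^ b \<in> int_polys_u"
    unfolding int_polys_u_def fps_of_int_monom[symmetric] by blast
  have "var_t ^ a * var_u ^ b = fps_of_poly (map_poly (\<lambda>q. fps_of_poly (map_poly of_int q)) (monom (monom 1 b :: int poly) a))"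
    by (intro fps_ext) (auto simp: coeff_map_poly var_t_def u fps_of_int_monom)
  then show "var_t ^ a * var_u ^ b \<in> int_polys_tu" unfolding int_polys_tu_def by blast
qed

lemma zero_in_int_polys: "0 \<in> int_polys_t" "0 \<in> int_polys_u" "0 \<in> int_polys_tu"
  using int_polys_t_add[OF monomial_in_int_polys(1)[of 0] int_polys_t_uminus[OF monomial_in_int_polys(1)[of 0]]]
    int_polys_u_add[OF monomial_in_int_polys(2)[of 0] int_polys_u_uminus[OF monomial_in_int_polys(2)[of 0]]]
    int_polys_tu_add[OF monomial_in_int_polys(3)[of 0 0] int_polys_tu_uminus[OF monomial_in_int_polys(3)[of 0 0]]]
  by simp_all

lemma pole_order_less_add:
  assumes "pole_order_less n Q" "pole_order_less n Q'"
  shows "pole_order_less n (Q + Q')"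
proof -
  obtain c c' where
    c: "\<forall>i\<ge>1. \<forall>j\<ge>1. c i j \<in> \<int>" "\<forall>j\<ge>1. c 0 j \<in> int_polys_t" "\<forall>i\<ge>1. c i 0 \<in> int_polys_u" "c 0 0 \<in> int_polys_tu" "Q = pole_sum n c"
    and c': "\<forall>i\<ge>1. \<forall>j\<ge>1. c' i j \<in> \<int>" "\<forall>j\<ge>1. c' 0 j \<in> int_polys_t" "\<forall>i\<ge>1. c' i 0 \<in> int_polys_u" "c' 0 0 \<in> int_polys_tu" "Q' = pole_sum n c'"
    using assms unfolding pole_order_less_altdef by blast
  have "Q + Q' = pole_sum n (\<lambda>i j. c i j + c' i j)"
    by (simp add: c(5) c'(5) pole_sum_def case_prod_unfold sum.distrib algebra_simps)
  then show ?thesis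
    unfolding pole_order_less_altdef using c c'
    by (intro exI[of _ "\<lambda>i j. c i j + c' i j"]) (auto intro: int_polys_t_add int_polys_u_add int_polys_tu_add)
qed

lemma pole_order_less_uminus:
  assumes "pole_order_less n Q"
  shows "pole_order_less n (- Q)"
proof -
  obtain c where
    c: "\<forall>i\<ge>1. \<forall>j\<ge>1. c i j \<in> \<int>" "\<forall>j\<ge>1. c 0 j \<in> int_polys_t" "\<forall>i\<ge>1. c i 0 \<in> int_polys_u" "c 0 0 \<in> int_polys_tu" "Q = pole_sum n c"
    using assms unfolding pole_order_less_altdef by blast
  have "- Q = pole_sum n (\<lambda>i j. - c i j)"
    by (simp add: c(5) pole_sum_def case_prod_unfold sum_negf)
  then show ?thesis
    unfolding pole_order_less_altdef using c
    by (intro exI[of _ "\<lambda>i j. - c i j"]) (auto intro: int_polys_t_uminus int_polys_u_uminus int_polys_tu_uminus)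
qed

lemma pole_order_less_diff:
  "pole_order_less n Q \<Longrightarrow> pole_order_less n Q' \<Longrightarrow> pole_order_less n (Q - Q')"
  using pole_order_less_add[OF _ pole_order_less_uminus] by fastforce

lemma finite_pairs_less: "finite {(i, j). i + j < (n::nat)}"
  by (rule finite_subset[of _ "{..<n} \<times> {..<n}"]) auto

lemma pole_order_less_zero: "pole_order_less n 0"
  unfolding pole_order_less_altdef
  by (intro exI[of _ "\<lambda>_ _. 0"]) (auto simp: pole_sum_def zero_in_int_polys)

lemma pole_order_less_sum_list:
  "(\<And>x. x \<in> set xs \<Longrightarrow> pole_order_less n (g x)) \<Longrightarrow> pole_order_less n (sum_list (map g xs))"
  by (induction xs) (auto intro: pole_order_less_zero pole_order_less_add)

text \<open>The terms already in normal form: a power of t may stand in the coefficient only if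
  there is no pole in t, and likewise for u.\<close>

lemma pole_order_less_reduced:
  assumes "i + j < n" "i \<ge> 1 \<Longrightarrow> a = 0" "j \<ge> 1 \<Longrightarrow> b = 0"
  shows "pole_order_less n (var_t ^ a * (var_u ^ b * pole i j))"
proof -
  let ?c = "\<lambda>i' j'. if i' = i \<and> j' = j then var_t ^ a * var_u ^ b else 0"
  have "pole_sum n ?c = (\<Sum>x\<in>{(i, j). i + j < n}. if x = (i, j) then var_t ^ a * var_u ^ b * pole i j else 0)"
    unfolding pole_sum_def by (intro sum.cong) (auto split: if_splits)
  also have "\<dots> = var_t ^ a * (var_u ^ b * pole i j)"
    using assms(1) by (simp add: finite_pairs_less mult.assoc)
  finally show ?thesis
    unfolding pole_order_less_altdef using assms monomial_in_int_polys(1)[of a] monomial_in_int_polys(2)[of b]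
      monomial_in_int_polys(3)[of a b] zero_in_int_polys
    by (intro exI[of _ ?c]) auto
qed

text \<open>Numerators are cleared by t/(1-t)^i = 1/(1-t)^i - 1/(1-t)^(i-1), which lowers a + b and
  never raises a pole order. This stops when, in each variable, the pole or the exponent is
  gone.\<close>

lemma pole_order_less_monomial:
  assumes "i + j < n"
  shows "pole_order_less n (var_t ^ a * (var_u ^ b * pole i j))"
  using assms
proof (induction "a + b" arbitrary: a b i j rule: less_induct)
  case less
  show ?case
  proof (cases "i \<ge> 1 \<and> a \<ge> 1")
    case True
    then obtain i' a' where ia: "i = Suc i'" "a = Suc a'" by (metis Suc_le_D One_nat_def)
    have "var_t ^ a * (var_u ^ b * pole i j) = var_t ^ a' * (var_u ^ b * (var_t * pole i j))"
      by (simp add: ia ac_simps)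
    also have "\<dots> = var_t ^ a' * (var_u ^ b * pole i j) - var_t ^ a' * (var_u ^ b * pole i' j)"
      unfolding ia var_t_pole by (simp add: algebra_simps)
    finally show ?thesis using less by (auto intro!: pole_order_less_diff simp: ia)
  next
    case 1: False
    show ?thesis
    proof (cases "j \<ge> 1 \<and> b \<ge> 1")
      case True
      then obtain j' b' where jb: "j = Suc j'" "b = Suc b'" by (metis Suc_le_D One_nat_def)
      have "var_t ^ a * (var_u ^ b * pole i j) = var_t ^ a * (var_u ^ b' * (var_u * pole i j))"
        by (simp add: jb ac_simps)
      also have "\<dots> = var_t ^ a * (var_u ^ b' * pole i j) - var_t ^ a * (var_u ^ b' * pole i j')"
        unfolding jb var_u_pole by (simp add: algebra_simps)
      finally show ?thesis using less by (auto intro!: pole_order_less_diff simp: jb)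
    next
      case False
      with 1 less.prems show ?thesis by (intro pole_order_less_reduced) auto
    qed
  qed
qed

text \<open>Clearing the numerator of a term of full order leaves the bare pole and terms of lower
  order. The argument needs poles in both variables, since otherwise a power of t or u stays in the
  coefficient.\<close>

lemma pole_order_less_monomial_diff:
  assumes "i \<ge> 1" "j \<ge> 1" "i + j \<le> n"
  shows "pole_order_less n (var_t ^ a * (var_u ^ b * pole i j) - pole i j)"
proof -
  obtain i' j' where ij: "i = Suc i'" "j = Suc j'" using assms by (metis Suc_le_D One_nat_def)
  have u: "pole_order_less n (var_u ^ b * pole i j - pole i j)"
  proof (induction b)
    case (Suc b)
    have "var_u ^ Suc b * pole i j = var_u ^ b * (var_u * pole i j)"
      by (simp add: ac_simps)
    also have "\<dots> = var_u ^ b * pole i j - var_u ^ b * pole i j'"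
      unfolding ij var_u_pole by (simp add: algebra_simps)
    finally have "var_u ^ Suc b * pole i j - pole i j = (var_u ^ b * pole i j - pole i j) - var_u ^ b * pole i j'"
      by simp
    moreover have "pole_order_less n (var_t ^ 0 * (var_u ^ b * pole i j'))"
      using assms by (intro pole_order_less_monomial) (simp add: ij)
    ultimately show ?case using Suc by (metis pole_order_less_diff power_0 mult_1_left)
  qed (simp add: pole_order_less_zero)
  show ?thesis
  proof (induction a)
    case 0
    then show ?case using u by simp
  next
    case (Suc a)
    have "var_t ^ Suc a * (var_u ^ b * pole i j) = var_t ^ a * (var_u ^ b * (var_t * pole i j))"
      by (simp add: ac_simps)
    also have "\<dots> = var_t ^ a * (var_u ^ b * pole i j) - var_t ^ a * (var_u ^ b * pole i' j)"
      unfolding ij var_t_pole by (simp add: algebra_simps)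
    finally have "var_t ^ Suc a * (var_u ^ b * pole i j) - pole i j
      = (var_t ^ a * (var_u ^ b * pole i j) - pole i j) - var_t ^ a * (var_u ^ b * pole i' j)"
      by simp
    moreover have "pole_order_less n (var_t ^ a * (var_u ^ b * pole i' j))"
      using assms by (intro pole_order_less_monomial) (simp add: ij)
    ultimately show ?case using Suc by (metis pole_order_less_diff)
  qed
qed

section \<open>Dickson's lemma and Stanley decompositions\<close>

definition exponents :: "nat \<Rightarrow> (nat \<Rightarrow> nat) set" where
  "exponents m = {\<alpha>. \<forall>k\<ge>m. \<alpha> k = 0}"

lemma exponents_drop: "\<alpha> \<in> exponents (Suc m) \<Longrightarrow> \<alpha>(m := 0) \<in> exponents m"
  by (simp add: exponents_def)

text \<open>Induction on the number of variables, slicing by the last exponent. The finite set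
  \<open>H\<close> bounds the union of all slices from below, and each of its members occurs at some
  height. Heights above the largest of these are served by \<open>H\<close>, the finitely many
  others by their own sets \<open>G k\<close>.\<close>

lemma dickson: "\<exists>G. finite G \<and> G \<subseteq> U \<and> (\<forall>\<alpha>\<in>U. \<exists>\<gamma>\<in>G. \<gamma> \<le> \<alpha>)" if "U \<subseteq> exponents m"
  using that
proof (induction m arbitrary: U)
  case 0
  then have "U \<subseteq> {\<lambda>_. 0}" by (auto simp: exponents_def)
  then show ?case by (intro exI[of _ U]) (auto intro: finite_subset)
next
  case (Suc m)
  define slice where "slice k = {\<alpha> \<in> exponents m. \<alpha>(m := k) \<in> U}" for k
  have "\<exists>G. finite G \<and> G \<subseteq> slice k \<and> (\<forall>\<alpha>\<in>slice k. \<exists>\<gamma>\<in>G. \<gamma> \<le> \<alpha>)" for k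
    by (rule Suc.IH) (auto simp: slice_def)
  then have "\<forall>k. \<exists>G. finite G \<and> G \<subseteq> slice k \<and> (\<forall>\<alpha>\<in>slice k. \<exists>\<gamma>\<in>G. \<gamma> \<le> \<alpha>)" ..
  from choice[OF this] obtain G where
    G': "\<forall>k. finite (G k) \<and> G k \<subseteq> slice k \<and> (\<forall>\<alpha>\<in>slice k. \<exists>\<gamma>\<in>G k. \<gamma> \<le> \<alpha>)" ..
  have G: "\<And>k. finite (G k)" "\<And>k. G k \<subseteq> slice k" "\<And>k \<alpha>. \<alpha> \<in> slice k \<Longrightarrow> \<exists>\<gamma>\<in>G k. \<gamma> \<le> \<alpha>"
    using G' by simp_all
  have "(\<Union>k. slice k) \<subseteq> exponents m" by (auto simp: slice_def)
  from Suc.IH[OF this] obtain H where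
    H': "finite H \<and> H \<subseteq> (\<Union>k. slice k) \<and> (\<forall>\<alpha>\<in>\<Union>k. slice k. \<exists>\<gamma>\<in>H. \<gamma> \<le> \<alpha>)" ..
  note H = H'[THEN conjunct1] H'[THEN conjunct2, THEN conjunct1] H'[THEN conjunct2, THEN conjunct2]
  have "\<forall>\<gamma>\<in>H. \<exists>k. \<gamma> \<in> slice k" using H(2) by blast
  from bchoice[OF this] obtain h where h': "\<forall>\<gamma>\<in>H. \<gamma> \<in> slice (h \<gamma>)" ..
  then have h: "\<gamma> \<in> slice (h \<gamma>)" if "\<gamma> \<in> H" for \<gamma> using that ..
  define K where "K = Max (insert 0 (h ` H))"
  have K: "h \<gamma> \<le> K" if "\<gamma> \<in> H" for \<gamma>
    unfolding K_def using H(1) that by (intro Max_ge) auto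
  define GG where "GG = (\<Union>k\<le>K. (\<lambda>\<gamma>. \<gamma>(m := k)) ` G k) \<union> (\<lambda>\<gamma>. \<gamma>(m := h \<gamma>)) ` H"
  have "finite GG" unfolding GG_def using G(1) H(1) by auto
  moreover have "GG \<subseteq> U" unfolding GG_def using G(2) h by (auto simp: slice_def)
  moreover have "\<exists>\<gamma>\<in>GG. \<gamma> \<le> \<alpha>" if "\<alpha> \<in> U" for \<alpha>
  proof -
    have \<alpha>: "\<alpha>(m := 0) \<in> slice (\<alpha> m)"
      using that Suc.prems exponents_drop[of \<alpha> m] by (auto simp: slice_def)
    show ?thesis
    proof (cases "\<alpha> m \<le> K")
      case True
      obtain \<gamma> where \<gamma>: "\<gamma> \<in> G (\<alpha> m)" "\<gamma> \<le> \<alpha>(m := 0)" using G(3)[OF \<alpha>] by blast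
      have "\<gamma>(m := \<alpha> m) \<le> \<alpha>" using \<gamma>(2) by (auto simp: le_fun_def split: if_splits)
      then show ?thesis using \<gamma>(1) True unfolding GG_def by blast
    next
      case False
      obtain \<gamma> where \<gamma>: "\<gamma> \<in> H" "\<gamma> \<le> \<alpha>(m := 0)" using H(3) \<alpha> by blast
      have "\<gamma>(m := h \<gamma>) \<le> \<alpha>" using \<gamma> K[of \<gamma>] False by (auto simp: le_fun_def split: if_splits)
      then show ?thesis using \<gamma>(1) unfolding GG_def by blast
    qed
  qed
  ultimately show ?case by blast
qed

definition down_closed :: "nat \<Rightarrow> (nat \<Rightarrow> nat) set \<Rightarrow> bool" where
  "down_closed m D \<longleftrightarrow> D \<subseteq> exponents m \<and> (\<forall>\<alpha>\<in>D. \<forall>\<beta>. \<beta> \<le> \<alpha> \<longrightarrow> \<beta> \<in> D)"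

lemma down_closedD: "down_closed m D \<Longrightarrow> \<alpha> \<in> D \<Longrightarrow> \<beta> \<le> \<alpha> \<Longrightarrow> \<beta> \<in> D"
  by (auto simp: down_closed_def)

text \<open>Finitely many exponents bound the union of all complements from below, and each of them
  is excluded from some level on. Beyond the last of these levels nothing more can be removed, as
  the sets are down-closed.\<close>

lemma down_closed_chain_stabilizes:
  fixes D :: "nat \<Rightarrow> (nat \<Rightarrow> nat) set"
  assumes "\<And>k. down_closed m (D k)" and "\<And>k k'. k \<le> k' \<Longrightarrow> D k' \<subseteq> D k"
  shows "\<exists>K. \<forall>k\<ge>K. D k = D K"
proof -
  have "(\<Union>k. exponents m - D k) \<subseteq> exponents m" by auto
  from dickson[OF this] obtain G where
    G': "finite G \<and> G \<subseteq> (\<Union>k. exponents m - D k) \<and>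
      (\<forall>\<alpha>\<in>\<Union>k. exponents m - D k. \<exists>\<gamma>\<in>G. \<gamma> \<le> \<alpha>)" ..
  note G = G'[THEN conjunct1] G'[THEN conjunct2, THEN conjunct1] G'[THEN conjunct2, THEN conjunct2]
  have "\<forall>\<gamma>\<in>G. \<exists>k. \<gamma> \<in> exponents m - D k" using G(2) by blast
  from bchoice[OF this] obtain h where h': "\<forall>\<gamma>\<in>G. \<gamma> \<in> exponents m - D (h \<gamma>)" ..
  then have h: "\<gamma> \<in> exponents m - D (h \<gamma>)" if "\<gamma> \<in> G" for \<gamma> using that ..
  define K where "K = Max (insert 0 (h ` G))"
  have K: "h \<gamma> \<le> K" if "\<gamma> \<in> G" for \<gamma>
    unfolding K_def using G(1) that by (intro Max_ge) auto
  have "D k = D K" if k: "K \<le> k" for k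
  proof
    show "D k \<subseteq> D K" by (rule assms(2)[OF k])
    show "D K \<subseteq> D k"
    proof
      fix \<alpha> assume \<alpha>: "\<alpha> \<in> D K"
      show "\<alpha> \<in> D k"
      proof (rule ccontr)
        assume "\<alpha> \<notin> D k"
        then have "\<alpha> \<in> (\<Union>k. exponents m - D k)" using \<alpha> assms(1)[of K] by (auto simp: down_closed_def)
        with G(3) obtain \<gamma> where \<gamma>: "\<gamma> \<in> G" "\<gamma> \<le> \<alpha>" by blast
        have "\<gamma> \<in> D K" using \<alpha> \<gamma>(2) assms(1) by (auto simp: down_closed_def)
        then show False using h[OF \<gamma>(1)] assms(2)[OF K[OF \<gamma>(1)]] by auto
      qed
    qed
  qed
  then show ?thesis by blast
qed

section \<open>Finite sums of shifted poles and their closure properties\<close>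

type_synonym piece = "nat \<times> nat \<times> nat \<times> nat"

text \<open>The piece (a, b, i, j) stands for t^a u^b / ((1-t)^i (1-u)^j).\<close>

fun piece_count :: "piece \<Rightarrow> nat \<Rightarrow> nat \<Rightarrow> nat" where
  "piece_count (a, b, i, j) = shifted a b (\<lambda>p q. geo_coeff i p * geo_coeff j q)"

definition sum_of_pieces :: "(nat \<Rightarrow> nat \<Rightarrow> nat) \<Rightarrow> bool" where
  "sum_of_pieces g \<longleftrightarrow> (\<exists>ps. \<forall>p q. g p q = (\<Sum>x\<leftarrow>ps. piece_count x p q))"

lemma sum_of_pieces_add:
  assumes "sum_of_pieces g" "sum_of_pieces h"
  shows "sum_of_pieces (\<lambda>p q. g p q + h p q)"
proof -
  obtain ps qs where "\<forall>p q. g p q = (\<Sum>x\<leftarrow>ps. piece_count x p q)" "\<forall>p q. h p q = (\<Sum>x\<leftarrow>qs. piece_count x p q)"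
    using assms by (auto simp: sum_of_pieces_def)
  then show ?thesis unfolding sum_of_pieces_def by (intro exI[of _ "ps @ qs"]) simp
qed

lemma sum_of_pieces_zero: "sum_of_pieces (\<lambda>p q. 0)"
  unfolding sum_of_pieces_def by (intro exI[of _ "[]"]) simp

lemma sum_of_pieces_sum:
  "(\<And>i. i \<in> I \<Longrightarrow> sum_of_pieces (g i)) \<Longrightarrow> sum_of_pieces (\<lambda>p q. \<Sum>i\<in>I. g i p q)"
  by (induction I rule: infinite_finite_induct) (auto intro: sum_of_pieces_add sum_of_pieces_zero)

lemma sum_of_pieces_induct [consumes 1, case_names zero add]:
  assumes "sum_of_pieces g"
    and "P (\<lambda>p q. 0)"
    and "\<And>x h. P h \<Longrightarrow> P (\<lambda>p q. piece_count x p q + h p q)"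
  shows "P g"
proof -
  obtain ps where ps: "\<forall>p q. g p q = (\<Sum>x\<leftarrow>ps. piece_count x p q)"
    using assms(1) by (auto simp: sum_of_pieces_def)
  have "P (\<lambda>p q. \<Sum>x\<leftarrow>ps. piece_count x p q)"
    by (induction ps) (simp_all add: assms(2,3))
  moreover have "g = (\<lambda>p q. \<Sum>x\<leftarrow>ps. piece_count x p q)" using ps by (intro ext) simp
  ultimately show ?thesis by simp
qed

lemma sum_of_pieces_piece: "sum_of_pieces (piece_count x)"
  unfolding sum_of_pieces_def by (intro exI[of _ "[x]"]) simp

lemma sum_of_pieces_shifted:
  assumes "sum_of_pieces g"
  shows "sum_of_pieces (shifted a b g)"
  using assms
proof (induction rule: sum_of_pieces_induct)
  case zero
  then show ?case using sum_of_pieces_zero by (simp add: shifted_def[abs_def])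
next
  case (add x h)
  obtain a' b' i j where x: "x = (a', b', i, j)" by (cases x)
  have eq: "shifted a b (\<lambda>p q. piece_count x p q + h p q) = (\<lambda>p q. piece_count (a + a', b + b', i, j) p q + shifted a b h p q)"
    by (intro ext) (auto simp: x shifted_def add.commute)
  show ?case unfolding eq by (rule sum_of_pieces_add[OF sum_of_pieces_piece add])
qed

lemma sum_shifted_fst:
  "(\<Sum>p'\<le>p. shifted a b g p' q) = shifted a b (\<lambda>p q. \<Sum>p'\<le>p. g p' q) p q"
proof (cases "a \<le> p \<and> b \<le> q")
  case True
  have "(\<Sum>p'\<le>p. shifted a b g p' q) = (\<Sum>p'\<in>{a..p}. g (p' - a) (q - b))"
    by (rule sum.mono_neutral_cong_right) (use True in \<open>auto simp: shifted_def\<close>)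
  also have "\<dots> = (\<Sum>p'\<le>p - a. g p' (q - b))"
    by (rule sum.reindex_bij_witness[of _ "\<lambda>k. k + a" "\<lambda>k. k - a"]) (use True in auto)
  finally show ?thesis using True by (simp add: shifted_def)
next
  case False
  then show ?thesis by (auto simp: shifted_def intro!: sum.neutral)
qed

lemma sum_of_pieces_sum_fst:
  assumes "sum_of_pieces g"
  shows "sum_of_pieces (\<lambda>p q. \<Sum>p'\<le>p. g p' q)"
  using assms
proof (induction rule: sum_of_pieces_induct)
  case zero
  then show ?case using sum_of_pieces_zero by simp
next
  case (add x h)
  obtain a b i j where x: "x = (a, b, i, j)" by (cases x)
  have "(\<Sum>p'\<le>p. piece_count x p' q) = piece_count (a, b, Suc i, j) p q" for p q
    by (simp add: x sum_shifted_fst sum_distrib_right)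
  then have eq: "(\<lambda>p q. \<Sum>p'\<le>p. piece_count x p' q + h p' q) = (\<lambda>p q. piece_count (a, b, Suc i, j) p q + (\<Sum>p'\<le>p. h p' q))"
    by (simp add: sum.distrib)
  show ?case unfolding eq by (rule sum_of_pieces_add[OF sum_of_pieces_piece add])
qed

lemma sum_of_pieces_swap:
  assumes "sum_of_pieces g"
  shows "sum_of_pieces (\<lambda>p q. g q p)"
  using assms
proof (induction rule: sum_of_pieces_induct)
  case zero
  then show ?case by (rule sum_of_pieces_zero)
next
  case (add x h)
  obtain a b i j where x: "x = (a, b, i, j)" by (cases x)
  have eq: "(\<lambda>p q. piece_count x q p + h q p) = (\<lambda>p q. piece_count (b, a, j, i) p q + h q p)"
    by (intro ext) (auto simp: x shifted_def)
  show ?case unfolding eq by (rule sum_of_pieces_add[OF sum_of_pieces_piece add])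
qed

text \<open>The coefficients of \<Sum>k. t^k g_k for a family that is constant from K on: finitely
  many shifted summands and the tail t^K g_K / (1-t), which is where a new pole arises.\<close>

lemma sum_of_pieces_series:
  assumes "\<And>k. sum_of_pieces (g k)" "\<And>k. K \<le> k \<Longrightarrow> g k = g K"
  shows "sum_of_pieces (\<lambda>p q. \<Sum>k\<le>p. g k (p - k) q)"
proof -
  have "(\<Sum>k\<le>p. g k (p - k) q) = (\<Sum>k<K. shifted k 0 (g k) p q) + shifted K 0 (\<lambda>p q. \<Sum>p'\<le>p. g K p' q) p q" for p q
  proof -
    have "(\<Sum>k\<le>p. g k (p - k) q) = (\<Sum>k\<in>{..p} \<inter> {..<K}. g k (p - k) q) + (\<Sum>k\<in>{..p} - {..<K}. g k (p - k) q)"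
      by (subst sum.union_disjoint[symmetric]) (auto intro: sum.cong)
    also have "(\<Sum>k\<in>{..p} \<inter> {..<K}. g k (p - k) q) = (\<Sum>k<K. shifted k 0 (g k) p q)"
      by (rule sum.mono_neutral_cong_left) (auto simp: shifted_def)
    also have "(\<Sum>k\<in>{..p} - {..<K}. g k (p - k) q) = (\<Sum>k\<in>{K..p}. g K (p - k) q)"
    proof (rule sum.cong)
      fix k assume "k \<in> {K..p}"
      then show "g k (p - k) q = g K (p - k) q" using assms(2)[of k] by simp
    qed auto
    also have "\<dots> = shifted K 0 (\<lambda>p q. \<Sum>p'\<le>p. g K p' q) p q"
    proof (cases "K \<le> p")
      case True
      have "(\<Sum>k\<in>{K..p}. g K (p - k) q) = (\<Sum>p'\<le>p - K. g K p' q)"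
        by (rule sum.reindex_bij_witness[of _ "\<lambda>k. p - k" "\<lambda>k. p - k"]) (use True in auto)
      then show ?thesis using True by (simp add: shifted_def)
    qed (simp add: shifted_def)
    finally show ?thesis .
  qed
  then show ?thesis
    using assms(1) by (simp only:) (intro sum_of_pieces_add sum_of_pieces_sum sum_of_pieces_shifted sum_of_pieces_sum_fst; simp)
qed

text \<open>The first n variables carry the t-degree, the others the u-degree. The number m of
  variables is kept apart from n, so that an induction can remove the last variable.\<close>

definition bidegree_part :: "nat \<Rightarrow> nat \<Rightarrow> (nat \<Rightarrow> nat) set \<Rightarrow> nat \<Rightarrow> nat \<Rightarrow> (nat \<Rightarrow> nat) set" where
  "bidegree_part n m D p q = {\<alpha>\<in>D. (\<Sum>k\<in>{..<m} \<inter> {..<n}. \<alpha> k) = p \<and> (\<Sum>k\<in>{..<m} - {..<n}. \<alpha> k) = q}"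

lemma bidegree_part_exponents_finite: 
  assumes "D \<subseteq> exponents m"
  shows "finite (bidegree_part n m D p q)"
proof (rule finite_subset)
  have bd: "\<alpha> k \<le> p + q" if "\<alpha> \<in> bidegree_part n m D p q" for \<alpha> k
  proof (cases "k < m")
    case True
    have "\<alpha> k \<le> (\<Sum>k\<in>{..<m}. \<alpha> k)" using True by (intro member_le_sum) auto
    also have "\<dots> = p + q" using that unfolding bidegree_part_def
      by (subst sum.Int_Diff[of _ _ "{..<n}"]) auto
    finally show ?thesis .
  next
    case False
    then show ?thesis using that assms by (auto simp: bidegree_part_def exponents_def)
  qed
  show "bidegree_part n m D p q \<subseteq> {\<alpha>. \<forall>k. (k \<in> {..<m} \<longrightarrow> \<alpha> k \<in> {..p + q}) \<and> (k \<notin> {..<m} \<longrightarrow> \<alpha> k = 0)}"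
    using bd assms by (auto simp: bidegree_part_def exponents_def)
  show "finite {\<alpha>. \<forall>k. (k \<in> {..<m} \<longrightarrow> \<alpha> k \<in> {..p + q}) \<and> (k \<notin> {..<m} \<longrightarrow> \<alpha> k = 0)}"
    by (rule finite_set_of_finite_funs) auto
qed

lemma sum_fun_upd_notin: "m \<notin> A \<Longrightarrow> (\<Sum>k\<in>A. (\<alpha>(m := x)) k) = (\<Sum>k\<in>A. \<alpha> k)"
  by (intro sum.cong) auto

text \<open>Slicing by the last exponent gives a decreasing chain of down-closed sets in fewer
  variables. It stabilises, so the slices form a series with eventually constant terms, in t or in u
  according to the degree that the last variable carries.\<close>

lemma card_bidegree_part_down_closed:
  assumes "down_closed m D"
  shows "sum_of_pieces (\<lambda>p q. card (bidegree_part n m D p q))"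
  using assms
proof (induction m arbitrary: D)
  case 0
  have "D \<subseteq> {\<lambda>_. 0}" using 0 by (auto simp: down_closed_def exponents_def)
  then consider "D = {}" | "D = {\<lambda>_. 0}" by blast
  then show ?case
  proof cases
    case 1
    then show ?thesis by (simp add: bidegree_part_def sum_of_pieces_zero)
  next
    case 2
    have "(\<lambda>p q. card (bidegree_part n 0 D p q)) = piece_count (0, 0, 0, 0)"
      by (intro ext) (auto simp: bidegree_part_def 2 shifted_def)
    then show ?thesis by (simp only: sum_of_pieces_piece)
  qed
next
  case (Suc m)
  define E where "E k = {\<alpha> \<in> exponents m. \<alpha>(m := k) \<in> D}" for k
  have E_down: "down_closed m (E k)" for k
    unfolding down_closed_def
  proof (intro conjI ballI allI impI)
    fix \<alpha> \<beta> assume a: "\<alpha> \<in> E k" "\<beta> \<le> \<alpha>"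
    have "\<beta>(m := k) \<le> \<alpha>(m := k)" using a(2) by (auto simp: le_fun_def)
    moreover have "\<alpha>(m := k) \<in> D" using a(1) by (simp add: E_def)
    ultimately have "\<beta>(m := k) \<in> D" by (rule down_closedD[OF Suc.prems, rotated])
    moreover have "\<beta> j = 0" if "m \<le> j" for j
      using a(1) that le_funD[OF a(2), of j] by (simp add: E_def exponents_def)
    then have "\<beta> \<in> exponents m" by (simp add: exponents_def)
    ultimately show "\<beta> \<in> E k" by (simp add: E_def)
  qed (auto simp: E_def)
  have E_mono: "E k' \<subseteq> E k" if "k \<le> k'" for k k'
  proof
    fix \<alpha> assume a: "\<alpha> \<in> E k'"
    have "\<alpha>(m := k) \<le> \<alpha>(m := k')" using that by (auto simp: le_fun_def)
    then show "\<alpha> \<in> E k" using a down_closedD[OF Suc.prems] by (auto simp: E_def)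
  qed
  obtain K where K: "\<forall>k\<ge>K. E k = E K"
    using down_closed_chain_stabilizes[of m E, OF E_down E_mono] ..
  let ?g = "\<lambda>k p q. card (bidegree_part n m (E k) p q)"
  have gK: "?g k = ?g K" if "K \<le> k" for k using K[rule_format, OF that] by simp
  have g: "sum_of_pieces (?g k)" for k by (rule Suc.IH[OF E_down])
  have fin: "finite (bidegree_part n m (E k) p q)" for k p q
    by (rule bidegree_part_exponents_finite) (auto simp: E_def)
  have upd: "\<alpha>(m := 0) \<in> E (\<alpha> m)" if "\<alpha> \<in> D" for \<alpha>
    using that Suc.prems exponents_drop[of \<alpha> m] unfolding E_def down_closed_def by fastforce
  have memD: "\<alpha> \<in> D \<longleftrightarrow> \<alpha>(m := 0) \<in> E (\<alpha> m)" for \<alpha>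
    using upd[of \<alpha>] by (auto simp: E_def)
  have E0: "\<beta> m = 0" if "\<beta> \<in> bidegree_part n m (E k) p q" for \<beta> k p q
    using that by (simp add: bidegree_part_def E_def exponents_def)
  have upd_deg:
    "(\<Sum>k\<in>{..<m} \<inter> {..<n}. (\<alpha>(m := x)) k) = (\<Sum>k\<in>{..<m} \<inter> {..<n}. \<alpha> k)"
    "(\<Sum>k\<in>{..<m} - {..<n}. (\<alpha>(m := x)) k) = (\<Sum>k\<in>{..<m} - {..<n}. \<alpha> k)" for \<alpha> :: "nat \<Rightarrow> nat" and x
    by (intro sum_fun_upd_notin; simp)+
  \<comment> \<open>Stated for arbitrary \<open>A\<close>, \<open>B\<close> and \<open>r\<close>, to
    serve both kinds of last variable.\<close>
  have slices: "card A = (\<Sum>k\<le>r. card (B k))"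
    if mem: "\<And>\<alpha>. \<alpha> \<in> A \<longleftrightarrow> \<alpha> m \<le> r \<and> \<alpha>(m := 0) \<in> B (\<alpha> m)"
      and B: "\<And>k. finite (B k)" "\<And>k \<beta>. \<beta> \<in> B k \<Longrightarrow> \<beta> m = 0" for A B and r :: nat
  proof -
    have "bij_betw (\<lambda>(k, \<beta>). \<beta>(m := k)) (SIGMA k:{..r}. B k) A"
    proof (rule bij_betw_byWitness[where f' = "\<lambda>\<alpha>. (\<alpha> m, \<alpha>(m := 0))"])
      show "\<forall>x\<in>SIGMA k:{..r}. B k. (\<lambda>\<alpha>. (\<alpha> m, \<alpha>(m := 0))) ((\<lambda>(k, \<beta>). \<beta>(m := k)) x) = x"
      proof
        fix x assume "x \<in> (SIGMA k:{..r}. B k)"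
        then obtain k \<beta> where x: "x = (k, \<beta>)" and \<beta>: "\<beta> \<in> B k" by blast
        show "(\<lambda>\<alpha>. (\<alpha> m, \<alpha>(m := 0))) ((\<lambda>(k, \<beta>). \<beta>(m := k)) x) = x"
          using B(2)[OF \<beta>] by (simp add: x fun_upd_idem)
      qed
      show "(\<lambda>(k, \<beta>). \<beta>(m := k)) ` (SIGMA k:{..r}. B k) \<subseteq> A"
      proof
        fix x assume "x \<in> (\<lambda>(k, \<beta>). \<beta>(m := k)) ` (SIGMA k:{..r}. B k)"
        then obtain k \<beta> where x: "x = \<beta>(m := k)" "k \<le> r" and \<beta>: "\<beta> \<in> B k" by auto
        then show "x \<in> A"
          using B(2)[OF \<beta>] by (simp add: mem fun_upd_idem)
      qed
    qed (simp_all add: mem image_subset_iff)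
    then have "card A = card (SIGMA k:{..r}. B k)" by (simp add: bij_betw_same_card)
    also have "\<dots> = (\<Sum>k\<le>r. card (B k))" using B(1) by (intro card_SigmaI) auto
    finally show ?thesis .
  qed
  show ?case
  proof (cases "m < n")
    case True
    have s: "{..<Suc m} \<inter> {..<n} = insert m ({..<m} \<inter> {..<n})" "{..<Suc m} - {..<n} = {..<m} - {..<n}"
      using True by auto
    have "\<alpha> \<in> bidegree_part n (Suc m) D p q \<longleftrightarrow> \<alpha> m \<le> p \<and> \<alpha>(m := 0) \<in> bidegree_part n m (E (\<alpha> m)) (p - \<alpha> m) q" for \<alpha> p q
      unfolding bidegree_part_def mem_Collect_eq upd_deg memD s by auto
    then have eq: "card (bidegree_part n (Suc m) D p q) = (\<Sum>k\<le>p. ?g k (p - k) q)" for p q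
      by (rule slices[where B = "\<lambda>k. bidegree_part n m (E k) (p - k) q"]) (erule fin E0 | rule fin)+
    show ?thesis unfolding eq by (rule sum_of_pieces_series[of ?g K, OF g gK])
  next
    case False
    have s: "{..<Suc m} \<inter> {..<n} = {..<m} \<inter> {..<n}" "{..<Suc m} - {..<n} = insert m ({..<m} - {..<n})"
      using False by auto
    have "\<alpha> \<in> bidegree_part n (Suc m) D p q \<longleftrightarrow> \<alpha> m \<le> q \<and> \<alpha>(m := 0) \<in> bidegree_part n m (E (\<alpha> m)) p (q - \<alpha> m)" for \<alpha> p q
      unfolding bidegree_part_def mem_Collect_eq upd_deg memD s by auto
    then have eq: "card (bidegree_part n (Suc m) D p q) = (\<Sum>k\<le>q. ?g k p (q - k))" for p q
      by (rule slices[where B = "\<lambda>k. bidegree_part n m (E k) p (q - k)"]) (erule fin E0 | rule fin)+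
    have gK': "(\<lambda>p q. ?g k q p) = (\<lambda>p q. ?g K q p)" if "K \<le> k" for k
      using K[rule_format, OF that] by simp
    show ?thesis unfolding eq
      by (rule sum_of_pieces_swap[OF sum_of_pieces_series[of "\<lambda>k p q. ?g k q p" K, OF sum_of_pieces_swap[OF g] gK']])
  qed
qed

section \<open>Determining the terms of maximal pole order\<close>

lemma affine_over_linear_tendsto:
  "(\<lambda>s. (real l * real s + c) / real s) \<longlonglongrightarrow> real l"
proof -
  have "(\<lambda>s. real l + c * (1 / real s)) \<longlonglongrightarrow> real l + c * 0"
    by (intro tendsto_intros lim_1_over_n)
  moreover have "eventually (\<lambda>s. real l + c * (1 / real s) = (real l * real s + c) / real s) sequentially"
    using eventually_gt_at_top[of 0] by eventually_elim (simp add: field_simps)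
  ultimately show ?thesis by (auto intro: Lim_transform_eventually)
qed

text \<open>By the binomial formula \<open>geo_coeff (Suc i) p\<close> is a polynomial in p of
  degree i with leading coefficient 1/i!; a shift of the argument does not affect the limit.\<close>

lemma geo_coeff_tendsto:
  assumes "l \<ge> 1"
  shows "(\<lambda>s. real (geo_coeff (Suc i) (l * s - a)) / real s ^ i) \<longlonglongrightarrow> real l ^ i / fact i"
proof -
  have "(\<lambda>s. (\<Prod>k<i. (real l * real s + (real i - real a - real k)) / real s) / fact i) \<longlonglongrightarrow> (\<Prod>k<i. real l) / fact i"
    by (intro tendsto_intros affine_over_linear_tendsto) auto
  moreover have "eventually (\<lambda>s. (\<Prod>k<i. (real l * real s + (real i - real a - real k)) / real s) / fact i
      = real (geo_coeff (Suc i) (l * s - a)) / real s ^ i) sequentially"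
    using eventually_ge_at_top[of a]
  proof eventually_elim
    case (elim s)
    then have a: "a \<le> l * s" using assms by (metis le_trans mult_le_mono1 nat_mult_1)
    have "real (geo_coeff (Suc i) (l * s - a)) = (\<Prod>k<i. real (l * s - a + i) - real k) / fact i"
      unfolding geo_coeff_Suc_eq_binomial binomial_gbinomial gbinomial_prod_rev
      by (simp add: lessThan_atLeast0)
    also have "\<dots> = (\<Prod>k<i. real l * real s + (real i - real a - real k)) / fact i"
      using a by (simp add: of_nat_diff algebra_simps)
    finally show ?case by (simp add: prod_dividef)
  qed
  ultimately show ?thesis by (auto intro: Lim_transform_eventually)
qed

text \<open>The limit along the ray (l s, s) depends on the slope through l^i. A single ray would
  only reveal a weighted sum over all terms of one total order; varying l separates them.\<close>

lemma piece_count_tendsto: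
  assumes "l \<ge> 1"
  shows "(\<lambda>s. real (piece_count (a, b, Suc i, Suc j) (l * s) s) / real s ^ (i + j))
    \<longlonglongrightarrow> real l ^ i / (fact i * fact j)"
proof -
  have "(\<lambda>s. real (geo_coeff (Suc i) (l * s - a)) / real s ^ i * (real (geo_coeff (Suc j) (1 * s - b)) / real s ^ j))
     \<longlonglongrightarrow> real l ^ i / fact i * (real 1 ^ j / fact j)"
    by (intro tendsto_mult geo_coeff_tendsto assms) auto
  moreover have "eventually (\<lambda>s. real (geo_coeff (Suc i) (l * s - a)) / real s ^ i * (real (geo_coeff (Suc j) (1 * s - b)) / real s ^ j)
     = real (piece_count (a, b, Suc i, Suc j) (l * s) s) / real s ^ (i + j)) sequentially"
    using eventually_ge_at_top[of "a + b"]
  proof eventually_elim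
    case (elim s)
    then have "a \<le> l * s" "b \<le> s" using assms by (auto intro: order_trans[of a s])
    then show ?case by (simp add: shifted_def power_add del: geo_coeff.simps)
  qed
  ultimately show ?thesis by (auto intro: Lim_transform_eventually)
qed

text \<open>Without a pole in one of the variables, the piece is supported on a line parallel to an
  axis, and every ray with l \<ge> 1 leaves that line.\<close>

lemma piece_count_degenerate:
  assumes "l \<ge> 1" "i = 0 \<or> j = 0"
  shows "eventually (\<lambda>s. piece_count (a, b, i, j) (l * s) s = 0) sequentially"
  using eventually_gt_at_top[of "a + b"]
proof eventually_elim
  case (elim s)
  then have "a < l * s" "b < s" using assms by (auto intro: order_less_le_trans[of a s])
  then show ?case using assms(2) by (auto simp: shifted_def)
qed

lemma power_quotient_tendsto_0:
  assumes "l \<ge> 1" "i + j < d"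
  shows "(\<lambda>s. (real (l * s) + 1) ^ i * (real s + 1) ^ j / real s ^ d) \<longlonglongrightarrow> 0"
proof -
  obtain e where d: "d = i + j + Suc e" using assms(2) less_imp_Suc_add by auto
  have "(\<lambda>s. ((real l * real s + 1) / real s) ^ i * ((real 1 * real s + 1) / real s) ^ j * (1 / real s) ^ Suc e)
      \<longlonglongrightarrow> real l ^ i * real 1 ^ j * 0 ^ Suc e"
    by (intro tendsto_intros affine_over_linear_tendsto lim_1_over_n)
  then show ?thesis
    by (simp add: d power_add power_divide field_simps)
qed

text \<open>Away from the axes the summands with i = 0 or i = k vanish. The others have degree (i -
  1) + (k - i - 1) = k - 2 in s, hence the condition k < d + 2.\<close>

lemma err_bounded_diagonal:
  assumes "err_bounded k g" "l \<ge> 1" "k < d + 2" "\<epsilon> > 0"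
  shows "eventually (\<lambda>s. g (l * s) s / real s ^ d \<le> \<epsilon>) sequentially"
proof -
  obtain N where N: "\<And>p q. g p q \<le> real N * (\<Sum>i\<le>k. err_term N i p * err_term N (k - i) q)"
    using assms(1) by (auto simp: err_bounded_def)
  define G where "G s = real N * (\<Sum>i\<in>{1..<k}. (real (l * s) + 1) ^ (i - 1) * (real s + 1) ^ (k - i - 1) / real s ^ d)" for s
  have "G \<longlonglongrightarrow> real N * (\<Sum>i\<in>{1..<k}. 0)"
    unfolding G_def by (intro tendsto_intros power_quotient_tendsto_0) (use assms in auto)
  then have "eventually (\<lambda>s. G s < \<epsilon>) sequentially"
    using assms(4) by (intro order_tendstoD(2)) auto
  then show ?thesis
    using eventually_gt_at_top[of N]
  proof eventually_elim
    case (elim s)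
    then have s: "N < s" "N < l * s" using assms(2) by (auto intro: order_less_le_trans[of N s])
    have "(\<Sum>i\<le>k. err_term N i (l * s) * err_term N (k - i) s)
      = (\<Sum>i\<in>{1..<k}. (real (l * s) + 1) ^ (i - 1) * (real s + 1) ^ (k - i - 1))"
      by (rule sum.mono_neutral_cong_right) (use s in \<open>auto simp: err_term_def\<close>)
    then have "real N * (\<Sum>i\<le>k. err_term N i (l * s) * err_term N (k - i) s) / real s ^ d = G s"
      by (simp add: G_def flip: sum_divide_distrib)
    then have "g (l * s) s / real s ^ d \<le> G s"
      using divide_right_mono[OF N[of "l * s" s], of "real s ^ d"] by simp
    then show ?case using elim by simp
  qed
qed

lemma err_term_le_power: "i \<le> k \<Longrightarrow> 1 \<le> k \<Longrightarrow> err_term N i q \<le> (real q + 1) ^ (k - 1)"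
  by (auto simp: err_term_def intro!: power_increasing)

text \<open>In a fixed row a pole in t contributes only a constant, so total order k allows growth
  in q of degree at most k - 1.\<close>

lemma err_bounded_fst_fixed:
  assumes "err_bounded k g" "1 \<le> k"
  shows "\<exists>C. \<forall>q. g p q \<le> C * (real q + 1) ^ (k - 1)"
proof -
  obtain N where N: "\<And>p q. g p q \<le> real N * (\<Sum>i\<le>k. err_term N i p * err_term N (k - i) q)"
    using assms(1) by (auto simp: err_bounded_def)
  have "g p q \<le> (real N * (\<Sum>i\<le>k. err_term N i p)) * (real q + 1) ^ (k - 1)" for q
  proof -
    have "(\<Sum>i\<le>k. err_term N i p * err_term N (k - i) q) \<le> (\<Sum>i\<le>k. err_term N i p * (real q + 1) ^ (k - 1))"
      using assms(2) by (intro sum_mono mult_left_mono err_term_le_power) auto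
    then have "real N * (\<Sum>i\<le>k. err_term N i p * err_term N (k - i) q) \<le> real N * ((\<Sum>i\<le>k. err_term N i p) * (real q + 1) ^ (k - 1))"
      by (intro mult_left_mono) (auto simp: sum_distrib_right)
    with N[of p q] show ?thesis by simp
  qed
  then show ?thesis by blast
qed

lemma geo_coeff_growth:
  assumes "\<And>q. real (shifted 0 b (\<lambda>p. geo_coeff j) 0 q) \<le> C * (real q + 1) ^ m"
  shows "j \<le> Suc m"
proof (rule ccontr)
  assume "\<not> j \<le> Suc m"
  then obtain j' where j: "j = Suc j'" "m < j'" by (cases j) auto
  have "(\<lambda>q. real (geo_coeff (Suc j') (1 * q - b)) / real q ^ j') \<longlonglongrightarrow> real 1 ^ j' / fact j'"
    by (rule geo_coeff_tendsto) simp
  moreover have "(\<lambda>q. C * ((real (1 * q) + 1) ^ m * (real q + 1) ^ 0 / real q ^ j')) \<longlonglongrightarrow> C * 0"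
    by (intro tendsto_intros power_quotient_tendsto_0) (use j in auto)
  moreover have "eventually (\<lambda>q. real (geo_coeff (Suc j') (1 * q - b)) / real q ^ j' \<le> C * ((real (1 * q) + 1) ^ m * (real q + 1) ^ 0 / real q ^ j')) sequentially"
    using eventually_ge_at_top[of b]
  proof eventually_elim
    case (elim q)
    have "real (geo_coeff (Suc j') (q - b)) \<le> C * (real q + 1) ^ m"
      using assms[of q] elim by (simp add: shifted_def j del: geo_coeff.simps)
    from divide_right_mono[OF this, of "real q ^ j'"] show ?case by simp
  qed
  ultimately have "real 1 ^ j' / fact j' \<le> C * 0"
    by (intro tendsto_le[OF sequentially_bot]) auto
  then show False using fact_gt_zero[of j', where 'a = real] by simp
qed

definition top_count :: "nat \<Rightarrow> piece list \<Rightarrow> nat \<Rightarrow> nat" where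
  "top_count n ps i = length (filter (\<lambda>(a, b, i', j). i' = i \<and> i' + j = n) ps)"

lemma sum_list_top_pieces:
  fixes F :: "nat \<Rightarrow> 'a::comm_ring_1"
  assumes "\<And>a b i j. (a, b, i, j) \<in> set ps \<Longrightarrow> i + j = n \<Longrightarrow> 1 \<le> i \<and> 1 \<le> j"
  shows "(\<Sum>(a, b, i, j)\<leftarrow>ps. if i + j = n then F i else 0) = (\<Sum>i = 1..<n. of_nat (top_count n ps i) * F i)"
  using assms
proof (induction ps)
  case Nil
  then show ?case by (simp add: top_count_def)
next
  case (Cons x ps)
  obtain a b i j where x: "x = (a, b, i, j)" by (cases x)
  have IH: "(\<Sum>(a, b, i, j)\<leftarrow>ps. if i + j = n then F i else 0) = (\<Sum>i = 1..<n. of_nat (top_count n ps i) * F i)"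
    by (rule Cons.IH) (use Cons.prems in auto)
  show ?case
  proof (cases "i + j = n")
    case True
    with Cons.prems[of a b i j] have i: "i \<in> {1..<n}" by (auto simp: x)
    have "(\<Sum>k = 1..<n. of_nat (top_count n (x # ps) k) * F k)
      = (\<Sum>k = 1..<n. (if k = i then F i else 0) + of_nat (top_count n ps k) * F k)"
      by (intro sum.cong) (auto simp: top_count_def x True algebra_simps)
    also have "\<dots> = F i + (\<Sum>k = 1..<n. of_nat (top_count n ps k) * F k)"
      using i by (simp add: sum.distrib)
    finally show ?thesis using True IH by (simp add: x)
  next
    case False
    then show ?thesis using IH by (auto simp: x top_count_def intro!: sum.cong)
  qed
qed

lemma piece_count_le_sum_list: "x \<in> set ps \<Longrightarrow> piece_count x p q \<le> (\<Sum>y\<leftarrow>ps. piece_count y p q)"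
  by (induction ps) auto

lemma poly_eq_0_if_nat_roots:
  fixes c :: "nat \<Rightarrow> real"
  assumes "\<And>l. l \<ge> 1 \<Longrightarrow> (\<Sum>i<m. c i * real l ^ i) = 0" "i < m"
  shows "c i = 0"
proof -
  define P where "P = (\<Sum>i<m. monom (c i) i)"
  have "poly P (real l) = 0" if "l \<ge> 1" for l
    using assms(1)[OF that] by (simp add: P_def poly_sum poly_monom)
  then have "real ` {1..} \<subseteq> {x. poly P x = 0}" by auto
  moreover have "infinite (real ` {1..})"
    by (subst finite_image_iff) (auto simp: infinite_Ici)
  ultimately have "P = 0" using poly_roots_finite[of P] finite_subset by blast
  then have "coeff P i = 0" by simp
  then show ?thesis using assms(2) by (simp add: P_def coeff_sum)
qed

section \<open>Comparison of a sum of pieces with the expected main term\<close>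

context
  fixes n :: nat and T :: "nat \<Rightarrow> int" and H :: "nat \<Rightarrow> nat \<Rightarrow> nat" and main :: "nat \<Rightarrow> nat \<Rightarrow> real" and ps :: "piece list"
  assumes n: "2 \<le> n"
    and main: "\<And>p q. main p q = (\<Sum>i = 1..<n. real_of_int (T i) * real (geo_coeff i p * geo_coeff (n - i) q))"
    and upper: "err_bounded (n - 1) (\<lambda>p q. real (H p q) - main p q)"
    and lower: "err_bounded (n - 1) (\<lambda>p q. main p q - real (H p q))"
    and pieces: "\<And>p q. H p q = (\<Sum>x\<leftarrow>ps. piece_count x p q)"
begin

lemma H_err_bounded: "err_bounded n (\<lambda>p q. real (H p q))"
proof -
  have "err_bounded n (\<lambda>p q. \<Sum>i = 1..<n. \<bar>real_of_int (T i)\<bar> * real (geo_coeff i p * geo_coeff (n - i) q))"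
    by (intro err_bounded_sum err_bounded_cmult err_bounded_geo_le) auto
  then have "err_bounded n main"
  proof (rule err_bounded_le)
    show "main p q \<le> (\<Sum>i = 1..<n. \<bar>real_of_int (T i)\<bar> * real (geo_coeff i p * geo_coeff (n - i) q))" for p q
      unfolding main by (intro sum_mono mult_right_mono) auto
  qed
  moreover have "err_bounded n (\<lambda>p q. real (H p q) - main p q)"
    using err_bounded_Suc[OF upper] n by simp
  ultimately show ?thesis using err_bounded_add by fastforce
qed

text \<open>Every summand of \<open>main\<close> has i \<ge> 1, so its pole in u has order at most n
  - 1, and the error has total order n - 1. Both grow in a fixed row at most like q^(n-2), one power
  less than total order n would allow.\<close>

lemma H_fst_fixed: "\<exists>C. \<forall>q. real (H p q) \<le> C * (real q + 1) ^ (n - 2)"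
proof -
  have n1: "1 \<le> n - 1" "n - 1 - 1 = n - 2" using n by auto
  obtain C where C: "\<And>q. real (H p q) - main p q \<le> C * (real q + 1) ^ (n - 2)"
    using err_bounded_fst_fixed[OF upper n1(1), of p] unfolding n1(2) by blast
  define C' where "C' = (\<Sum>i = 1..<n. \<bar>real_of_int (T i)\<bar> * real (geo_coeff i p))"
  have C': "main p q \<le> C' * (real q + 1) ^ (n - 2)" for q
  proof -
    have "main p q \<le> (\<Sum>i = 1..<n. \<bar>real_of_int (T i)\<bar> * real (geo_coeff i p) * (real q + 1) ^ (n - 2))"
      unfolding main
    proof (rule sum_mono)
      fix i assume i: "i \<in> {1..<n}"
      have "real (geo_coeff (n - i) q) \<le> (real q + 1) ^ (n - 1 - 1)"
        using i by (intro order_trans[OF geo_coeff_le_err_term[of _ _ 0] err_term_le_power]) auto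
      then have "\<bar>real_of_int (T i)\<bar> * real (geo_coeff i p) * real (geo_coeff (n - i) q)
         \<le> \<bar>real_of_int (T i)\<bar> * real (geo_coeff i p) * (real q + 1) ^ (n - 2)"
        by (intro mult_left_mono) (auto simp: numeral_2_eq_2)
      moreover have "real_of_int (T i) * real (geo_coeff i p * geo_coeff (n - i) q)
         \<le> \<bar>real_of_int (T i)\<bar> * real (geo_coeff i p * geo_coeff (n - i) q)"
        by (intro mult_right_mono) auto
      ultimately show "real_of_int (T i) * real (geo_coeff i p * geo_coeff (n - i) q)
         \<le> \<bar>real_of_int (T i)\<bar> * real (geo_coeff i p) * (real q + 1) ^ (n - 2)"
        by (simp add: mult.assoc)
    qed
    then show ?thesis by (simp add: C'_def sum_distrib_right)
  qed
  have "real (H p q) \<le> (C + C') * (real q + 1) ^ (n - 2)" for q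
    using C[of q] C'[of q] by (simp add: distrib_right)
  then show ?thesis by blast
qed

text \<open>A piece without pole in t lives in the single row p = a. As all pieces are nonnegative,
  it is bounded there by H, whose growth in q excludes j \<ge> n.\<close>

lemma piece_fst_0:
  assumes "(a, b, 0, j) \<in> set ps"
  shows "j < n"
proof -
  obtain C where C: "\<And>q. real (H a q) \<le> C * (real q + 1) ^ (n - 2)" using H_fst_fixed by blast
  have "j \<le> Suc (n - 2)"
  proof (rule geo_coeff_growth)
    fix q
    have "shifted 0 b (\<lambda>p. geo_coeff j) 0 q = piece_count (a, b, 0, j) a q"
      by (simp add: shifted_def)
    also have "\<dots> \<le> H a q" unfolding pieces by (rule piece_count_le_sum_list[OF assms])
    finally show "real (shifted 0 b (\<lambda>p. geo_coeff j) 0 q) \<le> C * (real q + 1) ^ (n - 2)"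
      by (intro order_trans[OF _ C]) simp
  qed
  then show ?thesis using n by simp
qed

text \<open>Pieces are nonnegative, so no cancellation can hide a pole of order above n: each single
  piece is bounded by H on the diagonal.\<close>

lemma piece_order_le:
  assumes "(a, b, Suc i, Suc j) \<in> set ps"
  shows "Suc i + Suc j \<le> n"
proof (rule ccontr)
  assume "\<not> Suc i + Suc j \<le> n"
  \<comment> \<open>Half of the limit of the rescaled piece along the diagonal, so that an eventual
    bound by it is contradictory.\<close>
  let ?\<epsilon> = "1 / (fact i * fact j) / 2 :: real"
  have "eventually (\<lambda>s. real (H (1 * s) s) / real s ^ (i + j) \<le> ?\<epsilon>) sequentially"
    using \<open>\<not> _\<close> by (intro err_bounded_diagonal[OF H_err_bounded]) auto
  then have "eventually (\<lambda>s. real (piece_count (a, b, Suc i, Suc j) (1 * s) s) / real s ^ (i + j) \<le> ?\<epsilon>) sequentially"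
  proof eventually_elim
    case (elim s)
    have "real (piece_count (a, b, Suc i, Suc j) (1 * s) s) \<le> real (H (1 * s) s)"
      unfolding pieces by (intro of_nat_mono piece_count_le_sum_list[OF assms])
    then show ?case using elim by (meson divide_right_mono order_trans zero_le_power of_nat_0_le_iff)
  qed
  from tendsto_upperbound[OF piece_count_tendsto this]
  have "real 1 ^ i / (fact i * fact j) \<le> ?\<epsilon>" by simp
  then show False by (simp add: field_simps)
qed

text \<open>Along every ray the rescaled difference of H and \<open>main\<close> tends to 0 by the
  two one-sided errors. Its limit is also a polynomial in the slope l, whose coefficients are the
  differences of \<open>top_count\<close> and T up to positive factors; having all l \<ge> 1 as
  roots, it is zero.\<close>

lemma top_coefficients:
  assumes le: "\<And>a b i j. (a, b, i, j) \<in> set ps \<Longrightarrow> i + j \<le> n"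
    and top: "\<And>a b i j. (a, b, i, j) \<in> set ps \<Longrightarrow> i + j = n \<Longrightarrow> 1 \<le> i \<and> 1 \<le> j"
    and i: "1 \<le> i" "i < n"
  shows "int (top_count n ps i) = T i"
proof -
  let ?F = "\<lambda>l i. real l ^ (i - 1) / (fact (i - 1) * fact (n - i - 1)) :: real"
  \<comment> \<open>The index is shifted by one: a term with t-pole of order k + 1 contributes
    l^k.\<close>
  define c where "c k = (real (top_count n ps (Suc k)) - real_of_int (T (Suc k))) / (fact k * fact (n - 2 - k))" for k
  have zero: "(\<Sum>k<n - 1. c k * real l ^ k) = 0" if l: "l \<ge> 1" for l
  proof -
    have "(\<lambda>s. real (piece_count x (l * s) s) / real s ^ (n - 2)) \<longlonglongrightarrow> (case x of (a, b, i, j) \<Rightarrow> if i + j = n then ?F l i else 0)"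
      if x: "x \<in> set ps" for x
    proof -
      obtain a b i j where abij: "x = (a, b, i, j)" by (cases x)
      show ?thesis
      proof (cases "i = 0 \<or> j = 0")
        case True
        then have "i + j \<noteq> n" using top[of a b i j] x by (auto simp: abij)
        moreover have "eventually (\<lambda>s. 0 = real (piece_count x (l * s) s) / real s ^ (n - 2)) sequentially"
          using piece_count_degenerate[OF l True, of a b] unfolding abij by eventually_elim simp
        ultimately show ?thesis
          by (auto simp: abij intro: Lim_transform_eventually[OF tendsto_const])
      next
        case False
        then obtain i' j' where ij: "i = Suc i'" "j = Suc j'" by (metis not0_implies_Suc)
        show ?thesis
        proof (cases "i + j = n")
          case True
          then have "n - 2 = i' + j'" "n - i - 1 = j'" by (auto simp: ij)
          then show ?thesis using piece_count_tendsto[OF l, of a b i' j'] True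
            by (simp add: abij ij del: piece_count.simps geo_coeff.simps)
        next
          case neq: False
          then have "i' + j' < n - 2" using le[of a b i j] x by (simp add: abij ij)
          then obtain e where e: "n - 2 = i' + j' + Suc e"
            using less_imp_Suc_add by (metis add_Suc_right)
          have "(\<lambda>s. real (piece_count x (l * s) s) / real s ^ (i' + j') * (1 / real s) ^ Suc e) \<longlonglongrightarrow> real l ^ i' / (fact i' * fact j') * 0 ^ Suc e"
            unfolding abij ij by (intro tendsto_mult piece_count_tendsto[OF l] tendsto_power lim_1_over_n)
          then show ?thesis using neq
            by (simp add: abij ij e power_add power_divide field_simps del: piece_count.simps)
        qed
      qed
    qed
    then have "(\<lambda>s. \<Sum>x\<leftarrow>ps. real (piece_count x (l * s) s) / real s ^ (n - 2)) \<longlonglongrightarrow> (\<Sum>(a, b, i, j)\<leftarrow>ps. if i + j = n then ?F l i else 0)"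
    proof (induction ps)
      case (Cons x ps)
      show ?case unfolding list.map sum_list.Cons
        by (intro tendsto_add Cons.prems Cons.IH) simp_all
    qed simp
    moreover have "(\<Sum>x\<leftarrow>ps. real (piece_count x p q) / r) = real (H p q) / r" for p q r
      unfolding pieces by (induction ps) (simp_all add: add_divide_distrib)
    ultimately have H: "(\<lambda>s. real (H (l * s) s) / real s ^ (n - 2)) \<longlonglongrightarrow> (\<Sum>i = 1..<n. real (top_count n ps i) * ?F l i)"
      by (simp only: sum_list_top_pieces[OF top])
    have "(\<lambda>s. \<Sum>i = 1..<n. real_of_int (T i) * (real (geo_coeff i (l * s) * geo_coeff (n - i) s) / real s ^ (n - 2)))
       \<longlonglongrightarrow> (\<Sum>i = 1..<n. real_of_int (T i) * ?F l i)"
    proof (intro tendsto_sum tendsto_mult tendsto_const)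
      fix i assume i: "i \<in> {1..<n}"
      then obtain i' j' where ij: "i = Suc i'" "n - i = Suc j'"
        by (metis atLeastLessThan_iff Suc_le_D One_nat_def zero_less_diff gr0_implies_Suc)
      then have "n - 2 = i' + j'" "n - Suc i' = Suc j'" "n - Suc (Suc i') = j'" by auto
      then show "(\<lambda>s. real (geo_coeff i (l * s) * geo_coeff (n - i) s) / real s ^ (n - 2)) \<longlonglongrightarrow> ?F l i"
        using piece_count_tendsto[OF l, of 0 0 i' j'] by (simp add: ij shifted_def del: geo_coeff.simps)
    qed
    then have M: "(\<lambda>s. main (l * s) s / real s ^ (n - 2)) \<longlonglongrightarrow> (\<Sum>i = 1..<n. real_of_int (T i) * ?F l i)"
      unfolding main by (simp add: sum_divide_distrib)
    define L where "L = (\<Sum>i = 1..<n. real (top_count n ps i) * ?F l i) - (\<Sum>i = 1..<n. real_of_int (T i) * ?F l i)"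
    have lim: "(\<lambda>s. (real (H (l * s) s) - main (l * s) s) / real s ^ (n - 2)) \<longlonglongrightarrow> L"
      using tendsto_diff[OF H M] by (simp add: diff_divide_distrib L_def)
    have L1: "L \<le> \<epsilon>" if "\<epsilon> > 0" for \<epsilon>
      using n by (intro tendsto_upperbound[OF lim err_bounded_diagonal[OF upper l _ that]]) auto
    have L2: "- L \<le> \<epsilon>" if "\<epsilon> > 0" for \<epsilon>
    proof -
      have "(\<lambda>s. (main (l * s) s - real (H (l * s) s)) / real s ^ (n - 2)) \<longlonglongrightarrow> - L"
        using tendsto_minus[OF lim] by (simp only: minus_divide_left minus_diff_eq)
      from tendsto_upperbound[OF this err_bounded_diagonal[OF lower l _ that]] show ?thesis
        using n by auto
    qed
    have "L \<le> 0" by (rule field_le_epsilon) (simp add: L1)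
    moreover have "- L \<le> 0" by (rule field_le_epsilon) (simp add: L2)
    ultimately have "L = 0" by simp
    have "(\<Sum>k<n - 1. c k * real l ^ k) = (\<Sum>i = 1..<n. (real (top_count n ps i) - real_of_int (T i)) * ?F l i)"
      by (rule sum.reindex_bij_witness[of _ "\<lambda>i. i - 1" Suc]) (auto simp: c_def field_simps numeral_2_eq_2)
    also have "\<dots> = L" by (simp only: L_def left_diff_distrib sum_subtractf)
    finally show ?thesis using \<open>L = 0\<close> by simp
  qed
  have "c (i - 1) = 0" by (rule poly_eq_0_if_nat_roots[OF zero]) (use i in auto)
  then show ?thesis using i by (simp add: c_def)
qed

end

theorem hilbert_series_from_bounds:
  assumes n: "2 \<le> n"
    and main: "\<And>p q. main p q = (\<Sum>i = 1..<n. real_of_int (T i) * real (geo_coeff i p * geo_coeff (n - i) q))"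
    and upper: "err_bounded (n - 1) (\<lambda>p q. real (H p q) - main p q)"
    and lower: "err_bounded (n - 1) (\<lambda>p q. main p q - real (H p q))"
    and "sum_of_pieces H"
  shows "\<exists>Q. Abs_fps (\<lambda>p. Abs_fps (\<lambda>q. of_nat (H p q))) = (\<Sum>i = 1..<n. of_int (T i) * pole i (n - i)) + Q \<and> pole_order_less n Q"
proof -
  obtain ps where pieces: "\<And>p q. H p q = (\<Sum>x\<leftarrow>ps. piece_count x p q)"
    using assms(5) unfolding sum_of_pieces_def by blast
  let ?sw = "map (\<lambda>(a, b, i, j). (b, a, j, i)) ps"
  \<comment> \<open>Exchanging t and u turns \<open>main\<close> into the main term with
    coefficients T (n - i) and transposes the pieces.\<close>
  have swap: "i < n" if "(a, b, i, 0) \<in> set ps" for a b i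
  proof (rule piece_fst_0[where H = "\<lambda>p q. H q p" and main = "\<lambda>p q. main q p" and ps = ?sw and T = "\<lambda>i. T (n - i)", OF n])
    show "main q p = (\<Sum>i = 1..<n. real_of_int (T (n - i)) * real (geo_coeff i p * geo_coeff (n - i) q))" for p q
      unfolding main
      by (rule sum.reindex_bij_witness[of _ "\<lambda>i. n - i" "\<lambda>i. n - i"]) auto
    show "err_bounded (n - 1) (\<lambda>p q. real (H q p) - main q p)" "err_bounded (n - 1) (\<lambda>p q. main q p - real (H q p))"
      by (rule err_bounded_swap[OF upper], rule err_bounded_swap[OF lower])
    have "piece_count ((\<lambda>(a, b, i, j). (b, a, j, i)) x) p q = piece_count x q p" for x p q
      by (cases x) (auto simp: shifted_def)
    then show "H q p = (\<Sum>x\<leftarrow>?sw. piece_count x p q)" for p q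
      by (simp add: pieces o_def del: piece_count.simps)
    show "(b, a, 0, i) \<in> set ?sw" using that by force
  qed
  have le: "i + j \<le> n" and top: "i + j = n \<Longrightarrow> 1 \<le> i \<and> 1 \<le> j" if "(a, b, i, j) \<in> set ps" for a b i j
  proof -
    note ctx = n main upper lower pieces
    consider "i = 0" | "j = 0" | i' j' where "i = Suc i'" "j = Suc j'" by (metis not0_implies_Suc)
    then have "i + j \<le> n \<and> (i + j = n \<longrightarrow> 1 \<le> i \<and> 1 \<le> j)"
    proof cases
      case 1
      then show ?thesis using piece_fst_0[OF ctx] that by fastforce
    next
      case 2
      then show ?thesis using swap that by fastforce
    next
      case 3
      then show ?thesis using piece_order_le[OF ctx] that by fastforce
    qed
    then show "i + j \<le> n" "i + j = n \<Longrightarrow> 1 \<le> i \<and> 1 \<le> j" by auto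
  qed
  let ?S = "\<lambda>(a, b, i, j). var_t ^ a * (var_u ^ b * pole i j)"
  let ?top = "\<lambda>(a :: nat, b :: nat, i, j). if i + j = n then pole i (n - i) else 0"
  \<comment> \<open>Each piece of order n is compared with the bare pole of the same type, every
    other piece with 0.\<close>
  define Q where "Q = (\<Sum>x\<leftarrow>ps. ?S x - ?top x)"
  have "fps_nth (fps_nth (\<Sum>x\<leftarrow>ps. ?S x) p) q = of_nat (\<Sum>x\<leftarrow>ps. piece_count x p q)" for p q
  proof (induction ps)
    case (Cons x ps)
    have "fps_nth (fps_nth (?S x) p) q = of_nat (piece_count x p q)"
      by (cases x) (simp add: monomial_mult_nth shifted_def pole_def)
    then show ?case using Cons by (simp del: piece_count.simps)
  qed simp
  then have "Abs_fps (\<lambda>p. Abs_fps (\<lambda>q. of_nat (H p q))) = (\<Sum>x\<leftarrow>ps. ?S x)"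
    by (intro fps_ext) (simp add: pieces del: piece_count.simps)
  also have "\<dots> = (\<Sum>x\<leftarrow>ps. ?top x) + Q"
    unfolding Q_def sum_list_subtractf by simp
  also have "(\<Sum>x\<leftarrow>ps. ?top x) = (\<Sum>i = 1..<n. of_nat (top_count n ps i) * pole i (n - i))"
    by (rule sum_list_top_pieces[OF top])
  also have "\<dots> = (\<Sum>i = 1..<n. of_int (T i) * pole i (n - i))"
  proof (rule sum.cong)
    fix i assume "i \<in> {1..<n}"
    then have "int (top_count n ps i) = T i"
      using top_coefficients[OF n main upper lower pieces le top] by auto
    then show "of_nat (top_count n ps i) * pole i (n - i) = of_int (T i) * pole i (n - i)"
      by (metis of_int_of_nat_eq)
  qed simp
  finally have "Abs_fps (\<lambda>p. Abs_fps (\<lambda>q. of_nat (H p q))) = (\<Sum>i = 1..<n. of_int (T i) * pole i (n - i)) + Q" .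
  moreover have "pole_order_less n Q"
    unfolding Q_def
  proof (rule pole_order_less_sum_list)
    fix x assume x: "x \<in> set ps"
    obtain a b i j where abij: "x = (a, b, i, j)" by (cases x)
    show "pole_order_less n (?S x - ?top x)"
    proof (cases "i + j = n")
      case True
      then have "n - i = j" by simp
      then show ?thesis using True top[of a b i j] x pole_order_less_monomial_diff[of i j n a b] by (simp add: abij)
    next
      case False
      then show ?thesis using le[of a b i j] x pole_order_less_monomial[of i j n a b] by (simp add: abij)
    qed
  qed
  ultimately show ?thesis by blast
qed

section \<open>Minors of an arrangement\<close>

interpretation fun_space: vector_space fun_scale
  by (rule vector_space_fun_scale)

lemma fun_scale_apply: "fun_scale c g x = c * g x"
  by (simp add: fun_scale_def)

lemma coeff_mult_const: "coeff (p * [:b:]) i = coeff p i * (b :: 'a::comm_ring_1)"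
  by (simp add: mult.commute)

locale essential_arrangement =
  fixes scl :: "complex \<Rightarrow> 'v::ab_group_add \<Rightarrow> 'v" and n :: nat and f :: "nat \<Rightarrow> 'v \<Rightarrow> complex"
  assumes scl_vector_space: "vector_space scl"
    and form: "\<And>i. i \<in> {1..n} \<Longrightarrow> f i \<in> linear_forms scl"
    and center: "center n f = {0}"
begin

sublocale vector_space scl by (rule scl_vector_space)

section \<open>Linear forms and flats\<close>

lemma linear_form_add: "\<phi> \<in> linear_forms scl \<Longrightarrow> \<phi> (x + y) = \<phi> x + \<phi> y"
  unfolding linear_forms_def by (simp add: Vector_Spaces.linear_iff)

lemma linear_form_scale: "\<phi> \<in> linear_forms scl \<Longrightarrow> \<phi> (scl c x) = c * \<phi> x"
  unfolding linear_forms_def by (simp add: Vector_Spaces.linear_iff)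

lemma linear_formI:
  assumes "\<And>x y. \<phi> (x + y) = \<phi> x + \<phi> y" "\<And>c x. \<phi> (scl c x) = c * \<phi> x"
  shows "\<phi> \<in> linear_forms scl"
proof -
  have "vector_space ((*) :: complex \<Rightarrow> complex \<Rightarrow> complex)"
    by unfold_locales (auto simp: algebra_simps)
  then show ?thesis
    unfolding linear_forms_def using scl_vector_space assms by (simp add: Vector_Spaces.linear_iff)
qed

lemma linear_form_zero: "\<phi> \<in> linear_forms scl \<Longrightarrow> \<phi> 0 = 0"
  using linear_form_scale[of \<phi> 0 0] by simp

lemma linear_form_diff: "\<phi> \<in> linear_forms scl \<Longrightarrow> \<phi> (x - y) = \<phi> x - \<phi> y"
  using linear_form_add[of \<phi> "x - y" y] by simp

lemma linear_forms_diff_scale: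
  assumes "\<phi> \<in> linear_forms scl" "\<psi> \<in> linear_forms scl"
  shows "\<phi> - fun_scale c \<psi> \<in> linear_forms scl"
  by (rule linear_formI) (simp_all add: fun_scale_apply linear_form_add linear_form_scale assms algebra_simps)

definition flat :: "nat set \<Rightarrow> 'v set" where
  "flat F = {x. \<forall>i\<in>F. f i x = 0}"

lemma flat_mono: "F \<subseteq> G \<Longrightarrow> flat G \<subseteq> flat F"
  by (auto simp: flat_def)

lemma flat_insert: "flat (insert e F) = {x \<in> flat F. f e x = 0}"
  by (auto simp: flat_def)

lemma flat_all: "flat {1..n} = {0}"
  using center by (auto simp: flat_def center_def hyperplane_def)

lemma flat_diff_scale:
  assumes "F \<subseteq> {1..n}" "x \<in> flat F" "y \<in> flat F"
  shows "x - scl c y \<in> flat F"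
  using assms form by (auto simp: flat_def linear_form_diff linear_form_scale subset_iff)

lemma zero_in_flat: "F \<subseteq> {1..n} \<Longrightarrow> 0 \<in> flat F"
  using form by (auto simp: flat_def linear_form_zero subset_iff)

text \<open>Subtracting a multiple of v moves x into the hyperplane f e = 0 of the flat, where the
  form vanishes. So on \<open>flat F\<close> the form is a multiple of \<open>f e\<close>, with the
  factor read off at v.\<close>

lemma vanishing_insert_decompose:
  assumes F: "F \<subseteq> {1..n}" and e: "e \<in> {1..n}" and v: "v \<in> flat F" "f e v \<noteq> 0"
    and \<phi>: "\<phi> \<in> linear_forms scl" "\<And>x. x \<in> flat (insert e F) \<Longrightarrow> \<phi> x = 0"
    and x: "x \<in> flat F"
  shows "\<phi> x = \<phi> v / f e v * f e x"
proof -
  let ?y = "x - scl (f e x / f e v) v"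
  have "?y \<in> flat (insert e F)"
    using flat_diff_scale[OF F x v(1)] form[OF e] v(2)
    by (simp add: flat_insert linear_form_diff linear_form_scale)
  then have "\<phi> ?y = 0" by (rule \<phi>(2))
  then show ?thesis using \<phi>(1) by (simp add: linear_form_diff linear_form_scale)
qed

text \<open>Duality between flats and spans of forms. Each new index of F contributes one multiple
  of \<open>f e\<close>, by the preceding lemma.\<close>

lemma vanishing_form_in_span:
  assumes "finite F" "F \<subseteq> {1..n}" "\<phi> \<in> linear_forms scl" "\<And>x. x \<in> flat F \<Longrightarrow> \<phi> x = 0"
  shows "\<phi> \<in> fun_space.span (f ` F)"
  using assms
proof (induction F arbitrary: \<phi> rule: finite_induct)
  case empty
  then have "\<phi> = 0" by (auto simp: flat_def fun_eq_iff)
  then show ?case by (metis fun_space.span_zero)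
next
  case (insert e F)
  then have F: "F \<subseteq> {1..n}" and e: "e \<in> {1..n}" by auto
  have mono: "fun_space.span (f ` F) \<subseteq> fun_space.span (f ` insert e F)"
    by (intro fun_space.span_mono) auto
  show ?case
  proof (cases "\<forall>x\<in>flat F. f e x = 0")
    case True
    then have "flat (insert e F) = flat F" by (auto simp: flat_insert)
    then show ?thesis using insert mono by auto
  next
    case False
    then obtain v where v: "v \<in> flat F" "f e v \<noteq> 0" by blast
    let ?c = "\<phi> v / f e v"
    have "\<phi> - fun_scale ?c (f e) \<in> fun_space.span (f ` F)"
    proof (rule insert.IH[OF F])
      show "\<phi> - fun_scale ?c (f e) \<in> linear_forms scl"
        by (intro linear_forms_diff_scale insert.prems form e)
      show "(\<phi> - fun_scale ?c (f e)) x = 0" if "x \<in> flat F" for x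
        using vanishing_insert_decompose[OF F e v insert.prems(2,3) that] by (simp add: fun_scale_apply)
    qed
    then have "\<phi> - fun_scale ?c (f e) \<in> fun_space.span (f ` insert e F)" using mono by blast
    moreover have "fun_scale ?c (f e) \<in> fun_space.span (f ` insert e F)"
      by (intro fun_space.span_scale fun_space.span_base) simp
    ultimately have "(\<phi> - fun_scale ?c (f e)) + fun_scale ?c (f e) \<in> fun_space.span (f ` insert e F)"
      by (rule fun_space.span_add)
    then show ?thesis by simp
  qed
qed

lemma span_vanishes_on_flat:
  assumes "\<phi> \<in> fun_space.span (f ` F)" "x \<in> flat F"
  shows "\<phi> x = 0"
  using assms(1) by (induction rule: fun_space.span_induct_alt) (use assms(2) in \<open>auto simp: flat_def fun_scale_apply\<close>)

lemma in_span_iff_vanishes: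
  assumes "F \<subseteq> {1..n}" "e \<in> {1..n}"
  shows "f e \<in> fun_space.span (f ` F) \<longleftrightarrow> (\<forall>x\<in>flat F. f e x = 0)"
  using vanishing_form_in_span[OF finite_subset[OF assms(1)] assms(1) form[OF assms(2)]] span_vanishes_on_flat
  by auto

section \<open>Matroid rank\<close>

abbreviation rk :: "nat set \<Rightarrow> nat" where
  "rk F \<equiv> matroid_rank f F"

text \<open>Translates rank into geometry: e is a loop after contracting F exactly if
  \<open>f e\<close> vanishes on \<open>flat F\<close>. Loops and coloops are recognised in this
  form from here on.\<close>

lemma rk_insert:
  assumes "F \<subseteq> {1..n}" "e \<in> {1..n}"
  shows "rk (insert e F) = (if \<forall>x\<in>flat F. f e x = 0 then rk F else Suc (rk F))"
proof -
  have fin: "finite (f ` F)" using assms(1) finite_subset by blast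
  obtain B where B: "B \<subseteq> f ` F" "fun_space.independent B" "f ` F \<subseteq> fun_space.span B" "card B = fun_space.dim (f ` F)"
    using fun_space.basis_exists by blast
  have span_B: "fun_space.span B = fun_space.span (f ` F)"
    using B(1,3) by (metis fun_space.span_eq order_trans fun_space.span_superset)
  have finB: "finite B" using B(1) fin finite_subset by blast
  show ?thesis
  proof (cases "\<forall>x\<in>flat F. f e x = 0")
    case True
    then have "f e \<in> fun_space.span B" using in_span_iff_vanishes[OF assms] span_B by simp
    then have "fun_space.dim (f ` insert e F) = card B"
      using B by (intro fun_space.dim_unique[of B]) auto
    then show ?thesis using True B(4) by (simp add: matroid_rank_def)
  next
    case False
    then have notin: "f e \<notin> fun_space.span B" using in_span_iff_vanishes[OF assms] span_B by simp
    then have "fun_space.dim (f ` insert e F) = card (insert (f e) B)"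
      using B fun_space.span_mono[of B "insert (f e) B"]
      by (intro fun_space.dim_unique[of "insert (f e) B"])
        (auto simp: fun_space.independent_insertI intro: fun_space.span_base)
    moreover have "f e \<notin> B" using notin by (auto intro: fun_space.span_base)
    ultimately show ?thesis using False B(4) finB by (simp add: matroid_rank_def)
  qed
qed

lemma rk_mono:
  assumes "F \<subseteq> G" "G \<subseteq> {1..n}"
  shows "rk F \<le> rk G"
proof -
  have "finite G" using assms(2) finite_subset by blast
  then have "finite (G - F)" by simp
  then have "G - F \<subseteq> {1..n} \<longrightarrow> rk F \<le> rk (F \<union> (G - F))"
  proof (induction rule: finite_induct)
    case (insert e H)
    then show ?case using rk_insert[of "F \<union> H" e] assms by auto
  qed simp
  then show ?thesis using assms by (auto simp: Un_absorb1)
qed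

lemma rk_le_card: "finite F \<Longrightarrow> rk F \<le> card F"
  unfolding matroid_rank_def by (rule order_trans[OF fun_space.dim_le_card' card_image_le]) auto

lemma rk_union_le:
  assumes "finite E" "F \<subseteq> {1..n}" "E \<subseteq> {1..n}"
  shows "rk (F \<union> E) \<le> rk F + card E"
  using assms
proof (induction E rule: finite_induct)
  case (insert e E)
  then show ?case using rk_insert[of "F \<union> E" e] by auto
qed simp

text \<open>
  A pair \<open>F\<close>, \<open>E\<close> of disjoint sets of indices stands for the minor obtained by contracting \<open>F\<close> and
  keeping \<open>E\<close>, i.e. for the forms \<open>f i\<close>, \<open>i \<in> E\<close>, on \<open>flat F\<close>. Then \<open>minor_poly F E\<close> is \<open>T(x, 0)\<close> of
  this minor. The sign is \<open>(-1)\<close> to the nullity of \<open>X\<close>, with the ranks added to avoid subtraction.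
\<close>
definition minor_term :: "nat set \<Rightarrow> nat set \<Rightarrow> nat set \<Rightarrow> int poly" where
  "minor_term F E X = [:-1, 1:] ^ (rk (F \<union> E) - rk (F \<union> X)) * [:(-1) ^ (card X + rk (F \<union> X) + rk F):]"

definition minor_poly :: "nat set \<Rightarrow> nat set \<Rightarrow> int poly" where
  "minor_poly F E = (\<Sum>X\<in>Pow E. minor_term F E X)"

text \<open>Common frame of the three recursions: the subsets of \<open>insert e E\<close> come in
  pairs X and \<open>insert e X\<close>.\<close>

lemma minor_poly_insert:
  assumes "finite E" "e \<notin> E"
    and "\<And>X. finite X \<Longrightarrow> X \<subseteq> E \<Longrightarrow> minor_term F (insert e E) X + minor_term F (insert e E) (insert e X) = g X"
  shows "minor_poly F (insert e E) = (\<Sum>X\<in>Pow E. g X)"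
proof -
  have "inj_on (insert e) (Pow E)" using assms(2) by (auto simp: inj_on_def)
  moreover have "Pow E \<inter> insert e ` Pow E = {}" using assms(2) by auto
  ultimately have "minor_poly F (insert e E) = (\<Sum>X\<in>Pow E. minor_term F (insert e E) X + minor_term F (insert e E) (insert e X))"
    using assms(1) by (simp add: minor_poly_def Pow_insert sum.union_disjoint sum.reindex sum.distrib)
  also have "\<dots> = (\<Sum>X\<in>Pow E. g X)"
    using assms(1,3) finite_subset by (intro sum.cong) auto
  finally show ?thesis .
qed

lemma minor_poly_empty: "minor_poly F {} = 1"
  by (simp add: minor_poly_def minor_term_def power_add flip: power_mult_distrib mult_2 one_pCons)

text \<open>Adding a loop to X keeps the rank and raises the nullity by one, so paired terms
  cancel.\<close>

lemma minor_poly_loop: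
  assumes "finite E" "e \<notin> E" "F \<subseteq> {1..n}" "insert e E \<subseteq> {1..n}" "\<forall>x\<in>flat F. f e x = 0"
  shows "minor_poly F (insert e E) = 0"
proof -
  have "minor_poly F (insert e E) = (\<Sum>X\<in>Pow E. 0)"
  proof (rule minor_poly_insert[OF assms(1,2)])
    fix X assume X: "finite X" "X \<subseteq> E"
    then have rk: "rk (insert e (F \<union> X)) = rk (F \<union> X)"
      using assms(3-5) flat_mono[of F "F \<union> X"] by (subst rk_insert) auto
    moreover have "card (insert e X) = Suc (card X)" using X assms(2) by (intro card_insert_disjoint) auto
    ultimately have "(- 1) ^ (card (insert e X) + rk (F \<union> insert e X) + rk F) = - ((- 1) ^ (card X + rk (F \<union> X) + rk F) :: int)"
      by simp
    then show "minor_term F (insert e E) X + minor_term F (insert e E) (insert e X) = 0"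
      unfolding minor_term_def by (simp add: rk)
  qed
  then show ?thesis by simp
qed

text \<open>Subsets avoiding e give the terms of the deletion, because e does not change the full
  rank; subsets containing e give those of the contraction.\<close>

lemma minor_poly_deletion_contraction:
  assumes "finite E" "e \<notin> E" "F \<subseteq> {1..n}" "insert e E \<subseteq> {1..n}"
    and "\<exists>x\<in>flat F. f e x \<noteq> 0" "\<forall>x\<in>flat (F \<union> E). f e x = 0"
  shows "minor_poly F (insert e E) = minor_poly F E + minor_poly (insert e F) E"
  unfolding minor_poly_def[of F E] minor_poly_def[of "insert e F"] sum.distrib[symmetric]
proof (rule minor_poly_insert[OF assms(1,2)])
  have 1: "rk (F \<union> insert e E) = rk (F \<union> E)" using assms by (simp add: rk_insert)
  have 2: "rk (insert e F) = Suc (rk F)" using assms by (simp add: rk_insert)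
  fix X assume X: "finite X" "X \<subseteq> E"
  then have "card (insert e X) = Suc (card X)" using assms(2) by (intro card_insert_disjoint) auto
  then show "minor_term F (insert e E) X + minor_term F (insert e E) (insert e X) = minor_term F E X + minor_term (insert e F) E X"
    unfolding minor_term_def using 1 2 by simp
qed

text \<open>The term of X has one factor x - 1 more than that of \<open>insert e X\<close>, and (x -
  1) + 1 = x.\<close>

lemma minor_poly_coloop:
  assumes "finite E" "e \<notin> E" "F \<subseteq> {1..n}" "insert e E \<subseteq> {1..n}"
    and "\<exists>x\<in>flat (F \<union> E). f e x \<noteq> 0"
  shows "minor_poly F (insert e E) = pCons 0 (minor_poly (insert e F) E)"
proof -
  have 2: "rk (insert e (F \<union> X)) = Suc (rk (F \<union> X))" if "X \<subseteq> E" for X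
    using assms that flat_mono[of "F \<union> X" "F \<union> E"] by (subst rk_insert) auto
  have F: "rk (insert e F) = Suc (rk F)" using 2[of "{}"] by simp
  have "minor_poly F (insert e E) = (\<Sum>X\<in>Pow E. [:0, 1:] * minor_term (insert e F) E X)"
  proof (rule minor_poly_insert[OF assms(1,2)])
    fix X assume X: "finite X" "X \<subseteq> E"
    let ?k = "rk (F \<union> E) - rk (F \<union> X)"
    let ?s = "(- 1) ^ (card X + rk (F \<union> X) + rk F) :: int"
    have "rk (F \<union> X) \<le> rk (F \<union> E)" using X assms by (intro rk_mono) auto
    then have k: "Suc (rk (F \<union> E)) - rk (F \<union> X) = Suc ?k" by simp
    have card: "card (insert e X) = Suc (card X)" using X assms(2) by (intro card_insert_disjoint) auto
    have "minor_term F (insert e E) X = [:- 1, 1:] * ([:- 1, 1:] ^ ?k * [:?s:])"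
      unfolding minor_term_def Un_insert_right 2[OF order_refl] k power_Suc mult.assoc ..
    moreover have "minor_term F (insert e E) (insert e X) = [:- 1, 1:] ^ ?k * [:?s:]"
      unfolding minor_term_def Un_insert_right 2[OF order_refl] 2[OF X(2)] card diff_Suc_Suc by simp
    moreover have "minor_term (insert e F) E X = [:- 1, 1:] ^ ?k * [:?s:]"
      unfolding minor_term_def Un_insert_left 2[OF order_refl] 2[OF X(2)] F diff_Suc_Suc by simp
    moreover have "[:- 1, 1:] * p + p = [:0, 1:] * p" for p :: "int poly"
      by (simp only: mult_pCons_left) simp
    ultimately show "minor_term F (insert e E) X + minor_term F (insert e E) (insert e X) = [:0, 1:] * minor_term (insert e F) E X"
      by (simp only:)
  qed
  also have "\<dots> = [:0, 1:] * minor_poly (insert e F) E" by (simp only: minor_poly_def sum_distrib_left)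
  finally show ?thesis by simp
qed

lemma coeff_minor_poly_eq_0:
  assumes "F \<subseteq> {1..n}" "E \<subseteq> {1..n}" "rk (F \<union> E) - rk F < i"
  shows "coeff (minor_poly F E) i = 0"
  unfolding minor_poly_def minor_term_def coeff_sum
proof (rule sum.neutral, rule ballI)
  fix X assume "X \<in> Pow E"
  then have "rk F \<le> rk (F \<union> X)" using assms(1,2) by (intro rk_mono) auto
  then have "rk (F \<union> E) - rk (F \<union> X) < i" using assms(3) by linarith
  then have "degree ([:- 1, 1:] ^ (rk (F \<union> E) - rk (F \<union> X)) :: int poly) < i"
    by (simp add: degree_linear_power)
  then show "coeff ([:- 1, 1:] ^ (rk (F \<union> E) - rk (F \<union> X)) * [:(- 1) ^ (card X + rk (F \<union> X) + rk F):] :: int poly) i = 0"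
    by (simp add: coeff_eq_0)
qed

lemma coeff_coeff_linear_power:
  "coeff (coeff ([:-1, 1:] ^ k :: int poly poly) i) 0 = coeff ([:-1, 1:] ^ k) i"
proof (induction k arbitrary: i)
  case (Suc k)
  then show ?case by (cases i) (simp_all add: coeff_pCons)
qed (auto simp: one_pCons coeff_pCons split: nat.split)

text \<open>At y = 0 the power of y - 1 becomes the sign of the nullity, and the corank power of x -
  1 remains.\<close>

lemma tutte_coeff_eq_minor: "tutte_coeff n f i 0 = coeff (minor_poly {} {1..n}) i"
proof -
  have "coeff (coeff (([:-1, 1:] :: int poly poly) ^ (rk {1..n} - rk X) * [:[:-1, 1:]:] ^ (card X - rk X)) i) 0
    = coeff ([:-1, 1:] ^ (rk {1..n} - rk X) * [:(-1) ^ (card X + rk X + rk {}):]) i" if "X \<in> Pow {1..n}" for X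
  proof -
    have "finite X" using that finite_subset by auto
    then have "rk X \<le> card X" by (rule rk_le_card)
    then have "(-1) ^ (card X - rk X) = ((-1) ^ (card X + rk X) :: int)"
      by (auto simp: minus_one_power_iff even_diff_nat)
    moreover have "rk {} = 0" using rk_le_card[of "{}"] by simp
    moreover have "coeff ([:-1, 1:] ^ m :: int poly) 0 = (-1) ^ m" for m
      by (simp add: coeff_0_power)
    moreover have "[:[:-1, 1:]:] ^ m = [:[:-1, 1:] ^ m :: int poly:]" for m
      by (rule poly_const_pow)
    ultimately show ?thesis
      by (simp only: coeff_mult_const coeff_mult_0 coeff_coeff_linear_power add_0_right)
  qed
  then show ?thesis
    unfolding tutte_coeff_def tutte_polynomial_def minor_poly_def minor_term_def
    by (simp add: coeff_sum)
qed

text \<open>All minors met are essential, i.e. \<open>flat (F \<union> E) = {0}\<close>. Deleting a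
  coloop would break this, so that case offers only the contraction. The case \<open>loops\<close>
  arises when E contains nothing but loops, which forces \<open>flat F = {0}\<close>. The vector v
  shows that e is no loop; for a coloop it even lies in \<open>flat (F \<union> E)\<close>.\<close>

lemma minor_induct [consumes 4, case_names loops coloop noncoloop]:
  assumes "E \<subseteq> {1..n}" "F \<subseteq> {1..n}" "F \<inter> E = {}" "flat (F \<union> E) = {0}"
    and loops: "\<And>F E. \<lbrakk>E \<subseteq> {1..n}; F \<subseteq> {1..n}; F \<inter> E = {}; flat F = {0};
       \<And>e. e \<in> E \<Longrightarrow> P F (E - {e})\<rbrakk> \<Longrightarrow> P F E"
    and coloop: "\<And>F E e v. \<lbrakk>E \<subseteq> {1..n}; F \<subseteq> {1..n}; e \<in> {1..n}; e \<notin> E; e \<notin> F; F \<inter> E = {};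
       v \<in> flat (F \<union> E); f e v \<noteq> 0; P (insert e F) E\<rbrakk> \<Longrightarrow> P F (insert e E)"
    and noncoloop: "\<And>F E e v. \<lbrakk>E \<subseteq> {1..n}; F \<subseteq> {1..n}; e \<in> {1..n}; e \<notin> E; e \<notin> F; F \<inter> E = {};
       v \<in> flat F; f e v \<noteq> 0; flat (F \<union> E) = {0}; P F E; P (insert e F) E\<rbrakk> \<Longrightarrow> P F (insert e E)"
  shows "P F E"
  using assms(1-4)
proof (induction "card E" arbitrary: F E)
  case 0
  have "finite E" using finite_subset[OF 0(2)] by simp
  with 0(1) have "E = {}" by simp
  show ?case
  proof (rule loops)
    show "flat F = {0}" using 0 \<open>E = {}\<close> by simp
  qed (use 0 \<open>E = {}\<close> in auto)
next
  case (Suc k)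
  have finE: "finite E" using finite_subset[OF Suc.prems(1)] by simp
  have "0 \<in> flat F" using Suc.prems(2) by (rule zero_in_flat)
  show ?case
  proof (cases "\<forall>e\<in>E. \<forall>x\<in>flat F. f e x = 0")
    case True
    then have "flat (F \<union> E) = flat F" by (auto simp: flat_def)
    then have F: "flat F = {0}" using Suc.prems by simp
    show ?thesis
    proof (rule loops[OF Suc.prems(1-3) F])
      fix e assume e: "e \<in> E"
      have "flat (F \<union> (E - {e})) = {0}"
        using F zero_in_flat[of "F \<union> (E - {e})"] flat_mono[of F "F \<union> (E - {e})"] Suc.prems by auto
      then show "P F (E - {e})" using Suc.prems Suc.hyps e finE by (intro Suc.hyps) auto
    qed
  next
    case False
    then obtain e v where e: "e \<in> E" and v: "v \<in> flat F" "f e v \<noteq> 0" by blast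
    let ?E = "E - {e}"
    have E: "E = insert e ?E" using e by auto
    have card: "k = card ?E" using e finE Suc.hyps(2) by simp
    have sub: "?E \<subseteq> {1..n}" "insert e F \<subseteq> {1..n}" "F \<subseteq> {1..n}" "F \<inter> ?E = {}" "insert e F \<inter> ?E = {}" "e \<in> {1..n}" "e \<notin> ?E" "e \<notin> F"
      using Suc.prems e by auto
    have un: "insert e F \<union> ?E = F \<union> E" using e by auto
    have con: "P (insert e F) ?E"
      using Suc.prems(4) by (intro Suc.hyps(1)[OF card sub(1,2,5)]) (simp only: un)
    show ?thesis
    proof (cases "\<exists>w\<in>flat (F \<union> ?E). f e w \<noteq> 0")
      case True
      then obtain w where "w \<in> flat (F \<union> ?E)" "f e w \<noteq> 0" by blast
      from coloop[OF sub(1,3,6,7,8,4) this con] E show ?thesis by simp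
    next
      case False
      then have "flat (F \<union> ?E) = flat (insert e (F \<union> ?E))" by (auto simp: flat_insert)
      also have "insert e (F \<union> ?E) = F \<union> E" using e by auto
      finally have flat0: "flat (F \<union> ?E) = {0}" using Suc.prems(4) by simp
      from noncoloop[OF sub(1,3,6,7,8,4) v flat0 Suc.hyps(1)[OF card sub(1,3,4) flat0] con] E
      show ?thesis by simp
    qed
  qed
qed

end

section \<open>The bigraded ring \<open>S\<close>\<close>

definition independent_mod :: "('a::zero \<Rightarrow> 'b \<Rightarrow> 'b::comm_monoid_add) \<Rightarrow> 'b set \<Rightarrow> 'b set \<Rightarrow> bool" where
  "independent_mod scl K B \<longleftrightarrow> (\<forall>c. (\<Sum>b\<in>B. scl (c b) b) \<in> K \<longrightarrow> (\<forall>b\<in>B. c b = 0))"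

context vector_space
begin

text \<open>This is dim (X / Y) \<le> |B|: together with a basis of Y, the set B spans X. The finite
  spanning set G keeps that basis finite.\<close>

lemma dim_le_card_add_dim:
  assumes "finite B" "X \<subseteq> span (B \<union> Y)" "Y \<subseteq> X" "finite G" "X \<subseteq> span G"
  shows "dim X \<le> card B + dim Y"
proof -
  obtain C where C: "C \<subseteq> Y" "independent C" "Y \<subseteq> span C" "card C = dim Y"
    using basis_exists by blast
  have "C \<subseteq> span G" using C(1) assms(3,5) by blast
  then have finC: "finite C" using independent_span_bound[OF assms(4) C(2)] by blast
  have "B \<union> Y \<subseteq> span (B \<union> C)"
    using C(3) span_mono[of C "B \<union> C"] by (auto intro: span_base)
  then have "X \<subseteq> span (B \<union> C)"
    using assms(2) span_minimal[OF _ subspace_span] by blast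
  then have "dim X \<le> card (B \<union> C)" using assms(1) finC by (intro dim_le_card) auto
  then show ?thesis using card_Un_le[of B C] C(4) by linarith
qed

lemma independent_mod_disjoint:
  assumes "independent_mod scale K B" "finite B"
  shows "B \<inter> K = {}"
proof (rule ccontr)
  assume "B \<inter> K \<noteq> {}"
  then obtain b where b: "b \<in> B" "b \<in> K" by blast
  have "(\<Sum>x\<in>B. scale (if x = b then 1 else 0) x) = (\<Sum>x\<in>B. if x = b then b else 0)"
    by (intro sum.cong) auto
  also have "\<dots> = b" using b(1) assms(2) by simp
  finally have "(\<Sum>x\<in>B. scale (if x = b then 1 else 0) x) \<in> K" using b(2) by simp
  from assms(1)[unfolded independent_mod_def, rule_format, OF this b(1)] show False by simp
qed

lemma independent_mod_inj:
  assumes "independent_mod scale K B" "finite B" "b \<in> B" "b' \<in> B" "b - b' \<in> K"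
  shows "b = b'"
proof (rule ccontr)
  assume ne: "b \<noteq> b'"
  let ?c = "\<lambda>x. (if x = b then 1 else 0) - (if x = b' then 1 else 0)"
  have "(\<Sum>x\<in>B. scale (?c x) x) = (\<Sum>x\<in>B. (if x = b then b else 0) - (if x = b' then b' else 0))"
    by (intro sum.cong) (auto simp: scale_left_diff_distrib)
  also have "\<dots> = b - b'" using assms(2-4) by (simp add: sum_subtractf)
  finally have "(\<Sum>x\<in>B. scale (?c x) x) \<in> K" using assms(5) by simp
  from assms(1)[unfolded independent_mod_def, rule_format, OF this assms(3)] ne show False by simp
qed

text \<open>This is |B| \<le> dim (X / Y): a relation between B and a basis of Y puts a combination
  of B into Y, so the coefficients on B vanish, and then the others do.\<close>

lemma card_add_dim_le:
  assumes "finite B" "B \<subseteq> X" "Y \<subseteq> X" "subspace Y" "independent_mod scale Y B" "finite G" "X \<subseteq> span G"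
  shows "card B + dim Y \<le> dim X"
proof -
  obtain C where C: "C \<subseteq> Y" "independent C" "Y \<subseteq> span C" "card C = dim Y"
    using basis_exists by blast
  have "C \<subseteq> span G" using C(1) assms(3,7) by blast
  then have finC: "finite C" using independent_span_bound[OF assms(6) C(2)] by blast
  have disj: "B \<inter> C = {}" using independent_mod_disjoint[OF assms(5,1)] C(1) by blast
  have "independent (B \<union> C)"
    unfolding dependent_finite[OF finite_UnI[OF assms(1) finC]]
  proof (rule notI, elim exE conjE bexE)
    fix u v assume v: "v \<in> B \<union> C" "u v \<noteq> 0" and sum0: "(\<Sum>v\<in>B \<union> C. scale (u v) v) = 0"
    have split: "(\<Sum>v\<in>B. scale (u v) v) + (\<Sum>v\<in>C. scale (u v) v) = 0"
      using sum0 by (simp add: sum.union_disjoint assms(1) finC disj)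
    then have "(\<Sum>v\<in>B. scale (u v) v) = - (\<Sum>v\<in>C. scale (u v) v)"
      by (rule eq_neg_iff_add_eq_0[THEN iffD2])
    also have "\<dots> \<in> Y"
      using C(1) by (intro subspace_neg subspace_sum subspace_scale assms(4)) auto
    finally have B0: "\<forall>b\<in>B. u b = 0"
      using assms(5) unfolding independent_mod_def by blast
    then have "(\<Sum>v\<in>C. scale (u v) v) = 0" using split by simp
    then have "\<forall>v\<in>C. u v = 0" using C(2) dependent_finite[OF finC] by blast
    then show False using B0 v by blast
  qed
  moreover obtain D where D: "D \<subseteq> X" "independent D" "X \<subseteq> span D" "card D = dim X"
    using basis_exists by blast
  moreover have "finite D" using independent_span_bound[OF assms(6) D(2)] D(1) assms(7) by blast
  moreover have "B \<union> C \<subseteq> span D" using assms(2,3) C(1) D(3) by blast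
  ultimately have "card (B \<union> C) \<le> dim X"
    using independent_span_bound by metis
  then show ?thesis using disj C(4) assms(1) finC by (simp add: card_Un_disjoint)
qed

text \<open>Additivity along K \<subseteq> L: B counts modulo L, while B' counts inside L modulo
  K.\<close>

lemma independent_mod_Un:
  assumes "finite B" "finite B'" "independent_mod scale L B" "independent_mod scale K B'" "K \<subseteq> L" "B' \<subseteq> L" "subspace L"
  shows "independent_mod scale K (B \<union> B') \<and> B \<inter> B' = {}"
proof -
  have disj: "B \<inter> B' = {}" using independent_mod_disjoint[OF assms(3,1)] assms(6) by blast
  have "independent_mod scale K (B \<union> B')"
    unfolding independent_mod_def
  proof (intro allI impI ballI)
    fix c b assume K: "(\<Sum>b\<in>B \<union> B'. scale (c b) b) \<in> K" and b: "b \<in> B \<union> B'"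
    have split: "(\<Sum>b\<in>B \<union> B'. scale (c b) b) = (\<Sum>b\<in>B. scale (c b) b) + (\<Sum>b\<in>B'. scale (c b) b)"
      by (simp add: sum.union_disjoint assms(1,2) disj)
    have B': "(\<Sum>b\<in>B'. scale (c b) b) \<in> L"
      using assms(6) by (intro subspace_sum subspace_scale assms(7)) auto
    have "(\<Sum>b\<in>B \<union> B'. scale (c b) b) - (\<Sum>b\<in>B'. scale (c b) b) \<in> L"
      using K assms(5) B' by (intro subspace_diff assms(7)) auto
    then have "(\<Sum>b\<in>B. scale (c b) b) \<in> L" by (simp add: split)
    then have B0: "\<forall>b\<in>B. c b = 0" using assms(3) unfolding independent_mod_def by blast
    then have "(\<Sum>b\<in>B'. scale (c b) b) \<in> K" using K split by simp
    then have B'0: "\<forall>b\<in>B'. c b = 0" using assms(4) unfolding independent_mod_def by blast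
    show "c b = 0" using b B0 B'0 by auto
  qed
  then show ?thesis using disj by blast
qed

lemma independent_mod_empty: "independent_mod scale K {}"
  by (simp add: independent_mod_def)

end

interpretation S_space: vector_space S_scale
  by (rule vector_space_S_scale)

section \<open>Embedding of functions and of the variables into S\<close>

definition lin :: "('v \<Rightarrow> complex) \<Rightarrow> 'v bipoly" where
  "lin g = Poly_Mapping.single 0 g"

definition av :: "nat \<Rightarrow> 'v bipoly" where
  "av i = Poly_Mapping.single (Poly_Mapping.single i 1) 1"

lemma S_scale_eq_lin: "S_scale c s = lin (\<lambda>_. c) * s"
  by (simp add: S_scale_def lin_def)

lemma lin_add: "lin (g + h) = lin g + lin h"
  by (simp add: lin_def single_add)

lemma lin_mult: "lin (g * h) = lin g * lin h"
  by (simp add: lin_def mult_single)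

lemma lin_1: "lin 1 = 1"
  by (simp add: lin_def)

lemma lin_0: "lin 0 = 0"
  by (simp add: lin_def)

lemma fun_scale_mult_right: "g * fun_scale c h = fun_scale c (g * h)"
  by (simp add: fun_scale_def fun_eq_iff)

lemma lin_fun_scale: "lin (fun_scale c g) = S_scale c (lin g)"
proof -
  have "fun_scale c g = (\<lambda>_. c) * g" by (simp add: fun_scale_def fun_eq_iff)
  then show ?thesis by (simp add: S_scale_eq_lin lin_mult)
qed

lemma mult_S_scale_left: "S_scale c s * t = S_scale c (s * t)"
  by (simp add: S_scale_eq_lin mult.assoc)

lemma mult_S_scale_right: "s * S_scale c t = S_scale c (s * t)"
  by (simp add: S_scale_eq_lin mult.left_commute)

lemma mult_mem_span: "s \<in> S_space.span A \<Longrightarrow> t * s \<in> S_space.span ((*) t ` A)"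
proof (induction rule: S_space.span_induct_alt)
  case base
  then show ?case using S_space.span_zero by simp
next
  case (step c x y)
  then show ?case
    by (simp add: distrib_left mult_S_scale_right S_space.span_add S_space.span_scale S_space.span_base)
qed

lemma mult_span_subset:
  assumes "s \<in> S_space.span A" "\<And>x. x \<in> A \<Longrightarrow> t * x \<in> Y" "S_space.subspace Y"
  shows "t * s \<in> Y"
proof -
  have "S_space.span ((*) t ` A) \<subseteq> Y" using assms by (intro S_space.span_minimal) auto
  then show ?thesis using mult_mem_span[OF assms(1)] by blast
qed

text \<open>The last assumption says that multiplication by T is injective from X modulo
  \<open>K'\<close> to S modulo K; injective maps preserve independence and cardinality.\<close>

lemma independent_mod_mult:
  assumes ind: "independent_mod S_scale K' B" and fin: "finite B"
    and B: "B \<subseteq> X" "S_space.subspace X" and K: "S_space.subspace K"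
    and T: "\<And>s. s \<in> X \<Longrightarrow> T * s \<in> K \<Longrightarrow> s \<in> K'"
  shows "independent_mod S_scale K ((*) T ` B) \<and> card ((*) T ` B) = card B"
proof -
  have inj: "inj_on ((*) T) B"
  proof (rule inj_onI)
    fix b b' assume b: "b \<in> B" "b' \<in> B" "T * b = T * b'"
    have "T * (b - b') \<in> K" using b(3) S_space.subspace_0[OF K] by (simp add: right_diff_distrib)
    moreover have "b - b' \<in> X" using b B by (intro S_space.subspace_diff) auto
    ultimately have "b - b' \<in> K'" by (intro T)
    then show "b = b'" by (rule S_space.independent_mod_inj[OF ind fin b(1,2)])
  qed
  have "independent_mod S_scale K ((*) T ` B)"
    unfolding independent_mod_def
  proof (intro allI impI ballI)
    fix c b assume sum: "(\<Sum>b\<in>(*) T ` B. S_scale (c b) b) \<in> K" and "b \<in> (*) T ` B"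
    then obtain b' where b': "b = T * b'" "b' \<in> B" by blast
    have "(\<Sum>b\<in>(*) T ` B. S_scale (c b) b) = T * (\<Sum>b\<in>B. S_scale (c (T * b)) b)"
      by (simp add: sum.reindex[OF inj] sum_distrib_left mult_S_scale_right)
    then have "T * (\<Sum>b\<in>B. S_scale (c (T * b)) b) \<in> K" using sum by simp
    moreover have "(\<Sum>b\<in>B. S_scale (c (T * b)) b) \<in> X"
      using B by (intro S_space.subspace_sum S_space.subspace_scale) auto
    ultimately have "(\<Sum>b\<in>B. S_scale (c (T * b)) b) \<in> K'" by (intro T)
    with ind[unfolded independent_mod_def, rule_format, of "\<lambda>b. c (T * b)" b'] b'
    show "c b = 0" by simp
  qed
  then show ?thesis using card_image[OF inj] by blast
qed

lemma sum_single_lookup: "(\<Sum>m\<in>Poly_Mapping.keys s. Poly_Mapping.single m (Poly_Mapping.lookup s m)) = s"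
proof (rule poly_mapping_eqI)
  fix k
  show "Poly_Mapping.lookup (\<Sum>m\<in>Poly_Mapping.keys s. Poly_Mapping.single m (Poly_Mapping.lookup s m)) k = Poly_Mapping.lookup s k"
    by (simp add: lookup_sum lookup_single when_def in_keys_iff)
qed

section \<open>Bihomogeneous components of S and their monomials\<close>

context essential_arrangement
begin

abbreviation sdeg :: "nat \<Rightarrow> nat \<Rightarrow> 'v bipoly set" where
  "sdeg \<equiv> S_bideg scl n"

abbreviation hom :: "nat \<Rightarrow> ('v \<Rightarrow> complex) set" where
  "hom \<equiv> homogeneous_functions scl"

definition mdeg :: "(nat \<Rightarrow>\<^sub>0 nat) \<Rightarrow> nat" where
  "mdeg m = (\<Sum>i\<in>Poly_Mapping.keys m. Poly_Mapping.lookup m i)"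

lemma hom_subspace: "fun_space.subspace (hom p)"
  by (simp add: homogeneous_functions_def)

lemma sdeg_iff:
  "s \<in> sdeg p q \<longleftrightarrow> (\<forall>m. Poly_Mapping.lookup s m \<in> hom p \<and>
     (Poly_Mapping.lookup s m \<noteq> 0 \<longrightarrow> Poly_Mapping.keys m \<subseteq> {1..n} \<and> mdeg m = q))"
  using fun_space.subspace_0[OF hom_subspace, of p]
  unfolding S_bideg_def mdeg_def by (auto simp: in_keys_iff)

lemma sdeg_subspace: "S_space.subspace (sdeg p q)"
proof (rule S_space.subspaceI)
  show "0 \<in> sdeg p q"
    unfolding sdeg_iff lookup_zero using fun_space.subspace_0[OF hom_subspace] by blast
  show "x + y \<in> sdeg p q" if "x \<in> sdeg p q" "y \<in> sdeg p q" for x y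
  proof -
    have "Poly_Mapping.lookup x m \<noteq> 0 \<or> Poly_Mapping.lookup y m \<noteq> 0" if "Poly_Mapping.lookup x m + Poly_Mapping.lookup y m \<noteq> 0" for m
      using that by (metis add.right_neutral)
    then show ?thesis
      using that fun_space.subspace_add[OF hom_subspace] unfolding sdeg_iff lookup_add by metis
  qed
  show "S_scale c x \<in> sdeg p q" if x: "x \<in> sdeg p q" for c x
  proof -
    have "Poly_Mapping.lookup (S_scale c x) m = fun_scale c (Poly_Mapping.lookup x m)" for m
    proof -
      have "S_scale c x = (\<Sum>k\<in>Poly_Mapping.keys x. Poly_Mapping.single k (fun_scale c (Poly_Mapping.lookup x k)))"
        unfolding S_scale_def
        by (subst sum_single_lookup[of x, symmetric], unfold sum_distrib_left mult_single)
          (simp add: fun_scale_def times_fun_def)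
      then show ?thesis
        by (auto simp: lookup_sum lookup_single when_def in_keys_iff fun_scale_def fun_eq_iff)
    qed
    then show ?thesis
      using x fun_space.subspace_scale[OF hom_subspace] unfolding sdeg_iff
      by (metis fun_space.scale_zero_right)
  qed
qed

lemma single_mem_sdeg:
  "g \<in> hom p \<Longrightarrow> Poly_Mapping.keys m \<subseteq> {1..n} \<Longrightarrow> mdeg m = q \<Longrightarrow> Poly_Mapping.single m g \<in> sdeg p q"
  unfolding S_bideg_def mdeg_def by auto

lemma mdeg_eq: "Poly_Mapping.keys m \<subseteq> {1..n} \<Longrightarrow> mdeg m = (\<Sum>i = 1..n. Poly_Mapping.lookup m i)"
  unfolding mdeg_def by (intro sum.mono_neutral_left) (auto simp: in_keys_iff)

lemma hom_mult_form:
  assumes "\<phi> \<in> linear_forms scl" "g \<in> hom p"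
  shows "\<phi> * g \<in> hom (Suc p)"
  using assms(2) unfolding homogeneous_functions_def
proof (induction rule: fun_space.span_induct_alt)
  case base
  show ?case unfolding mult_zero_right by (rule fun_space.span_zero)
next
  case (step c x y)
  from step(1) obtain \<psi> where \<psi>: "x = (\<Prod>k<p. \<psi> k)" "\<forall>k<p. \<psi> k \<in> linear_forms scl" by blast
  have "\<phi> * x = (\<Prod>k<Suc p. (\<psi>(p := \<phi>)) k)" by (simp add: \<psi> mult.commute)
  moreover have "\<forall>k<Suc p. (\<psi>(p := \<phi>)) k \<in> linear_forms scl" using \<psi> assms(1) by auto
  ultimately have "\<phi> * x \<in> {\<Prod>k<Suc p. \<psi> k |\<psi>. \<forall>k<Suc p. \<psi> k \<in> linear_forms scl}" by blast
  from fun_space.span_add[OF fun_space.span_scale[OF fun_space.span_base[OF this], of c] step(2)]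
  show ?case
    by (simp only: distrib_left) (simp only: fun_scale_mult_right)
qed

lemma one_mem_hom: "1 \<in> hom 0"
  unfolding homogeneous_functions_def by (rule fun_space.span_base) simp

lemma one_mem_sdeg: "1 \<in> sdeg 0 0"
  using single_mem_sdeg[OF one_mem_hom, of 0 0] by (simp add: mdeg_def)

lemma lin_mult_mem_sdeg:
  assumes "\<phi> \<in> linear_forms scl" "s \<in> sdeg p q"
  shows "lin \<phi> * s \<in> sdeg (Suc p) q"
proof -
  have "lin \<phi> * s = (\<Sum>m\<in>Poly_Mapping.keys s. Poly_Mapping.single m (\<phi> * Poly_Mapping.lookup s m))"
    unfolding lin_def by (subst sum_single_lookup[of s, symmetric]) (simp add: sum_distrib_left mult_single)
  moreover have "Poly_Mapping.single m (\<phi> * Poly_Mapping.lookup s m) \<in> sdeg (Suc p) q" if "m \<in> Poly_Mapping.keys s" for m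
    using that assms by (intro single_mem_sdeg hom_mult_form) (auto simp: S_bideg_def mdeg_def)
  ultimately show ?thesis by (auto intro!: S_space.subspace_sum sdeg_subspace)
qed

lemma av_mult_mem_sdeg:
  assumes "i \<in> {1..n}" "s \<in> sdeg p q"
  shows "av i * s \<in> sdeg p (Suc q)"
proof -
  have "av i * s = (\<Sum>m\<in>Poly_Mapping.keys s. Poly_Mapping.single (Poly_Mapping.single i 1 + m) (Poly_Mapping.lookup s m))"
    unfolding av_def by (subst sum_single_lookup[of s, symmetric]) (simp add: sum_distrib_left mult_single)
  moreover have "Poly_Mapping.single (Poly_Mapping.single i 1 + m) (Poly_Mapping.lookup s m) \<in> sdeg p (Suc q)" if m: "m \<in> Poly_Mapping.keys s" for m
  proof (rule single_mem_sdeg)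
    have keys: "Poly_Mapping.keys m \<subseteq> {1..n}" "mdeg m = q" and g: "Poly_Mapping.lookup s m \<in> hom p"
      using m assms by (auto simp: S_bideg_def mdeg_def)
    show k: "Poly_Mapping.keys (Poly_Mapping.single i 1 + m) \<subseteq> {1..n}"
      using keys(1) assms(1) keys_add[of "Poly_Mapping.single i 1" m] by (auto split: if_splits)
    show "mdeg (Poly_Mapping.single i 1 + m) = Suc q"
      using assms(1) keys(2) unfolding mdeg_eq[OF k] mdeg_eq[OF keys(1)]
      by (simp add: lookup_add sum.distrib lookup_single when_def)
  qed (use m assms in \<open>auto simp: S_bideg_def\<close>)
  ultimately show ?thesis by (auto intro!: S_space.subspace_sum sdeg_subspace)
qed

text \<open>
  The forms \<open>f 1, \<dots>, f n\<close> span all linear forms but are dependent, so the monomials \<open>mon \<alpha>\<close> only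
  span \<open>S\<close>. The definition of \<open>reducible\<close> below needs no more than that.
\<close>
definition yvar :: "nat \<Rightarrow> 'v bipoly" where
  "yvar k = (if k < n then lin (f (Suc k)) else av (Suc (k - n)))"

definition mon :: "(nat \<Rightarrow> nat) \<Rightarrow> 'v bipoly" where
  "mon \<alpha> = (\<Prod>k<2 * n. yvar k ^ \<alpha> k)"

definition bimonos :: "nat \<Rightarrow> nat \<Rightarrow> (nat \<Rightarrow> nat) set" where
  "bimonos = bidegree_part n (2 * n) (exponents (2 * n))"

lemma index_split: "{..<2 * n} \<inter> {..<n} = {..<n}" "{..<2 * n} - {..<n} = {n..<2 * n}"
  by auto

lemma mon_add: "mon (\<alpha> + \<beta>) = mon \<alpha> * mon \<beta>"
  by (simp add: mon_def power_add prod.distrib)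

lemma mon_zero: "mon 0 = 1"
  by (simp add: mon_def)

lemma mon_single: 
  assumes "k < 2 * n"
  shows "mon (0(k := Suc 0)) = yvar k"
proof -
  have "mon (0(k := Suc 0)) = (\<Prod>j<2 * n. if j = k then yvar k else 1)"
    unfolding mon_def by (intro prod.cong) auto
  then show ?thesis using assms by simp
qed

lemma bimonos_add: "\<alpha> \<in> bimonos p q \<Longrightarrow> \<beta> \<in> bimonos p' q' \<Longrightarrow> \<alpha> + \<beta> \<in> bimonos (p + p') (q + q')"
  by (auto simp: bimonos_def bidegree_part_def exponents_def sum.distrib)

lemma zero_bimonos: "0 \<in> bimonos 0 0"
  by (auto simp: bimonos_def bidegree_part_def exponents_def)

lemma single_bimonos: "k < n \<Longrightarrow> 0(k := Suc 0) \<in> bimonos 1 0" "n \<le> k \<Longrightarrow> k < 2 * n \<Longrightarrow> 0(k := Suc 0) \<in> bimonos 0 1"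
  by (auto simp: bimonos_def bidegree_part_def exponents_def index_split zero_fun_def)

lemma finite_bimonos: "finite (bimonos p q)"
  unfolding bimonos_def by (rule bidegree_part_exponents_finite) simp

text \<open>Candidate for \<open>sdeg p q\<close>. Multiplication by forms and variables stays
  within such spans, so they contain every element of the bidegree.\<close>

definition tdeg :: "nat \<Rightarrow> nat \<Rightarrow> 'v bipoly set" where
  "tdeg p q = S_space.span (mon ` bimonos p q)"

lemma yvar_mult_tdeg:
  assumes "s \<in> tdeg p q" "k < 2 * n"
  shows "yvar k * s \<in> (if k < n then tdeg (Suc p) q else tdeg p (Suc q))"
proof (rule mult_span_subset[OF assms(1)[unfolded tdeg_def]])
  fix x assume "x \<in> mon ` bimonos p q"
  then obtain \<alpha> where \<alpha>: "x = mon \<alpha>" "\<alpha> \<in> bimonos p q" by blast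
  have "yvar k * x = mon (0(k := Suc 0) + \<alpha>)" by (simp add: mon_add mon_single assms(2) \<alpha>)
  moreover have "0(k := Suc 0) + \<alpha> \<in> (if k < n then bimonos (Suc p) q else bimonos p (Suc q))"
    using bimonos_add[OF single_bimonos(1) \<alpha>(2), of k] bimonos_add[OF single_bimonos(2) \<alpha>(2), of k] assms(2) by auto
  ultimately show "yvar k * x \<in> (if k < n then tdeg (Suc p) q else tdeg p (Suc q))"
    unfolding tdeg_def by (auto intro: S_space.span_base split: if_splits)
qed (simp add: tdeg_def)

text \<open>Here essentiality enters: every form vanishes on the trivial centre, so the defining
  forms span the dual space, and S is generated by the \<open>yvar k\<close>.\<close>

lemma form_in_span: "\<phi> \<in> linear_forms scl \<Longrightarrow> \<phi> \<in> fun_space.span (f ` {1..n})"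
  using flat_all by (intro vanishing_form_in_span) (auto simp: linear_form_zero)

lemma lin_mult_tdeg:
  assumes "\<phi> \<in> linear_forms scl" "s \<in> tdeg p q"
  shows "lin \<phi> * s \<in> tdeg (Suc p) q"
  using form_in_span[OF assms(1)]
proof (induction rule: fun_space.span_induct_alt)
  case base
  show ?case unfolding lin_0 tdeg_def by (simp add: S_space.span_zero)
next
  case (step c x y)
  from step(1) obtain i where i: "i \<in> {1..n}" "x = f i" by blast
  then have "yvar (i - 1) = lin x" "i - 1 < n" by (auto simp: yvar_def)
  then have "lin x * s \<in> tdeg (Suc p) q" using yvar_mult_tdeg[OF assms(2), of "i - 1"] by auto
  then show ?case using step(2)
    unfolding lin_add lin_fun_scale distrib_right mult_S_scale_left tdeg_def
    by (simp add: S_space.span_add S_space.span_scale)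
qed

lemma av_mult_tdeg:
  assumes "i \<in> {1..n}" "s \<in> tdeg p q"
  shows "av i * s \<in> tdeg p (Suc q)"
proof -
  have "yvar (n + i - 1) = av i" "n + i - 1 < 2 * n" "\<not> n + i - 1 < n" using assms(1) by (auto simp: yvar_def)
  then show ?thesis using yvar_mult_tdeg[OF assms(2), of "n + i - 1"] by auto
qed

lemma one_tdeg: "1 \<in> tdeg 0 0"
  unfolding tdeg_def using zero_bimonos mon_zero by (metis S_space.span_base image_eqI)

lemma single_one_tdeg:
  assumes "Poly_Mapping.keys m \<subseteq> {1..n}" "mdeg m = q"
  shows "Poly_Mapping.single m 1 \<in> tdeg 0 q"
  using assms
proof (induction q arbitrary: m)
  case 0
  then have "\<forall>i\<in>{1..n}. Poly_Mapping.lookup m i = 0" by (simp add: mdeg_eq)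
  then have "m = 0" using 0(1) by (metis in_keys_iff keys_eq_empty subset_eq ex_in_conv)
  show ?case unfolding \<open>m = 0\<close> single_one by (rule one_tdeg)
next
  case (Suc q)
  then have "m \<noteq> 0" by (auto simp: mdeg_def)
  then obtain i where i: "i \<in> Poly_Mapping.keys m" by (metis keys_eq_empty ex_in_conv)
  define m' where "m' = m - Poly_Mapping.single i 1"
  have m: "m = Poly_Mapping.single i 1 + m'"
    using i by (intro poly_mapping_eqI) (auto simp: m'_def lookup_add lookup_minus lookup_single when_def in_keys_iff)
  have keys: "Poly_Mapping.keys m' \<subseteq> {1..n}"
    using Suc(2) by (auto simp: m'_def in_keys_iff lookup_minus)
  have "mdeg m = Suc (mdeg m')"
    using i Suc(2) unfolding mdeg_eq[OF Suc(2)] mdeg_eq[OF keys]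
    by (auto simp: m lookup_add sum.distrib lookup_single when_def)
  then have "mdeg m' = q" using Suc.prems(2) by simp
  from Suc.IH[OF keys this] have "av i * Poly_Mapping.single m' 1 \<in> tdeg 0 (Suc q)"
    by (rule av_mult_tdeg[rotated]) (use i Suc(2) in auto)
  then show ?case unfolding av_def mult_single mult_1_left m[symmetric] .
qed

lemma sdeg_subset_tdeg: "sdeg p q \<subseteq> tdeg p q"
proof
  fix s assume s: "s \<in> sdeg p q"
  have "Poly_Mapping.single m g \<in> tdeg p q"
    if m: "Poly_Mapping.keys m \<subseteq> {1..n}" "mdeg m = q" and "g \<in> hom p" for m g
    using that(3) unfolding homogeneous_functions_def
  proof (induction rule: fun_space.span_induct_alt)
    case base
    show ?case unfolding tdeg_def single_zero by (rule S_space.span_zero)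
  next
    case (step c x y)
    from step(1) obtain \<psi> where \<psi>: "x = (\<Prod>k<p. \<psi> k)" "\<forall>k<p. \<psi> k \<in> linear_forms scl" by blast
    have "lin (\<Prod>k<r. \<psi> k) * Poly_Mapping.single m 1 \<in> tdeg r q" if "r \<le> p" for r
      using that
    proof (induction r)
      case 0
      show ?case using single_one_tdeg[OF m] by (simp only: lessThan_0 prod.empty lin_1 mult_1_left)
    next
      case (Suc r)
      then have "\<psi> r \<in> linear_forms scl" "r \<le> p" using \<psi>(2) by simp_all
      then have "lin (\<psi> r) * (lin (\<Prod>k<r. \<psi> k) * Poly_Mapping.single m 1) \<in> tdeg (Suc r) q"
        by (intro lin_mult_tdeg Suc.IH)
      then show ?case unfolding prod.lessThan_Suc lin_mult by (simp only: ac_simps)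
    qed
    from this[of p] have "Poly_Mapping.single m x \<in> tdeg p q"
      by (simp only: lin_def mult_single \<psi>(1)[symmetric] mult_1_right add_0_left order_refl)
    moreover have "Poly_Mapping.single m (fun_scale c x + y) = S_scale c (Poly_Mapping.single m x) + Poly_Mapping.single m y"
      unfolding single_add by (simp add: S_scale_def mult_single fun_scale_def times_fun_def)
    ultimately show ?case using step(2)
      unfolding tdeg_def by (metis S_space.span_add S_space.span_scale)
  qed
  then have "(\<Sum>m\<in>Poly_Mapping.keys s. Poly_Mapping.single m (Poly_Mapping.lookup s m)) \<in> tdeg p q"
    using s unfolding tdeg_def by (intro S_space.span_sum) (auto simp: S_bideg_def mdeg_def)
  then show "s \<in> tdeg p q" by (simp add: sum_single_lookup)
qed

lemma mon_induct:
  assumes "\<alpha> \<in> bimonos p q"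
    and "P 0 0 1"
    and "\<And>p q s \<phi>. P p q s \<Longrightarrow> \<phi> \<in> linear_forms scl \<Longrightarrow> P (Suc p) q (lin \<phi> * s)"
    and "\<And>p q s i. P p q s \<Longrightarrow> i \<in> {1..n} \<Longrightarrow> P p (Suc q) (av i * s)"
  shows "P p q (mon \<alpha>)"
  using assms(1)
proof (induction "p + q" arbitrary: \<alpha> p q)
  case 0
  then have "\<alpha> k = 0" for k
    by (cases "k < n"; cases "k < 2 * n") (auto simp: bimonos_def bidegree_part_def exponents_def index_split)
  then have "\<alpha> = 0" by (intro ext) simp
  moreover have "p = 0" "q = 0" using 0(1) by simp_all
  ultimately show ?case using assms(2) by (simp only: mon_zero)
next
  case (Suc r)
  have "\<exists>k<2 * n. \<alpha> k \<noteq> 0"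
  proof (rule ccontr)
    assume "\<not> ?thesis"
    then have "p = 0" "q = 0" using Suc.prems by (auto simp: bimonos_def bidegree_part_def index_split)
    then show False using Suc.hyps by simp
  qed
  then obtain k where k: "k < 2 * n" "\<alpha> k \<noteq> 0" by blast
  define \<beta> where "\<beta> = \<alpha>(k := \<alpha> k - 1)"
  have \<alpha>: "\<alpha> = 0(k := Suc 0) + \<beta>" using k by (auto simp: \<beta>_def fun_eq_iff)
  have expo: "\<beta> \<in> exponents (2 * n)" using Suc.prems by (auto simp: \<beta>_def bimonos_def bidegree_part_def exponents_def)
  show ?case
  proof (cases "k < n")
    case True
    then have s: "(\<Sum>j<n. \<alpha> j) = Suc (\<Sum>j<n. \<beta> j)" "(\<Sum>j=n..<2*n. \<alpha> j) = (\<Sum>j=n..<2*n. \<beta> j)"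
      by (auto simp: \<alpha> sum.distrib zero_fun_def)
    then obtain p' where p: "p = Suc p'" and \<beta>: "\<beta> \<in> bimonos p' q"
      using Suc.prems expo by (auto simp: bimonos_def bidegree_part_def index_split)
    have "P p' q (mon \<beta>)" using Suc.hyps \<beta> p by auto
    then have "P (Suc p') q (lin (f (Suc k)) * mon \<beta>)"
      using True by (intro assms(3) form) auto
    then show ?thesis using True k by (simp add: \<alpha> mon_add mon_single yvar_def p)
  next
    case False
    then have s: "(\<Sum>j<n. \<alpha> j) = (\<Sum>j<n. \<beta> j)" "(\<Sum>j=n..<2*n. \<alpha> j) = Suc (\<Sum>j=n..<2*n. \<beta> j)"
      using k by (auto simp: \<alpha> sum.distrib zero_fun_def)
    then obtain q' where q: "q = Suc q'" and \<beta>: "\<beta> \<in> bimonos p q'"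
      using Suc.prems expo by (auto simp: bimonos_def bidegree_part_def index_split)
    have "P p q' (mon \<beta>)" using Suc.hyps \<beta> q by auto
    then have "P p (Suc q') (av (Suc (k - n)) * mon \<beta>)"
      using False k by (intro assms(4)) auto
    then show ?thesis using False k by (simp add: \<alpha> mon_add mon_single yvar_def q)
  qed
qed

lemma mon_mem_sdeg: "\<alpha> \<in> bimonos p q \<Longrightarrow> mon \<alpha> \<in> sdeg p q"
  by (rule mon_induct[of \<alpha> p q "\<lambda>p q s. s \<in> sdeg p q"])
    (auto intro: one_mem_sdeg lin_mult_mem_sdeg av_mult_mem_sdeg)

lemma sdeg_eq_span: "sdeg p q = S_space.span (mon ` bimonos p q)"
proof
  show "sdeg p q \<subseteq> S_space.span (mon ` bimonos p q)" using sdeg_subset_tdeg by (simp add: tdeg_def)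
  show "S_space.span (mon ` bimonos p q) \<subseteq> sdeg p q"
    by (intro S_space.span_minimal sdeg_subspace) (auto intro: mon_mem_sdeg)
qed

text \<open>The predicate carries the bidegree, so that products, polynomiality along lines and
  membership in ideals can be treated without touching exponents.\<close>

lemma sdeg_induct [consumes 1, case_names zero add one lin av]:
  assumes "s \<in> sdeg p q"
    and "\<And>p q. P p q 0"
    and "\<And>p q c s t. P p q s \<Longrightarrow> P p q t \<Longrightarrow> P p q (S_scale c s + t)"
    and "P 0 0 1"
    and "\<And>p q s \<phi>. P p q s \<Longrightarrow> \<phi> \<in> linear_forms scl \<Longrightarrow> P (Suc p) q (lin \<phi> * s)"
    and "\<And>p q s i. P p q s \<Longrightarrow> i \<in> {1..n} \<Longrightarrow> P p (Suc q) (av i * s)"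
  shows "P p q s"
  using assms(1) unfolding sdeg_eq_span
proof (induction rule: S_space.span_induct_alt)
  case (step c x y)
  from step(1) obtain \<alpha> where "\<alpha> \<in> bimonos p q" "x = mon \<alpha>" by blast
  then have "P p q x" using mon_induct[of \<alpha> p q P] assms(4-6) by blast
  then show ?case using step(2) by (rule assms(3))
qed (rule assms(2))

lemma sdeg_mult:
  assumes "s \<in> sdeg p q" "t \<in> sdeg p' q'"
  shows "s * t \<in> sdeg (p + p') (q + q')"
  using assms(1)
proof (induction rule: sdeg_induct)
  case (zero p q)
  show ?case by (simp add: S_space.subspace_0[OF sdeg_subspace])
next
  case (add p q c s u)
  then show ?case
    by (simp add: distrib_right mult_S_scale_left S_space.subspace_add[OF sdeg_subspace] S_space.subspace_scale[OF sdeg_subspace])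
next
  case one
  show ?case using assms(2) by simp
next
  case (lin p q s \<phi>)
  then show ?case using lin_mult_mem_sdeg[of \<phi> "s * t"] by (simp add: mult.assoc)
next
  case (av p q s i)
  then show ?case using av_mult_mem_sdeg[of i "s * t"] by (simp add: mult.assoc)
qed

lemma lin_mem_sdeg: "\<phi> \<in> linear_forms scl \<Longrightarrow> lin \<phi> \<in> sdeg 1 0"
  using lin_mult_mem_sdeg[OF _ one_mem_sdeg] by simp

lemma av_mem_sdeg: "i \<in> {1..n} \<Longrightarrow> av i \<in> sdeg 0 1"
  using av_mult_mem_sdeg[OF _ one_mem_sdeg] by simp

end

section \<open>Standard monomials\<close>

text \<open>Extremal elements are only taken inside one bidegree, which contains finitely many
  exponents, so well-foundedness is not an issue.\<close>

definition lex_less :: "(nat \<Rightarrow> nat) \<Rightarrow> (nat \<Rightarrow> nat) \<Rightarrow> bool" where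
  "lex_less \<beta> \<alpha> \<longleftrightarrow> (\<exists>k. \<beta> k < \<alpha> k \<and> (\<forall>j<k. \<beta> j = \<alpha> j))"

lemma lex_less_irrefl: "\<not> lex_less \<alpha> \<alpha>"
  by (simp add: lex_less_def)

lemma lex_less_trans:
  assumes "lex_less \<alpha> \<beta>" "lex_less \<beta> \<gamma>"
  shows "lex_less \<alpha> \<gamma>"
proof -
  obtain k where k: "\<alpha> k < \<beta> k" "\<forall>j<k. \<alpha> j = \<beta> j" using assms(1) by (auto simp: lex_less_def)
  obtain l where l: "\<beta> l < \<gamma> l" "\<forall>j<l. \<beta> j = \<gamma> j" using assms(2) by (auto simp: lex_less_def)
  have "\<alpha> (min k l) < \<gamma> (min k l)" "\<forall>j<min k l. \<alpha> j = \<gamma> j"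
    using k l by (cases k l rule: linorder_cases; auto)+
  then show ?thesis unfolding lex_less_def by blast
qed

lemma lex_less_linear:
  assumes "\<alpha> \<noteq> \<beta>"
  shows "lex_less \<alpha> \<beta> \<or> lex_less \<beta> \<alpha>"
proof -
  have ex: "\<exists>k. \<alpha> k \<noteq> \<beta> k" using assms by (auto simp: fun_eq_iff)
  define k where "k = (LEAST k. \<alpha> k \<noteq> \<beta> k)"
  have "\<alpha> k \<noteq> \<beta> k" unfolding k_def using ex by (rule LeastI_ex)
  moreover have "\<forall>j<k. \<alpha> j = \<beta> j" unfolding k_def using not_less_Least by blast
  ultimately show ?thesis unfolding lex_less_def by (metis linorder_neqE_nat)
qed

lemma lex_less_add: "lex_less \<beta> \<alpha> \<Longrightarrow> lex_less (\<gamma> + \<beta>) (\<gamma> + \<alpha>)"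
  by (auto simp: lex_less_def)

lemma asymp_lex_less: "asymp_on A lex_less"
  using lex_less_trans lex_less_irrefl by (intro asymp_onI) blast

lemma transp_lex_less: "transp_on A lex_less"
  using lex_less_trans by (intro transp_onI) blast

context essential_arrangement
begin

section \<open>Polynomial functions and the ring S\<close>

lemma poly_functions_scale: "g \<in> poly_functions scl \<Longrightarrow> fun_scale c g \<in> poly_functions scl"
proof -
  assume "g \<in> poly_functions scl"
  then have "(\<lambda>_. c) * g \<in> poly_functions scl" by (intro poly_functions.mult poly_functions.const)
  moreover have "(\<lambda>_. c) * g = fun_scale c g" by (simp add: fun_scale_def fun_eq_iff)
  ultimately show ?thesis by simp
qed

lemma poly_functions_prod:
  "(\<And>k. k \<in> K \<Longrightarrow> g k \<in> poly_functions scl) \<Longrightarrow> (\<Prod>k\<in>K. g k) \<in> poly_functions scl"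
proof (induction K rule: infinite_finite_induct)
  case (insert k K)
  then show ?case unfolding prod.insert[OF insert(1,2)] by (intro poly_functions.mult) auto
qed (simp_all add: poly_functions.const one_fun_def)

lemma hom_subset_poly_functions: "hom p \<subseteq> poly_functions scl"
proof
  fix g assume "g \<in> hom p"
  then show "g \<in> poly_functions scl"
    unfolding homogeneous_functions_def
  proof (induction rule: fun_space.span_induct_alt)
    case base
    then show ?case using poly_functions.const[of 0] by (simp add: zero_fun_def)
  next
    case (step c x y)
    from step(1) obtain \<psi> where \<psi>: "x = (\<Prod>k<p. \<psi> k)" "\<forall>k<p. \<psi> k \<in> linear_forms scl" by blast
    have "x \<in> poly_functions scl"
      unfolding \<psi>(1) by (rule poly_functions_prod, rule poly_functions.linear) (use \<psi>(2) in auto)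
    then show ?case using step(2) by (intro poly_functions.add poly_functions_scale)
  qed
qed

lemma poly_functions_sum:
  "(\<And>k. k \<in> K \<Longrightarrow> g k \<in> poly_functions scl) \<Longrightarrow> (\<Sum>k\<in>K. g k) \<in> poly_functions scl"
proof (induction K rule: infinite_finite_induct)
  case (insert k K)
  then show ?case unfolding sum.insert[OF insert(1,2)] by (intro poly_functions.add) auto
qed (simp_all add: poly_functions.const zero_fun_def)

lemma S_ring_iff:
  "s \<in> S_ring scl n \<longleftrightarrow> (\<forall>m. Poly_Mapping.lookup s m \<in> poly_functions scl \<and>
     (Poly_Mapping.lookup s m \<noteq> 0 \<longrightarrow> Poly_Mapping.keys m \<subseteq> {1..n}))"
proof -
  have "0 \<in> poly_functions scl" using poly_functions.const[of 0] by (simp add: zero_fun_def)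
  then show ?thesis unfolding S_ring_def in_keys_iff mem_Collect_eq Ball_def by metis
qed

lemma S_ring_zero: "0 \<in> S_ring scl n"
  by (simp add: S_ring_def)

lemma S_ring_add:
  assumes "s \<in> S_ring scl n" "t \<in> S_ring scl n"
  shows "s + t \<in> S_ring scl n"
proof -
  have "Poly_Mapping.lookup s m \<noteq> 0 \<or> Poly_Mapping.lookup t m \<noteq> 0" if "Poly_Mapping.lookup s m + Poly_Mapping.lookup t m \<noteq> 0" for m
    using that by (metis add.right_neutral)
  then show ?thesis
    using assms poly_functions.add unfolding S_ring_iff lookup_add by metis
qed

lemma S_ring_sum: "(\<And>k. k \<in> K \<Longrightarrow> g k \<in> S_ring scl n) \<Longrightarrow> (\<Sum>k\<in>K. g k) \<in> S_ring scl n"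
  by (induction K rule: infinite_finite_induct) (auto intro: S_ring_add S_ring_zero)

lemma S_ring_mult:
  assumes "s \<in> S_ring scl n" "t \<in> S_ring scl n"
  shows "s * t \<in> S_ring scl n"
proof -
  have "s * t = (\<Sum>k\<in>Poly_Mapping.keys s. \<Sum>l\<in>Poly_Mapping.keys t.
      Poly_Mapping.single (k + l) (Poly_Mapping.lookup s k * Poly_Mapping.lookup t l))"
    by (subst sum_single_lookup[of s, symmetric], subst sum_single_lookup[of t, symmetric])
      (simp only: sum_product mult_single)
  moreover have "Poly_Mapping.single (k + l) (Poly_Mapping.lookup s k * Poly_Mapping.lookup t l) \<in> S_ring scl n"
    if "k \<in> Poly_Mapping.keys s" "l \<in> Poly_Mapping.keys t" for k l
  proof -
    have "Poly_Mapping.keys (k + l) \<subseteq> {1..n}"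
      using that assms keys_add[of k l] unfolding S_ring_def by blast
    moreover have "Poly_Mapping.lookup s k * Poly_Mapping.lookup t l \<in> poly_functions scl"
      using that assms by (intro poly_functions.mult) (auto simp: S_ring_def)
    ultimately show ?thesis unfolding S_ring_def by simp
  qed
  ultimately show ?thesis by (simp add: S_ring_sum)
qed

lemma sdeg_subset_S_ring: "sdeg p q \<subseteq> S_ring scl n"
  using hom_subset_poly_functions unfolding S_bideg_def S_ring_def by blast

section \<open>The logarithmic ideal in one bidegree\<close>

abbreviation I :: "'v bipoly set" where
  "I \<equiv> log_ideal scl n f"

lemma log_ideal_add: "s \<in> I \<Longrightarrow> t \<in> I \<Longrightarrow> s + t \<in> I"
  by (induction rule: log_ideal.induct) (auto simp: add.assoc intro: log_ideal.step)

lemma log_ideal_mult: "s \<in> I \<Longrightarrow> r \<in> S_ring scl n \<Longrightarrow> r * s \<in> I"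
proof (induction rule: log_ideal.induct)
  case (step s w z)
  have "(r * s) * w + r * z \<in> I"
    using step by (intro log_ideal.step S_ring_mult) auto
  then show ?case by (simp add: algebra_simps)
qed (simp add: log_ideal.zero)

lemma log_ideal_subspace: "S_space.subspace I"
proof (rule S_space.subspaceI)
  show "S_scale c x \<in> I" if "x \<in> I" for c x
    unfolding S_scale_eq_lin
    using that by (intro log_ideal_mult) (auto simp: S_ring_def lin_def poly_functions.const)
qed (auto intro: log_ideal.zero log_ideal_add)

definition Ideg :: "nat \<Rightarrow> nat \<Rightarrow> 'v bipoly set" where
  "Ideg p q = I \<inter> sdeg p q"

lemma Ideg_subspace: "S_space.subspace (Ideg p q)"
  unfolding Ideg_def by (intro S_space.subspace_inter log_ideal_subspace sdeg_subspace)

lemma Ideg_mult: "s \<in> Ideg p q \<Longrightarrow> t \<in> sdeg p' q' \<Longrightarrow> t * s \<in> Ideg (p' + p) (q' + q)"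
  unfolding Ideg_def using log_ideal_mult sdeg_subset_S_ring sdeg_mult by blast

lemma quotient_dim_le:
  assumes "finite B" "sdeg p q \<subseteq> S_space.span (B \<union> Ideg p q)"
  shows "quotient_dim scl n f p q \<le> card B"
proof -
  have "S_space.dim (sdeg p q) \<le> card B + S_space.dim (Ideg p q)"
    using sdeg_eq_span finite_bimonos
    by (intro S_space.dim_le_card_add_dim[of _ _ _ "mon ` bimonos p q"] assms) (auto simp: Ideg_def)
  then show ?thesis unfolding quotient_dim_def Ideg_def by simp
qed

lemma quotient_dim_ge:
  assumes "finite B" "B \<subseteq> sdeg p q" "independent_mod S_scale (Ideg p q) B"
  shows "card B \<le> quotient_dim scl n f p q"
proof -
  have "card B + S_space.dim (Ideg p q) \<le> S_space.dim (sdeg p q)"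
    using sdeg_eq_span finite_bimonos
    by (intro S_space.card_add_dim_le[of _ _ _ "mon ` bimonos p q"] assms Ideg_subspace) (auto simp: Ideg_def)
  then show ?thesis unfolding quotient_dim_def Ideg_def by simp
qed

text \<open>In terms of the polynomial ring in 2 n variables that maps onto S: \<alpha> is the
  lexicographically largest exponent of a bihomogeneous polynomial mapping into I. Linear relations
  among the forms are thus treated like relations coming from I.\<close>

definition reducible :: "nat \<Rightarrow> nat \<Rightarrow> (nat \<Rightarrow> nat) \<Rightarrow> bool" where
  "reducible p q \<alpha> \<longleftrightarrow> mon \<alpha> \<in> S_space.span (mon ` {\<beta> \<in> bimonos p q. lex_less \<beta> \<alpha>} \<union> Ideg p q)"

definition standard :: "(nat \<Rightarrow> nat) set" where
  "standard = {\<alpha>. \<exists>p q. \<alpha> \<in> bimonos p q \<and> \<not> reducible p q \<alpha>}"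

lemma exponents_bimonos: "\<alpha> \<in> exponents (2 * n) \<Longrightarrow> \<exists>p q. \<alpha> \<in> bimonos p q"
  by (auto simp: bimonos_def bidegree_part_def)

lemma bimonos_unique: "\<alpha> \<in> bimonos p q \<Longrightarrow> \<alpha> \<in> bimonos p' q' \<Longrightarrow> p = p' \<and> q = q'"
  by (auto simp: bimonos_def bidegree_part_def)

text \<open>Multiplication by \<open>mon \<gamma>\<close> respects both the order and the ideal.
  Hence the reducible exponents form a monomial ideal and the standard ones a down-closed
  set.\<close>

lemma reducible_add:
  assumes "reducible p q \<alpha>" "\<gamma> \<in> bimonos p' q'"
  shows "reducible (p' + p) (q' + q) (\<gamma> + \<alpha>)"
proof -
  have "mon \<gamma> * mon \<alpha> \<in> S_space.span (mon ` {\<beta> \<in> bimonos (p' + p) (q' + q). lex_less \<beta> (\<gamma> + \<alpha>)} \<union> Ideg (p' + p) (q' + q))"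
  proof (rule mult_span_subset[OF assms(1)[unfolded reducible_def]])
    fix x assume "x \<in> mon ` {\<beta> \<in> bimonos p q. lex_less \<beta> \<alpha>} \<union> Ideg p q"
    then show "mon \<gamma> * x \<in> S_space.span (mon ` {\<beta> \<in> bimonos (p' + p) (q' + q). lex_less \<beta> (\<gamma> + \<alpha>)} \<union> Ideg (p' + p) (q' + q))"
    proof
      assume "x \<in> mon ` {\<beta> \<in> bimonos p q. lex_less \<beta> \<alpha>}"
      then obtain \<beta> where \<beta>: "x = mon \<beta>" "\<beta> \<in> bimonos p q" "lex_less \<beta> \<alpha>" by blast
      then have "\<gamma> + \<beta> \<in> {\<beta> \<in> bimonos (p' + p) (q' + q). lex_less \<beta> (\<gamma> + \<alpha>)}"
        using bimonos_add[OF assms(2)] lex_less_add by blast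
      then show ?thesis unfolding \<beta>(1) mon_add[symmetric] by (intro S_space.span_base) blast
    next
      assume "x \<in> Ideg p q"
      then show ?thesis using Ideg_mult mon_mem_sdeg[OF assms(2)] by (intro S_space.span_base) blast
    qed
  qed simp
  then show ?thesis by (simp only: reducible_def mon_add)
qed

lemma standard_down_closed: "down_closed (2 * n) standard"
  unfolding down_closed_def
proof (intro conjI ballI allI impI)
  show "standard \<subseteq> exponents (2 * n)"
    by (auto simp: standard_def bimonos_def bidegree_part_def)
  fix \<alpha> \<beta> assume \<alpha>: "\<alpha> \<in> standard" and le: "\<beta> \<le> \<alpha>"
  define \<gamma> where "\<gamma> = (\<lambda>k. \<alpha> k - \<beta> k)"
  have eq: "\<alpha> = \<gamma> + \<beta>" using le by (auto simp: \<gamma>_def le_fun_def fun_eq_iff)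
  have "\<alpha> \<in> exponents (2 * n)" using \<alpha> by (auto simp: standard_def bimonos_def bidegree_part_def)
  then have "\<gamma> \<in> exponents (2 * n)" "\<beta> \<in> exponents (2 * n)" by (auto simp: eq exponents_def)
  then obtain p q p' q' where pq: "\<beta> \<in> bimonos p q" "\<gamma> \<in> bimonos p' q'" using exponents_bimonos by meson
  have "\<not> reducible p q \<beta>"
  proof
    assume "reducible p q \<beta>"
    then have "reducible (p' + p) (q' + q) \<alpha>" unfolding eq using pq(2) by (rule reducible_add)
    moreover have "\<alpha> \<in> bimonos (p' + p) (q' + q)" unfolding eq using pq by (intro bimonos_add)
    ultimately show False using \<alpha> bimonos_unique unfolding standard_def by blast
  qed
  then show "\<beta> \<in> standard" using pq(1) unfolding standard_def by blast
qed

lemma standard_part: "bidegree_part n (2 * n) standard p q = {\<alpha> \<in> bimonos p q. \<not> reducible p q \<alpha>}"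
proof -
  have "\<alpha> \<in> bimonos p q \<longleftrightarrow> \<alpha> \<in> bidegree_part n (2 * n) standard p q" if "\<alpha> \<in> standard" for \<alpha>
    using that standard_down_closed by (auto simp: bidegree_part_def bimonos_def down_closed_def)
  then show ?thesis
    using bimonos_unique unfolding standard_def bidegree_part_def by blast
qed

text \<open>Macaulay's argument: in each bidegree the standard monomials represent a basis of
  S/I.\<close>

lemma quotient_dim_eq_standard:
  "quotient_dim scl n f p q = card (bidegree_part n (2 * n) standard p q)"
proof -
  define A where "A = {\<alpha> \<in> bimonos p q. \<not> reducible p q \<alpha>}"
  have finA: "finite A" unfolding A_def using finite_bimonos by simp
  \<comment> \<open>If two exponents give the same monomial, the larger one is reducible through the
    smaller.\<close>
  have inj: "inj_on mon A"
  proof (rule inj_onI)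
    fix \<alpha> \<beta> assume ab: "\<alpha> \<in> A" "\<beta> \<in> A" "mon \<alpha> = mon \<beta>"
    have no: "\<not> lex_less \<alpha> \<beta>" if "\<alpha> \<in> A" "\<beta> \<in> A" "mon \<alpha> = mon \<beta>" for \<alpha> \<beta>
    proof
      assume "lex_less \<alpha> \<beta>"
      then have "mon \<alpha> \<in> mon ` {\<alpha> \<in> bimonos p q. lex_less \<alpha> \<beta>}" using that(1) by (intro imageI) (simp add: A_def)
      then have "reducible p q \<beta>"
        unfolding reducible_def that(3)[symmetric] by (intro S_space.span_base) blast
      then show False using that by (simp add: A_def)
    qed
    show "\<alpha> = \<beta>" using no[OF ab] no[OF ab(2,1) ab(3)[symmetric]] lex_less_linear by blast
  qed
  \<comment> \<open>A minimal exponent outside the span would be reducible, hence a combination of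
    smaller ones, which lie inside.\<close>
  have spans: "mon \<alpha> \<in> S_space.span (mon ` A \<union> Ideg p q)" if "\<alpha> \<in> bimonos p q" for \<alpha>
  proof (rule ccontr)
    define bad where "bad = {\<alpha> \<in> bimonos p q. mon \<alpha> \<notin> S_space.span (mon ` A \<union> Ideg p q)}"
    assume "\<not> ?thesis"
    then have "finite bad" "bad \<noteq> {}" using that finite_bimonos by (auto simp: bad_def)
    then obtain \<beta> where \<beta>: "\<beta> \<in> bad" "\<forall>\<gamma>\<in>bad. \<gamma> \<noteq> \<beta> \<longrightarrow> \<not> lex_less \<gamma> \<beta>"
      using Finite_Set.bex_min_element[OF _ asymp_lex_less transp_lex_less] by metis
    have "reducible p q \<beta>"
    proof (rule ccontr)
      assume "\<not> reducible p q \<beta>"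
      then have "mon \<beta> \<in> mon ` A \<union> Ideg p q" using \<beta>(1) by (simp add: bad_def A_def)
      from S_space.span_base[OF this] \<beta>(1) show False by (simp only: bad_def mem_Collect_eq simp_thms)
    qed
    moreover have "mon \<gamma> \<in> S_space.span (mon ` A \<union> Ideg p q)" if "\<gamma> \<in> bimonos p q" "lex_less \<gamma> \<beta>" for \<gamma>
    proof (rule ccontr)
      assume "\<not> ?thesis"
      then have "\<gamma> \<in> bad" using that by (simp add: bad_def)
      then show False using \<beta>(2) that(2) lex_less_irrefl by metis
    qed
    then have "mon ` {\<gamma> \<in> bimonos p q. lex_less \<gamma> \<beta>} \<union> Ideg p q \<subseteq> S_space.span (mon ` A \<union> Ideg p q)"
      using S_space.span_superset by blast
    ultimately have "mon \<beta> \<in> S_space.span (mon ` A \<union> Ideg p q)"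
      unfolding reducible_def using S_space.span_minimal[OF _ S_space.subspace_span] by blast
    then show False using \<beta>(1) by (simp add: bad_def)
  qed
  \<comment> \<open>The largest exponent with nonzero coefficient in a relation modulo I would be
    reducible.\<close>
  have ind: "independent_mod S_scale (Ideg p q) (mon ` A)"
    unfolding independent_mod_def
  proof (intro allI impI)
    fix c assume "(\<Sum>b\<in>mon ` A. S_scale (c b) b) \<in> Ideg p q"
    then have sum: "(\<Sum>\<alpha>\<in>A. S_scale (c (mon \<alpha>)) (mon \<alpha>)) \<in> Ideg p q" (is "?s \<in> _")
      by (simp add: sum.reindex[OF inj])
    show "\<forall>b\<in>mon ` A. c b = 0"
    proof (rule ccontr)
      define N where "N = {\<alpha> \<in> A. c (mon \<alpha>) \<noteq> 0}"
      assume "\<not> ?thesis"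
      then have "finite N" "N \<noteq> {}" using finA by (auto simp: N_def)
      then obtain \<beta> where \<beta>: "\<beta> \<in> N" "\<forall>\<gamma>\<in>N. \<gamma> \<noteq> \<beta> \<longrightarrow> \<not> lex_less \<beta> \<gamma>"
        using Finite_Set.bex_max_element[OF _ asymp_lex_less transp_lex_less] by metis
      have \<beta>A: "\<beta> \<in> A" "c (mon \<beta>) \<noteq> 0" using \<beta>(1) by (auto simp: N_def)
      let ?L = "S_space.span (mon ` {\<gamma> \<in> bimonos p q. lex_less \<gamma> \<beta>} \<union> Ideg p q)"
      have "S_scale (c (mon \<gamma>)) (mon \<gamma>) \<in> ?L" if "\<gamma> \<in> A - {\<beta>}" for \<gamma>
      proof (cases "\<gamma> \<in> N")
        case True
        then have "lex_less \<gamma> \<beta>" using that \<beta>(2) lex_less_linear by blast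
        then show ?thesis using that by (intro S_space.span_scale S_space.span_base) (auto simp: A_def)
      next
        case False
        then have "c (mon \<gamma>) = 0" using that by (simp add: N_def)
        then show ?thesis by (simp add: S_space.span_zero)
      qed
      then have rest: "(\<Sum>\<gamma>\<in>A - {\<beta>}. S_scale (c (mon \<gamma>)) (mon \<gamma>)) \<in> ?L" by (rule S_space.span_sum)
      have "?s \<in> ?L" using sum by (intro S_space.span_base) blast
      then have "?s - (\<Sum>\<gamma>\<in>A - {\<beta>}. S_scale (c (mon \<gamma>)) (mon \<gamma>)) \<in> ?L" using rest by (rule S_space.span_diff)
      then have "S_scale (c (mon \<beta>)) (mon \<beta>) \<in> ?L"
        by (simp add: sum.remove[OF finA \<beta>A(1)])
      then have "S_scale (inverse (c (mon \<beta>))) (S_scale (c (mon \<beta>)) (mon \<beta>)) \<in> ?L" by (rule S_space.span_scale)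
      then have "reducible p q \<beta>" using \<beta>A(2) by (simp add: reducible_def)
      then show False using \<beta>A(1) by (simp add: A_def)
    qed
  qed
  have "quotient_dim scl n f p q \<le> card (mon ` A)"
  proof (rule quotient_dim_le)
    show "sdeg p q \<subseteq> S_space.span (mon ` A \<union> Ideg p q)"
      unfolding sdeg_eq_span using spans by (intro S_space.span_minimal) auto
  qed (simp add: finA)
  moreover have "card (mon ` A) \<le> quotient_dim scl n f p q"
    using finA ind mon_mem_sdeg by (intro quotient_dim_ge) (auto simp: A_def)
  ultimately show ?thesis
    by (simp add: standard_part card_image[OF inj] flip: A_def)
qed

lemma quotient_dim_sum_of_pieces: "sum_of_pieces (quotient_dim scl n f)"
proof -
  have "quotient_dim scl n f = (\<lambda>p q. card (bidegree_part n (2 * n) standard p q))"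
    by (intro ext quotient_dim_eq_standard)
  then show ?thesis using card_bidegree_part_down_closed[OF standard_down_closed] by simp
qed


section \<open>Upper bound\<close>

definition support :: "nat set \<Rightarrow> 'v \<Rightarrow> nat set" where
  "support E v = {i \<in> E. f i v \<noteq> 0}"

text \<open>The contraction of the derivation P \<partial>_v, with P the product of the forms not
  vanishing at v: it maps f_i to f_i(v) P, and division by f_i removes one factor.\<close>

definition contr :: "nat set \<Rightarrow> 'v \<Rightarrow> 'v bipoly" where
  "contr E v = (\<Sum>i\<in>support E v. S_scale (f i v) (av i * (\<Prod>j\<in>support E v - {i}. lin (f j))))"

text \<open>All minors live in the same ring S: the forms vanishing on \<open>flat F\<close> and the
  variables \<open>a i\<close> with i outside E are killed. Generators carry their bidegree. For an
  empty support \<open>contr\<close> is 0, so the truncated degree is harmless.\<close>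

inductive minor_gen :: "nat set \<Rightarrow> nat set \<Rightarrow> nat \<Rightarrow> nat \<Rightarrow> 'v bipoly \<Rightarrow> bool" for F E where
  lform: "\<phi> \<in> linear_forms scl \<Longrightarrow> (\<And>x. x \<in> flat F \<Longrightarrow> \<phi> x = 0) \<Longrightarrow> minor_gen F E 1 0 (lin \<phi>)"
| var: "i \<in> {1..n} \<Longrightarrow> i \<notin> E \<Longrightarrow> minor_gen F E 0 1 (av i)"
| sum: "minor_gen F E 0 1 (\<Sum>i\<in>E. av i)"
| contr: "v \<in> flat F \<Longrightarrow> minor_gen F E (card (support E v) - 1) 1 (contr E v)"

text \<open>Only graded pieces are defined, so bihomogeneity is built in.\<close>

definition minor_ideal :: "nat set \<Rightarrow> nat set \<Rightarrow> nat \<Rightarrow> nat \<Rightarrow> 'v bipoly set" where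
  "minor_ideal F E p q = S_space.span
     {s * g |s g p0 q0 p1 q1. minor_gen F E p0 q0 g \<and> s \<in> sdeg p1 q1 \<and> p = p1 + p0 \<and> q = q1 + q0}"

definition av_part :: "nat \<Rightarrow> nat \<Rightarrow> nat \<Rightarrow> 'v bipoly set" where
  "av_part e p q = {av e * s |s q'. q = Suc q' \<and> s \<in> sdeg p q'}"

definition form_part :: "nat \<Rightarrow> nat \<Rightarrow> nat \<Rightarrow> 'v bipoly set" where
  "form_part e p q = {lin (f e) * s |s p'. p = Suc p' \<and> s \<in> sdeg p' q}"

lemma minor_ideal_subspace: "S_space.subspace (minor_ideal F E p q)"
  by (simp add: minor_ideal_def)

lemma minor_idealI:
  "minor_gen F E p0 q0 g \<Longrightarrow> s \<in> sdeg p1 q1 \<Longrightarrow> s * g \<in> minor_ideal F E (p1 + p0) (q1 + q0)"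
  unfolding minor_ideal_def by (rule S_space.span_base) blast

lemma minor_ideal_mult:
  assumes "z \<in> minor_ideal F E p q" "t \<in> sdeg p' q'"
  shows "t * z \<in> minor_ideal F E (p' + p) (q' + q)"
proof (rule mult_span_subset[OF assms(1)[unfolded minor_ideal_def] _ minor_ideal_subspace])
  fix x assume "x \<in> {s * g |s g p0 q0 p1 q1. minor_gen F E p0 q0 g \<and> s \<in> sdeg p1 q1 \<and> p = p1 + p0 \<and> q = q1 + q0}"
  then obtain s g p0 q0 p1 q1 where x: "x = s * g" "minor_gen F E p0 q0 g" "s \<in> sdeg p1 q1" "p = p1 + p0" "q = q1 + q0"
    by blast
  have "t * s * g \<in> minor_ideal F E (p' + p1 + p0) (q' + q1 + q0)"
    by (intro minor_idealI x sdeg_mult assms)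
  then show "t * x \<in> minor_ideal F E (p' + p) (q' + q)" by (simp add: x ac_simps)
qed

lemma minor_ideal_subset:
  assumes "\<And>s g p0 q0 p1 q1. minor_gen F E p0 q0 g \<Longrightarrow> s \<in> sdeg p1 q1 \<Longrightarrow> p = p1 + p0 \<Longrightarrow> q = q1 + q0 \<Longrightarrow> s * g \<in> Y"
    and "S_space.subspace Y"
  shows "minor_ideal F E p q \<subseteq> Y"
  unfolding minor_ideal_def using assms by (intro S_space.span_minimal) auto

lemma prod_lin_mem_sdeg: "finite D \<Longrightarrow> D \<subseteq> {1..n} \<Longrightarrow> (\<Prod>j\<in>D. lin (f j)) \<in> sdeg (card D) 0"
proof (induction D rule: finite_induct)
  case empty
  show ?case using one_mem_sdeg by simp
next
  case (insert e D)
  then show ?case using lin_mult_mem_sdeg[OF form, of e] by simp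
qed

lemma contr_mem_sdeg:
  assumes "finite E" "E \<subseteq> {1..n}"
  shows "contr E v \<in> sdeg (card (support E v) - 1) 1"
  unfolding contr_def
proof (rule S_space.subspace_sum[OF sdeg_subspace])
  fix i assume i: "i \<in> support E v"
  have sub: "support E v \<subseteq> {1..n}" "finite (support E v)" using assms by (auto simp: support_def)
  have "av i * (\<Prod>j\<in>support E v - {i}. lin (f j)) \<in> sdeg (0 + card (support E v - {i})) (1 + 0)"
    using sub i by (intro sdeg_mult av_mem_sdeg prod_lin_mem_sdeg) auto
  then show "S_scale (f i v) (av i * (\<Prod>j\<in>support E v - {i}. lin (f j))) \<in> sdeg (card (support E v) - 1) 1"
    using i sub by (simp add: S_space.subspace_scale[OF sdeg_subspace])
qed

lemma minor_idealI':
  assumes "minor_gen F E p0 q0 g" "s \<in> sdeg p1 q1" "p = p1 + p0" "q = q1 + q0"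
  shows "s * g \<in> S_space.span (minor_ideal F E p q \<union> A)"
  using minor_idealI[OF assms(1,2)] assms(3,4) by (intro S_space.span_base) auto

lemma av_partI: "s \<in> sdeg p q' \<Longrightarrow> q = Suc q' \<Longrightarrow> av_part e p q \<subseteq> A \<Longrightarrow> av e * s \<in> S_space.span A"
  unfolding av_part_def by (intro S_space.span_base) blast

lemma form_partI: "s \<in> sdeg p' q \<Longrightarrow> p = Suc p' \<Longrightarrow> form_part e p q \<subseteq> A \<Longrightarrow> lin (f e) * s \<in> S_space.span A"
  unfolding form_part_def by (intro S_space.span_base) blast

lemma support_insert: "support (insert e E) v = (if f e v = 0 then support E v else insert e (support E v))"
  by (auto simp: support_def)

lemma contr_insert_zero: "f e v = 0 \<Longrightarrow> contr (insert e E) v = contr E v"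
  by (simp add: contr_def support_insert)

text \<open>The summand of e has the full product over the old support; all others gain the factor
  \<open>f e\<close>. So modulo \<open>a e\<close>, the new contraction is \<open>f e\<close> times
  the old one.\<close>

lemma contr_insert:
  assumes "finite E" "e \<notin> E" "f e v \<noteq> 0"
  shows "contr (insert e E) v = S_scale (f e v) (av e * (\<Prod>j\<in>support E v. lin (f j))) + lin (f e) * contr E v"
proof -
  have fin: "finite (support E v)" and e: "e \<notin> support E v" using assms by (auto simp: support_def)
  have "av i * (\<Prod>j\<in>insert e (support E v) - {i}. lin (f j)) = lin (f e) * (av i * (\<Prod>j\<in>support E v - {i}. lin (f j)))"
    if "i \<in> support E v" for i
  proof -
    have "insert e (support E v) - {i} = insert e (support E v - {i})" using that e by auto
    then show ?thesis using fin e by (simp add: ac_simps)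
  qed
  then have "(\<Sum>i\<in>support E v. S_scale (f i v) (av i * (\<Prod>j\<in>insert e (support E v) - {i}. lin (f j)))) = lin (f e) * contr E v"
    by (simp add: contr_def sum_distrib_left mult_S_scale_right)
  moreover have "insert e (support E v) - {e} = support E v" using e by auto
  ultimately show ?thesis
    using assms fin e by (simp add: contr_def support_insert)
qed

text \<open>A form vanishing on the smaller flat is a form vanishing on \<open>flat F\<close> plus a
  multiple of \<open>f e\<close>. Directions v in the smaller flat satisfy f e v = 0, so their
  contractions are unchanged by adding e.\<close>

lemma minor_ideal_contraction:
  assumes E: "finite E" "e \<notin> E" "e \<in> {1..n}" "F \<subseteq> {1..n}" and v: "v \<in> flat F" "f e v \<noteq> 0"
  shows "minor_ideal (insert e F) E p q \<subseteq> S_space.span (minor_ideal F (insert e E) p q \<union> av_part e p q \<union> form_part e p q)"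
    (is "_ \<subseteq> S_space.span ?A")
proof (rule minor_ideal_subset)
  have A: "?A = minor_ideal F (insert e E) p q \<union> (av_part e p q \<union> form_part e p q)" by blast
  note J = minor_idealI'[where F = F and E = "insert e E" and p = p and q = q and A = "av_part e p q \<union> form_part e p q", folded A]
  fix s g p0 q0 p1 q1
  assume g: "minor_gen (insert e F) E p0 q0 g" and s: "s \<in> sdeg p1 q1" and pq: "p = p1 + p0" "q = q1 + q0"
  from g show "s * g \<in> S_space.span ?A"
  proof cases
    case (lform \<phi>)
    let ?c = "\<phi> v / f e v"
    have "minor_gen F (insert e E) 1 0 (lin (\<phi> - fun_scale ?c (f e)))"
    proof (rule minor_gen.lform)
      show "\<phi> - fun_scale ?c (f e) \<in> linear_forms scl"
        by (intro linear_forms_diff_scale lform form E)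
      show "(\<phi> - fun_scale ?c (f e)) x = 0" if "x \<in> flat F" for x
        using vanishing_insert_decompose[OF E(4,3) v lform(4,5) that] by (simp add: fun_scale_apply)
    qed
    then have "s * lin (\<phi> - fun_scale ?c (f e)) \<in> S_space.span ?A" by (rule J[OF _ s]) (use pq lform in simp_all)
    moreover have "S_scale ?c (lin (f e) * s) \<in> S_space.span ?A"
      using s pq lform by (intro S_space.span_scale form_partI) auto
    ultimately have "s * lin (\<phi> - fun_scale ?c (f e)) + S_scale ?c (lin (f e) * s) \<in> S_space.span ?A"
      by (rule S_space.span_add)
    moreover have "lin \<phi> = lin (\<phi> - fun_scale ?c (f e)) + S_scale ?c (lin (f e))"
      unfolding lin_fun_scale[symmetric] lin_add[symmetric] diff_add_cancel ..
    then have "s * lin \<phi> = s * lin (\<phi> - fun_scale ?c (f e)) + S_scale ?c (lin (f e) * s)"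
      by (simp only: distrib_left mult_S_scale_right mult.commute[of s "lin (f e)"])
    ultimately show ?thesis by (simp only: lform)
  next
    case (var i)
    show ?thesis
    proof (cases "i = e")
      case True
      then show ?thesis using av_partI[of s p q1 q e ?A] s pq var by (auto simp: mult.commute)
    next
      case False
      then have "minor_gen F (insert e E) p0 q0 g" using var minor_gen.var[of i "insert e E" F] by simp
      then show ?thesis using s pq by (rule J)
    qed
  next
    case sum
    have "s * (\<Sum>i\<in>insert e E. av i) \<in> S_space.span ?A"
      by (rule J[OF minor_gen.sum s]) (use pq sum in simp_all)
    moreover have "av e * s \<in> S_space.span ?A"
      using av_partI[of s p q1 q e ?A] s pq sum by auto
    ultimately have "s * (\<Sum>i\<in>insert e E. av i) - av e * s \<in> S_space.span ?A"
      by (rule S_space.span_diff)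
    then show ?thesis using E by (simp add: sum distrib_left mult.commute)
  next
    case (contr v')
    then have v': "v' \<in> flat F" "f e v' = 0" by (auto simp: flat_insert)
    from minor_gen.contr[OF v'(1), of "insert e E"]
    have "minor_gen F (insert e E) p0 q0 g" using contr v'(2) by (simp add: contr_insert_zero support_insert)
    then show ?thesis using s pq by (rule J)
  qed
qed simp

text \<open>The factor \<open>f e\<close> is forced by the generators with
  \<open>f e v \<noteq> 0\<close>, through \<open>contr_insert\<close>. All other generators lie in
  the larger ideal modulo \<open>a e\<close> already.\<close>

lemma minor_ideal_deletion:
  assumes E: "finite E" "insert e E \<subseteq> {1..n}" "e \<notin> E" and x: "x \<in> minor_ideal F E p q"
  shows "lin (f e) * x \<in> S_space.span (minor_ideal F (insert e E) (Suc p) q \<union> av_part e (Suc p) q)"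
    (is "_ \<in> S_space.span ?A")
proof (rule mult_span_subset[OF x[unfolded minor_ideal_def]])
  have e: "f e \<in> linear_forms scl" using E(2) form by auto
  fix x assume "x \<in> {s * g |s g p0 q0 p1 q1. minor_gen F E p0 q0 g \<and> s \<in> sdeg p1 q1 \<and> p = p1 + p0 \<and> q = q1 + q0}"
  then obtain s g p0 q0 p1 q1 where x: "x = s * g" and g: "minor_gen F E p0 q0 g" and s: "s \<in> sdeg p1 q1" and pq: "p = p1 + p0" "q = q1 + q0"
    by blast
  have fs: "lin (f e) * s \<in> sdeg (Suc p1) q1" by (rule lin_mult_mem_sdeg[OF e s])
  have J: "lin (f e) * s * g \<in> S_space.span ?A" if "minor_gen F (insert e E) p0 q0 g"
    using minor_idealI'[OF that fs] pq by simp
  from g have "lin (f e) * s * g \<in> S_space.span ?A"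
  proof cases
    case (lform \<phi>)
    then have "minor_gen F (insert e E) p0 q0 g" using minor_gen.lform[of \<phi> F "insert e E"] by simp
    then show ?thesis by (rule J)
  next
    case (var i)
    show ?thesis
    proof (cases "i = e")
      case True
      then show ?thesis using av_partI[of "lin (f e) * s" "Suc p" q1 q e ?A] fs pq var by (auto simp: ac_simps)
    next
      case False
      then have "minor_gen F (insert e E) p0 q0 g" using var minor_gen.var[of i "insert e E" F] by simp
      then show ?thesis by (rule J)
    qed
  next
    case sum
    have "lin (f e) * s * (\<Sum>i\<in>insert e E. av i) \<in> S_space.span ?A"
      using minor_idealI'[OF minor_gen.sum fs] pq sum by simp
    moreover have "av e * (lin (f e) * s) \<in> S_space.span ?A"
      using av_partI[of "lin (f e) * s" "Suc p" q1 q e ?A] fs pq sum by auto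
    ultimately have "lin (f e) * s * (\<Sum>i\<in>insert e E. av i) - av e * (lin (f e) * s) \<in> S_space.span ?A"
      by (rule S_space.span_diff)
    then show ?thesis using E by (simp add: sum distrib_left ac_simps)
  next
    case (contr v)
    show ?thesis
    proof (cases "f e v = 0 \<or> support E v = {}")
      case True
      then show ?thesis
      proof
        assume "f e v = 0"
        with minor_gen.contr[OF contr(4), of "insert e E"] have "minor_gen F (insert e E) p0 q0 g"
          using contr by (simp add: contr_insert_zero support_insert)
        then show ?thesis by (rule J)
      next
        assume "support E v = {}"
        then show ?thesis using S_space.span_zero by (simp add: contr contr_def)
      qed
    next
      case False
      let ?P = "\<Prod>j\<in>support E v. lin (f j)"
      have fin: "finite (support E v)" "e \<notin> support E v" "support E v \<subseteq> {1..n}" using E by (auto simp: support_def)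
      \<comment> \<open>The support is nonempty here, so p0 is not truncated, and multiplication by
        \<open>f e\<close> gives the degree of the contraction with enlarged support.\<close>
      then have card: "card (support (insert e E) v) - 1 = card (support E v)" "Suc p0 = card (support E v)"
        using False contr by (auto simp: support_insert card_gt_0_iff)
      have P: "s * ?P \<in> sdeg (p1 + card (support E v)) (q1 + 0)"
        using fin by (intro sdeg_mult s prod_lin_mem_sdeg)
      have "s * contr (insert e E) v \<in> S_space.span ?A"
        by (rule minor_idealI'[OF minor_gen.contr[OF contr(4), of "insert e E"] s]) (use card pq contr(2) in linarith)+
      moreover have "S_scale (f e v) (av e * (s * ?P)) \<in> S_space.span ?A"
        using av_partI[of "s * ?P" "Suc p" q1 q e ?A] P card pq contr by (intro S_space.span_scale) auto
      ultimately have "s * contr (insert e E) v - S_scale (f e v) (av e * (s * ?P)) \<in> S_space.span ?A"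
        by (rule S_space.span_diff)
      moreover have "s * contr (insert e E) v = S_scale (f e v) (av e * (s * ?P)) + lin (f e) * s * contr E v"
        using contr_insert[OF E(1,3), of v] False
        by (simp add: distrib_left mult_S_scale_right ac_simps)
      ultimately show ?thesis by (simp add: contr)
    qed
  qed
  then show "lin (f e) * x \<in> S_space.span ?A" by (simp add: x mult.assoc)
qed simp

text \<open>For a loop every direction in \<open>flat F\<close> has f e v = 0, so contractions are
  unchanged and no factor \<open>f e\<close> is needed.\<close>

lemma minor_ideal_loop:
  assumes E: "finite E" "e \<notin> E" and loop: "\<And>x. x \<in> flat F \<Longrightarrow> f e x = 0"
  shows "minor_ideal F E p q \<subseteq> S_space.span (minor_ideal F (insert e E) p q \<union> av_part e p q)"
    (is "_ \<subseteq> S_space.span ?A")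
proof (rule minor_ideal_subset)
  fix s g p0 q0 p1 q1
  assume g: "minor_gen F E p0 q0 g" and s: "s \<in> sdeg p1 q1" and pq: "p = p1 + p0" "q = q1 + q0"
  note J = minor_idealI'[where F = F and E = "insert e E" and p = p and q = q and A = "av_part e p q"]
  from g show "s * g \<in> S_space.span ?A"
  proof cases
    case (lform \<phi>)
    then have "minor_gen F (insert e E) p0 q0 g" using minor_gen.lform[of \<phi> F "insert e E"] by simp
    then show ?thesis using s pq by (rule J)
  next
    case (var i)
    show ?thesis
    proof (cases "i = e")
      case True
      then show ?thesis using av_partI[of s p q1 q e ?A] s pq var by (auto simp: mult.commute)
    next
      case False
      then have "minor_gen F (insert e E) p0 q0 g" using var minor_gen.var[of i "insert e E" F] by simp
      then show ?thesis using s pq by (rule J)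
    qed
  next
    case sum
    have "s * (\<Sum>i\<in>insert e E. av i) \<in> S_space.span ?A"
      by (rule J[OF minor_gen.sum s]) (use pq sum in simp_all)
    moreover have "av e * s \<in> S_space.span ?A"
      using av_partI[of s p q1 q e ?A] s pq sum by auto
    ultimately have "s * (\<Sum>i\<in>insert e E. av i) - av e * s \<in> S_space.span ?A"
      by (rule S_space.span_diff)
    then show ?thesis using E by (simp add: sum distrib_left mult.commute)
  next
    case (contr v)
    from minor_gen.contr[OF contr(4), of "insert e E"]
    have "minor_gen F (insert e E) p0 q0 g" using contr loop by (simp add: contr_insert_zero support_insert)
    then show ?thesis using s pq by (rule J)
  qed
qed simp

text \<open>
  \<open>covers X Y k\<close> replaces statements about dimensions of quotients in the recursion, so that no
  exact sequences are needed.
\<close>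
definition covers :: "'v bipoly set \<Rightarrow> 'v bipoly set \<Rightarrow> nat \<Rightarrow> bool" where
  "covers X Y k \<longleftrightarrow> (\<exists>A. finite A \<and> card A \<le> k \<and> X \<subseteq> S_space.span (A \<union> Y))"

lemma covers_subset: "X \<subseteq> S_space.span Y \<Longrightarrow> covers X Y 0"
  unfolding covers_def by (intro exI[of _ "{}"]) simp

lemma covers_trans:
  assumes "covers X Y k" "covers Y Z k'"
  shows "covers X Z (k + k')"
proof -
  obtain A where A: "finite A" "card A \<le> k" "X \<subseteq> S_space.span (A \<union> Y)"
    using assms(1) unfolding covers_def by blast
  obtain A' where A': "finite A'" "card A' \<le> k'" "Y \<subseteq> S_space.span (A' \<union> Z)"
    using assms(2) unfolding covers_def by blast
  have "S_space.span (A' \<union> Z) \<subseteq> S_space.span (A \<union> A' \<union> Z)" by (intro S_space.span_mono) auto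
  then have "A \<union> Y \<subseteq> S_space.span (A \<union> A' \<union> Z)" using A'(3) S_space.span_superset by blast
  then have "X \<subseteq> S_space.span (A \<union> A' \<union> Z)" using A(3) S_space.span_minimal[OF _ S_space.subspace_span] by blast
  moreover have "card (A \<union> A') \<le> k + k'" using card_Un_le[of A A'] A(2) A'(2) by linarith
  ultimately show ?thesis unfolding covers_def using A(1) A'(1) by blast
qed

lemma covers_Un: "covers X Y k \<Longrightarrow> covers (Y \<union> X) Y k"
  unfolding covers_def by (blast intro: S_space.span_base)

lemma covers_mult:
  assumes "covers X Y k" "\<And>y. y \<in> Y \<Longrightarrow> t * y \<in> S_space.span Z"
  shows "covers ((*) t ` X) Z k"
proof -
  obtain A where A: "finite A" "card A \<le> k" "X \<subseteq> S_space.span (A \<union> Y)"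
    using assms(1) unfolding covers_def by blast
  have "t * y \<in> S_space.span ((*) t ` A \<union> Z)" if "y \<in> A \<union> Y" for y
    using that assms(2) S_space.span_mono[of Z "(*) t ` A \<union> Z"] by (auto intro: S_space.span_base)
  then have "t * x \<in> S_space.span ((*) t ` A \<union> Z)" if "x \<in> X" for x
    using A(3) that by (intro mult_span_subset[of x "A \<union> Y"]) auto
  moreover have "card ((*) t ` A) \<le> k" using card_image_le[OF A(1), of "(*) t"] A(2) by simp
  ultimately show ?thesis unfolding covers_def using A(1) by (intro exI[of _ "(*) t ` A"]) auto
qed

text \<open>Multiplication by \<open>a e\<close> maps S/J(M) in u-degree q - 1 onto (a e) modulo
  J(M). For q = 0 there is nothing to cover.\<close>

lemma av_part_covers:
  assumes "e \<in> {1..n}" "q = 0 \<and> k = 0 \<or> (\<exists>q'. q = Suc q' \<and> covers (sdeg p q') (minor_ideal F E p q') k)"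
  shows "covers (av_part e p q) (minor_ideal F E p q) k"
  using assms(2)
proof (elim disjE conjE exE)
  fix q' assume q: "q = Suc q'" and "covers (sdeg p q') (minor_ideal F E p q') k"
  then have "covers ((*) (av e) ` sdeg p q') (minor_ideal F E p q) k"
    using minor_ideal_mult[OF _ av_mem_sdeg[OF assms(1)]] by (intro covers_mult S_space.span_base) auto
  moreover have "av_part e p q = (*) (av e) ` sdeg p q'" by (auto simp: av_part_def q)
  ultimately show ?thesis by simp
qed (simp add: av_part_def covers_subset)

lemma form_part_covers:
  assumes "p = 0 \<and> k = 0 \<or> (\<exists>p'. p = Suc p' \<and> covers (sdeg p' q) Y k \<and> (\<forall>y\<in>Y. lin (f e) * y \<in> S_space.span Z))"
  shows "covers (form_part e p q) Z k"
  using assms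
proof (elim disjE conjE exE)
  fix p' assume p: "p = Suc p'" and "covers (sdeg p' q) Y k" "\<forall>y\<in>Y. lin (f e) * y \<in> S_space.span Z"
  then have "covers ((*) (lin (f e)) ` sdeg p' q) Z k" by (intro covers_mult) auto
  moreover have "form_part e p q = (*) (lin (f e)) ` sdeg p' q" by (auto simp: form_part_def p)
  ultimately show ?thesis by simp
qed (simp add: form_part_def covers_subset)

text \<open>In effect the bound dim (S/J(M)) \<le> k in bidegree (p, q).\<close>

definition generated_by :: "nat set \<Rightarrow> nat set \<Rightarrow> nat \<Rightarrow> nat \<Rightarrow> nat \<Rightarrow> bool" where
  "generated_by F E p q k \<longleftrightarrow> covers (sdeg p q) (minor_ideal F E p q) k"

text \<open>Filtration J(M) \<subseteq> J(M) + (a e) \<subseteq> J(M) + (a e) + (f e) \<subseteq> S.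
  The top quotient is bounded by the contraction, the middle one by the deletion in t-degree p - 1,
  and the bottom one by the same minor in u-degree q - 1. Unrolling the last gives the sum over
  q'.\<close>

lemma generated_by_noncoloop:
  assumes E: "insert e E \<subseteq> {1..n}" "F \<subseteq> {1..n}" "e \<notin> E" and v: "v \<in> flat F" "f e v \<noteq> 0"
    and del: "\<And>p q. generated_by F E p q (u1 p q)"
    and con: "\<And>p q. generated_by (insert e F) E p q (u2 p q)"
  shows "generated_by F (insert e E) p q (\<Sum>q'\<le>q. (if p = 0 then 0 else u1 (p - 1) q') + u2 p q')"
proof -
  have finE: "finite E" using finite_subset[OF E(1)] by simp
  have e: "e \<in> {1..n}" using E(1) by auto
  let ?J = "minor_ideal F (insert e E)"
  have step: "covers (sdeg p q) (?J p q) (u2 p q + ((if p = 0 then 0 else u1 (p - 1) q) + k))"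
    if av: "covers (av_part e p q) (?J p q) k" for q k
  proof -
    have "covers (form_part e p q) (?J p q \<union> av_part e p q) (if p = 0 then 0 else u1 (p - 1) q)"
      using del[of "p - 1" q] minor_ideal_deletion[OF finE E(1,3)]
      by (intro form_part_covers[where Y = "minor_ideal F E (p - 1) q"]) (cases p, auto simp: generated_by_def)
    from covers_trans[OF covers_Un[OF this] covers_Un[OF av]]
    have "covers (?J p q \<union> av_part e p q \<union> form_part e p q) (?J p q) ((if p = 0 then 0 else u1 (p - 1) q) + k)" .
    from covers_trans[OF covers_subset[OF minor_ideal_contraction[OF finE E(3) e E(2) v]] this]
    show ?thesis
      using covers_trans[OF con[of p q, unfolded generated_by_def]] by simp
  qed
  show ?thesis
    unfolding generated_by_def
  proof (induction q)
    case 0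
    show ?case using step[OF av_part_covers[OF e, of 0 0]] unfolding atMost_0 by (simp add: add.commute)
  next
    case (Suc q)
    then have "covers (av_part e p (Suc q)) (?J p (Suc q)) (\<Sum>q'\<le>q. (if p = 0 then 0 else u1 (p - 1) q') + u2 p q')"
      by (intro av_part_covers[OF e]) auto
    from step[OF this] show ?case by (cases "p = 0") (simp_all add: ac_simps)
  qed
qed

text \<open>The direction v has support {e} in this minor, so its contraction is a multiple of
  \<open>a e\<close>, and \<open>a e\<close> lies in the ideal. What remains is multiplication by
  \<open>f e\<close> inside the same minor, hence a sum over p'.\<close>

lemma generated_by_coloop:
  assumes E: "insert e E \<subseteq> {1..n}" "F \<subseteq> {1..n}" "e \<notin> E" and v: "v \<in> flat (F \<union> E)" "f e v \<noteq> 0"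
    and con: "\<And>p q. generated_by (insert e F) E p q (u2 p q)"
  shows "generated_by F (insert e E) p q (\<Sum>p'\<le>p. u2 p' q)"
proof -
  have finE: "finite E" using finite_subset[OF E(1)] by simp
  have e: "e \<in> {1..n}" using E(1) by auto
  have vF: "v \<in> flat F" using v(1) flat_mono[of F "F \<union> E"] by auto
  have supp: "support (insert e E) v = {e}" using v E(3) by (auto simp: support_def flat_def)
  let ?J = "minor_ideal F (insert e E)"
  have av: "av_part e p q \<subseteq> ?J p q" for p
  proof
    fix x assume "x \<in> av_part e p q"
    then obtain s q' where x: "x = av e * s" "q = Suc q'" "s \<in> sdeg p q'" by (auto simp: av_part_def)
    have "s * contr (insert e E) v \<in> ?J p q"
      using minor_idealI[OF minor_gen.contr[OF vF, of "insert e E"] x(3)] x(2) by (simp add: supp)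
    then have "S_scale (inverse (f e v)) (s * contr (insert e E) v) \<in> ?J p q"
      by (rule S_space.subspace_scale[OF minor_ideal_subspace])
    moreover have "S_scale (inverse (f e v)) (s * contr (insert e E) v) = x"
      using v(2) by (simp add: contr_def supp x(1) mult_S_scale_right mult.commute)
    ultimately show "x \<in> ?J p q" by simp
  qed
  have step: "covers (sdeg p q) (?J p q) (u2 p q + k)" if form: "covers (form_part e p q) (?J p q) k" for p k
  proof -
    have "minor_ideal (insert e F) E p q \<subseteq> S_space.span (?J p q \<union> form_part e p q)"
      using minor_ideal_contraction[OF finE E(3) e E(2) vF v(2), of p q] unfolding Un_absorb2[OF av] .
    from covers_trans[OF covers_subset[OF this] covers_Un[OF form]]
    show ?thesis using covers_trans[OF con[of p q, unfolded generated_by_def]] by simp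
  qed
  show ?thesis
    unfolding generated_by_def
  proof (induction p)
    case 0
    show ?case using step[OF form_part_covers[of 0 0]] unfolding atMost_0 by simp
  next
    case (Suc p)
    have "lin (f e) * y \<in> ?J (Suc p) q" if "y \<in> ?J p q" for y
      using minor_ideal_mult[OF that lin_mem_sdeg[OF form[OF e]]] by simp
    then have "covers (form_part e (Suc p) q) (?J (Suc p) q) (\<Sum>p'\<le>p. u2 p' q)"
      using Suc by (intro form_part_covers[where Y = "?J p q"]) (auto intro: S_space.span_base)
    from step[OF this] show ?case by (simp add: add.commute)
  qed
qed

lemma generated_by_loop:
  assumes E: "insert e E \<subseteq> {1..n}" "e \<notin> E" and loop: "\<And>x. x \<in> flat F \<Longrightarrow> f e x = 0"
    and del: "\<And>p q. generated_by F E p q (u1 p q)"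
  shows "generated_by F (insert e E) p q (\<Sum>q'\<le>q. u1 p q')"
proof -
  have finE: "finite E" using finite_subset[OF E(1)] by simp
  have e: "e \<in> {1..n}" using E(1) by auto
  have step: "covers (sdeg p q) (minor_ideal F (insert e E) p q) (u1 p q + k)"
    if "covers (av_part e p q) (minor_ideal F (insert e E) p q) k" for q k
    using covers_trans[OF covers_subset[OF minor_ideal_loop[OF finE E(2) loop]] covers_Un[OF that]]
      covers_trans[OF del[of p q, unfolded generated_by_def]] by simp
  show ?thesis
    unfolding generated_by_def
  proof (induction q)
    case 0
    show ?case using step[OF av_part_covers[OF e, of 0 0]] unfolding atMost_0 by simp
  next
    case (Suc q)
    then have "covers (av_part e p (Suc q)) (minor_ideal F (insert e E) p (Suc q)) (\<Sum>q'\<le>q. u1 p q')"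
      by (intro av_part_covers[OF e]) auto
    from step[OF this] show ?case by (simp add: add.commute)
  qed
qed

text \<open>On the trivial flat all forms are killed. If E has at most one element, all variables
  are killed too, because the Euler generator is then the remaining variable itself.\<close>

lemma generated_by_trivial:
  assumes F: "flat F = {0}" and E: "E = {} \<or> E = {e}"
  shows "generated_by F E p q (of_bool (p = 0 \<and> q = 0))"
proof (cases "p = 0 \<and> q = 0")
  case True
  have "bimonos 0 0 \<subseteq> {0}"
  proof
    fix \<alpha> assume a: "\<alpha> \<in> bimonos 0 0"
    have "\<alpha> k = 0" for k
      using a by (cases "k < n"; cases "k < 2 * n") (auto simp: bimonos_def bidegree_part_def exponents_def index_split)
    then have "\<alpha> = 0" by (intro ext) simp
    then show "\<alpha> \<in> {0}" by (simp only: singleton_iff)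
  qed
  then have "sdeg 0 0 \<subseteq> S_space.span ({1} \<union> minor_ideal F E 0 0)"
    unfolding sdeg_eq_span using mon_zero by (intro S_space.span_mono) auto
  then show ?thesis unfolding generated_by_def covers_def using True by (intro exI[of _ "{1}"]) auto
next
  case False
  have "(p = 0 \<and> q = 0) \<or> s \<in> minor_ideal F E p q" if "s \<in> sdeg p q" for s p q
  proof -
    have "s \<in> sdeg p q \<and> ((p = 0 \<and> q = 0) \<or> s \<in> minor_ideal F E p q)"
      using that
    proof (induction rule: sdeg_induct)
      case (zero p q)
      then show ?case by (simp add: S_space.subspace_0[OF minor_ideal_subspace] S_space.subspace_0[OF sdeg_subspace])
    next
      case (add p q c s t)
      then show ?case
        by (auto intro: S_space.subspace_add[OF minor_ideal_subspace] S_space.subspace_scale[OF minor_ideal_subspace]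
            S_space.subspace_add[OF sdeg_subspace] S_space.subspace_scale[OF sdeg_subspace])
    next
      case one
      then show ?case using one_mem_sdeg by simp
    next
      case (lin p q s \<phi>)
      have "minor_gen F E 1 0 (lin \<phi>)"
        using lin(2) by (intro minor_gen.lform) (auto simp: F linear_form_zero)
      then have "s * lin \<phi> \<in> minor_ideal F E (p + 1) (q + 0)" using lin by (intro minor_idealI) auto
      then show ?case using lin lin_mult_mem_sdeg[of \<phi> s p q] by (simp add: mult.commute)
    next
      case (av p q s i)
      have "minor_gen F E 0 1 (av i)"
      proof (cases "i \<in> E")
        case True
        then have "(\<Sum>j\<in>E. av j) = (av i :: 'v bipoly)" using E by auto
        then show ?thesis using minor_gen.sum[of F E] by simp
      next
        case False
        then show ?thesis using av(2) by (intro minor_gen.var)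
      qed
      then have "s * av i \<in> minor_ideal F E (p + 0) (q + 1)" using av by (intro minor_idealI) auto
      then show ?case using av av_mult_mem_sdeg[of i s p q] by (simp add: mult.commute)
    qed
    then show ?thesis by blast
  qed
  then have "sdeg p q \<subseteq> S_space.span ({} \<union> minor_ideal F E p q)"
    using False by (auto intro: S_space.span_base)
  then show ?thesis unfolding generated_by_def covers_def using False by (intro exI[of _ "{}"]) auto
qed


section \<open>Main terms and admissible errors of minors\<close>

lemma minor_poly_all_loops:
  assumes "E \<subseteq> {1..n}" "F \<subseteq> {1..n}" "flat F = {0}" "E \<noteq> {}"
  shows "minor_poly F E = 0"
proof -
  obtain e where e: "e \<in> E" using assms(4) by blast
  have "finite E" using finite_subset[OF assms(1)] by simp
  moreover have "f e x = 0" if "x \<in> flat F" for x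
    using that e assms by (auto intro!: linear_form_zero form)
  ultimately have "minor_poly F (insert e (E - {e})) = 0"
    using assms e by (intro minor_poly_loop) auto
  then show ?thesis using e by (simp add: insert_absorb)
qed

lemma flat_nonzero_imp_nonempty:
  assumes "e \<in> {1..n}" "v \<in> flat F" "f e v \<noteq> 0" "flat (F \<union> E) = {0}"
  shows "E \<noteq> {}"
proof
  assume "E = {}"
  then have "v = 0" using assms by simp
  then show False using assms(1,3) form linear_form_zero by auto
qed

lemma minor_poly_noncoloop:
  assumes "E \<subseteq> {1..n}" "F \<subseteq> {1..n}" "e \<in> {1..n}" "e \<notin> E" "v \<in> flat F" "f e v \<noteq> 0" "flat (F \<union> E) = {0}"
  shows "minor_poly F (insert e E) = minor_poly F E + minor_poly (insert e F) E"
proof (rule minor_poly_deletion_contraction)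
  show "finite E" using finite_subset[OF assms(1)] by simp
  show "\<forall>x\<in>flat (F \<union> E). f e x = 0" using assms by (auto intro!: linear_form_zero form)
qed (use assms in auto)

text \<open>Both properties pass through the recursion. Together they make the main term of a
  nonempty minor increase with p, which absorbs a degree shift in the upper bound.\<close>

lemma coeff_minor_poly:
  assumes "E \<subseteq> {1..n}" "F \<subseteq> {1..n}" "F \<inter> E = {}" "flat (F \<union> E) = {0}"
  shows "(\<forall>i. 0 \<le> coeff (minor_poly F E) i) \<and> (E \<noteq> {} \<longrightarrow> coeff (minor_poly F E) 0 = 0)"
  using assms
proof (induction rule: minor_induct)
  case (loops F E)
  then show ?case by (cases "E = {}") (auto simp: minor_poly_empty minor_poly_all_loops)
next
  case (coloop F E e v)
  have "finite E" using finite_subset[OF coloop(1)] by simp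
  then have "minor_poly F (insert e E) = pCons 0 (minor_poly (insert e F) E)"
    using coloop by (intro minor_poly_coloop) auto
  then show ?case using coloop by (auto simp: coeff_pCons split: nat.split)
next
  case (noncoloop F E e v)
  have "E \<noteq> {}" by (rule flat_nonzero_imp_nonempty) (use noncoloop in auto)
  moreover have "minor_poly F (insert e E) = minor_poly F E + minor_poly (insert e F) E"
    by (rule minor_poly_noncoloop) (use noncoloop in auto)
  ultimately show ?case using noncoloop by simp
qed

text \<open>The coefficients of \<Sum>i. T_i / ((1-t)^i (1-u)^(|E|-i)), the expected leading part
  for the minor.\<close>

definition minor_main :: "nat set \<Rightarrow> nat set \<Rightarrow> nat \<Rightarrow> nat \<Rightarrow> real" where
  "minor_main F E p q = (\<Sum>i\<le>card E. real_of_int (coeff (minor_poly F E) i) * real (geo_coeff i p * geo_coeff (card E - i) q))"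

text \<open>Total pole order below |E|. For the empty minor |E| - 1 would truncate to 0 and admit a
  constant, so there no positive error is allowed.\<close>

definition minor_err :: "nat set \<Rightarrow> (nat \<Rightarrow> nat \<Rightarrow> real) \<Rightarrow> bool" where
  "minor_err E g \<longleftrightarrow> (if E = {} then \<forall>p q. g p q \<le> 0 else err_bounded (card E - 1) g)"

lemma minor_err_sum_fst:
  assumes "e \<notin> E" "finite E" "minor_err E g"
  shows "minor_err (insert e E) (\<lambda>p q. \<Sum>p'\<le>p. g p' q)"
proof (cases "E = {}")
  case True
  then have "(\<Sum>p'\<le>p. g p' q) \<le> 0" for p q using assms(3) by (auto simp: minor_err_def intro!: sum_nonpos)
  then have "err_bounded 0 (\<lambda>p q. \<Sum>p'\<le>p. g p' q)" by (intro err_bounded_le[OF err_bounded_zero])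
  then show ?thesis using True by (simp add: minor_err_def)
next
  case False
  then have "err_bounded (Suc (card E - 1)) (\<lambda>p q. \<Sum>p'\<le>p. g p' q)"
    using assms(3) by (intro err_bounded_sum_fst) (simp add: minor_err_def)
  moreover have "Suc (card E - 1) = card (insert e E) - 1" using False assms(1,2) by (simp add: card_gt_0_iff)
  ultimately show ?thesis by (simp add: minor_err_def)
qed

text \<open>T(x, 0) is multiplied by x, so i and |E| grow together and |E| - i is unchanged: only
  the pole in t grows.\<close>

lemma minor_main_coloop:
  assumes "E \<subseteq> {1..n}" "F \<subseteq> {1..n}" "e \<in> {1..n}" "e \<notin> E" "v \<in> flat (F \<union> E)" "f e v \<noteq> 0"
  shows "minor_main F (insert e E) p q = (\<Sum>p'\<le>p. minor_main (insert e F) E p' q)"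
proof -
  have fin: "finite E" using finite_subset[OF assms(1)] by simp
  have P: "minor_poly F (insert e E) = pCons 0 (minor_poly (insert e F) E)"
    using fin assms by (intro minor_poly_coloop) auto
  have "minor_main F (insert e E) p q = (\<Sum>i\<le>Suc (card E). real_of_int (coeff (pCons 0 (minor_poly (insert e F) E)) i) * real (geo_coeff i p * geo_coeff (Suc (card E) - i) q))"
    using fin assms(4) by (simp add: minor_main_def P del: geo_coeff.simps sum.atMost_Suc)
  also have "\<dots> = (\<Sum>i\<le>card E. real_of_int (coeff (minor_poly (insert e F) E) i) * real (geo_coeff (Suc i) p * geo_coeff (card E - i) q))"
    by (simp add: sum.atMost_Suc_shift del: geo_coeff.simps sum.atMost_Suc)
  also have "\<dots> = (\<Sum>p'\<le>p. minor_main (insert e F) E p' q)"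
    unfolding minor_main_def by (subst sum.swap) (simp add: sum_distrib_left sum_distrib_right)
  finally show ?thesis .
qed

text \<open>Both minors have |E| elements, so for fixed i the pole in u grows by one. The new top
  index |E| + 1 drops out, since it exceeds the ranks of both minors.\<close>

lemma minor_main_noncoloop:
  assumes "E \<subseteq> {1..n}" "F \<subseteq> {1..n}" "e \<in> {1..n}" "e \<notin> E" "v \<in> flat F" "f e v \<noteq> 0" "flat (F \<union> E) = {0}"
  shows "minor_main F (insert e E) p q = (\<Sum>q'\<le>q. minor_main F E p q' + minor_main (insert e F) E p q')"
proof -
  have fin: "finite E" using finite_subset[OF assms(1)] by simp
  have P: "minor_poly F (insert e E) = minor_poly F E + minor_poly (insert e F) E"
    by (rule minor_poly_noncoloop) (use assms in auto)
  have zero: "coeff (minor_poly G E) (Suc (card E)) = 0" if "G \<subseteq> {1..n}" for G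
    using rk_union_le[OF fin that assms(1)] by (intro coeff_minor_poly_eq_0 that assms) linarith
  have "minor_main F (insert e E) p q = (\<Sum>i\<le>Suc (card E). real_of_int (coeff (minor_poly F E) i + coeff (minor_poly (insert e F) E) i) * real (geo_coeff i p * geo_coeff (Suc (card E) - i) q))"
    using fin assms(4) by (simp add: minor_main_def P del: geo_coeff.simps sum.atMost_Suc)
  also have "\<dots> = (\<Sum>i\<le>card E. real_of_int (coeff (minor_poly F E) i + coeff (minor_poly (insert e F) E) i) * real (geo_coeff i p * geo_coeff (Suc (card E - i)) q))"
    using zero[of F] zero[of "insert e F"] assms(2,3) by (simp add: Suc_diff_le del: geo_coeff.simps)
  also have "\<dots> = (\<Sum>q'\<le>q. minor_main F E p q' + minor_main (insert e F) E p q')"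
    unfolding minor_main_def sum.distrib[symmetric]
    by (subst sum.swap) (simp add: sum_distrib_left algebra_simps sum.distrib)
  finally show ?thesis .
qed

lemma minor_main_empty: "minor_main F {} p q = real (geo_coeff 0 p * geo_coeff 0 q)"
  by (simp add: minor_main_def minor_poly_empty)

lemma minor_main_all_loops:
  assumes "E \<subseteq> {1..n}" "F \<subseteq> {1..n}" "flat F = {0}" "E \<noteq> {}"
  shows "minor_main F E p q = 0"
  using minor_poly_all_loops[OF assms] by (simp add: minor_main_def)

lemma minor_main_nonneg:
  assumes "E \<subseteq> {1..n}" "F \<subseteq> {1..n}" "F \<inter> E = {}" "flat (F \<union> E) = {0}"
  shows "0 \<le> minor_main F E p q"
  unfolding minor_main_def using coeff_minor_poly[OF assms] by (intro sum_nonneg mult_nonneg_nonneg) auto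

text \<open>A constant coefficient would contribute \<open>geo_coeff 0\<close>, which is not
  monotone; it vanishes for nonempty minors.\<close>

lemma minor_main_mono:
  assumes "E \<subseteq> {1..n}" "F \<subseteq> {1..n}" "F \<inter> E = {}" "flat (F \<union> E) = {0}" "E \<noteq> {}" "p \<le> p'"
  shows "minor_main F E p q \<le> minor_main F E p' q"
  unfolding minor_main_def
proof (rule sum_mono)
  fix i
  show "real_of_int (coeff (minor_poly F E) i) * real (geo_coeff i p * geo_coeff (card E - i) q)
      \<le> real_of_int (coeff (minor_poly F E) i) * real (geo_coeff i p' * geo_coeff (card E - i) q)"
  proof (cases "i = 0")
    case True
    then show ?thesis using coeff_minor_poly[OF assms(1-4)] assms(5) by simp
  next
    case False
    then have "geo_coeff i p * geo_coeff (card E - i) q \<le> geo_coeff i p' * geo_coeff (card E - i) q"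
      using geo_coeff_mono[of i p p'] assms(6) by (intro mult_right_mono) auto
    then show ?thesis using coeff_minor_poly[OF assms(1-4)]
      by (intro mult_left_mono of_nat_mono) auto
  qed
qed

theorem minor_upper_bound:
  assumes "E \<subseteq> {1..n}" "F \<subseteq> {1..n}" "F \<inter> E = {}" "flat (F \<union> E) = {0}"
  shows "\<exists>u g. (\<forall>p q. generated_by F E p q (u p q)) \<and> minor_err E g \<and> (\<forall>p q. real (u p q) \<le> minor_main F E p q + g p q)"
  using assms
proof (induction rule: minor_induct)
  case (loops F E)
  have fin: "finite E" using finite_subset[OF loops(1)] by simp
  \<comment> \<open>The main term is 0 unless E is empty. A single loop costs nothing, as the Euler
    generator kills its variable; every further loop adds a pole in u, in step with the admissible
    order |E| - 1.\<close>
  consider "E = {}" | e where "E = {e}" | e e' where "e \<in> E" "e' \<in> E" "e \<noteq> e'" by blast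
  then show ?case
  proof cases
    case 1
    then show ?thesis
      using generated_by_trivial[OF loops(4)]
      by (intro exI[of _ "\<lambda>p q. of_bool (p = 0 \<and> q = 0)"] exI[of _ "\<lambda>_ _. 0"]) (auto simp: minor_err_def minor_main_empty)
  next
    case (2 e)
    have "err_bounded 0 (\<lambda>p q. real (of_bool (p = 0 \<and> q = 0)))"
      by (rule err_bounded_le[OF err_bounded_geo_le[of 0 0 0]]) auto
    then show ?thesis
      using 2 generated_by_trivial[OF loops(4), of E e] minor_main_all_loops[OF loops(1,2,4)]
      by (intro exI[of _ "\<lambda>p q. of_bool (p = 0 \<and> q = 0)"] exI[of _ "\<lambda>p q. real (of_bool (p = 0 \<and> q = 0))"]) (simp add: minor_err_def)
  next
    case (3 e e')
    let ?E = "E - {e}"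
    obtain u g where u: "\<And>p q. generated_by F ?E p q (u p q)" and g: "minor_err ?E g"
        and le: "\<And>p q. real (u p q) \<le> minor_main F ?E p q + g p q"
      using loops(5)[OF 3(1)] by blast
    have ne: "?E \<noteq> {}" using 3 by auto
    have "minor_main F ?E p q = 0" for p q
      by (rule minor_main_all_loops) (use loops ne in auto)
    then have le: "real (u p q) \<le> g p q" for p q using le[of p q] by simp
    have E: "insert e ?E = E" using 3 by auto
    have loop: "f e x = 0" if "x \<in> flat F" for x
      using that loops 3 by (auto intro!: linear_form_zero form)
    have "generated_by F (insert e ?E) p q (\<Sum>q'\<le>q. u p q')" for p q
      by (rule generated_by_loop[OF _ _ loop u]) (use 3 loops(1) in auto)
    then have gen: "generated_by F E p q (\<Sum>q'\<le>q. u p q')" for p q unfolding E .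
    have "err_bounded (Suc (card ?E - 1)) (\<lambda>p q. \<Sum>q'\<le>q. g p q')"
      using g ne by (intro err_bounded_sum_snd) (simp add: minor_err_def)
    moreover have "Suc (card ?E - 1) = card E - 1" using 3 ne fin
      by (metis E Diff_iff One_nat_def Suc_pred' card_gt_0_iff card_insert_disjoint diff_Suc_1 finite_Diff singletonI)
    ultimately have "minor_err E (\<lambda>p q. \<Sum>q'\<le>q. g p q')" using 3 by (auto simp: minor_err_def)
    moreover have "real (\<Sum>q'\<le>q. u p q') \<le> minor_main F E p q + (\<Sum>q'\<le>q. g p q')" for p q
    proof -
      have "minor_main F E p q = 0" by (rule minor_main_all_loops) (use loops 3 in auto)
      moreover have "(\<Sum>q'\<le>q. real (u p q')) \<le> (\<Sum>q'\<le>q. g p q')" by (intro sum_mono le)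
      ultimately show ?thesis by simp
    qed
    ultimately show ?thesis using gen
      by (intro exI[of _ "\<lambda>p q. \<Sum>q'\<le>q. u p q'"] exI[of _ "\<lambda>p q. \<Sum>q'\<le>q. g p q'"] conjI allI)
  qed
next
  case (coloop F E e v)
  have fin: "finite E" using finite_subset[OF coloop(1)] by simp
  obtain u g where u: "\<And>p q. generated_by (insert e F) E p q (u p q)" and g: "minor_err E g"
      and le: "\<And>p q. real (u p q) \<le> minor_main (insert e F) E p q + g p q"
    using coloop(9) by blast
  have "generated_by F (insert e E) p q (\<Sum>p'\<le>p. u p' q)" for p q
    by (rule generated_by_coloop[OF _ _ _ coloop(7,8) u]) (use coloop in auto)
  moreover have "minor_err (insert e E) (\<lambda>p q. \<Sum>p'\<le>p. g p' q)"
    using coloop(4) fin g by (rule minor_err_sum_fst)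
  moreover have "real (\<Sum>p'\<le>p. u p' q) \<le> minor_main F (insert e E) p q + (\<Sum>p'\<le>p. g p' q)" for p q
  proof -
    have "minor_main F (insert e E) p q = (\<Sum>p'\<le>p. minor_main (insert e F) E p' q)"
      by (rule minor_main_coloop) (use coloop in auto)
    then show ?thesis using sum_mono[of "{..p}", OF le] by (simp add: sum.distrib)
  qed
  ultimately show ?case
    by (intro exI[of _ "\<lambda>p q. \<Sum>p'\<le>p. u p' q"] exI[of _ "\<lambda>p q. \<Sum>p'\<le>p. g p' q"] conjI allI)
next
  case (noncoloop F E e v)
  have fin: "finite E" using finite_subset[OF noncoloop(1)] by simp
  have ne: "E \<noteq> {}" by (rule flat_nonzero_imp_nonempty) (use noncoloop in auto)
  obtain u1 g1 where u1: "\<And>p q. generated_by F E p q (u1 p q)" and g1: "minor_err E g1"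
      and le1: "\<And>p q. real (u1 p q) \<le> minor_main F E p q + g1 p q"
    using noncoloop(10) by blast
  obtain u2 g2 where u2: "\<And>p q. generated_by (insert e F) E p q (u2 p q)" and g2: "minor_err E g2"
      and le2: "\<And>p q. real (u2 p q) \<le> minor_main (insert e F) E p q + g2 p q"
    using noncoloop(11) by blast
  let ?u = "\<lambda>p q. \<Sum>q'\<le>q. (if p = 0 then 0 else u1 (p - 1) q') + u2 p q'"
  let ?g = "\<lambda>p q. \<Sum>q'\<le>q. shifted 1 0 g1 p q' + g2 p q'"
  have gen: "generated_by F (insert e E) p q (?u p q)" for p q
    by (rule generated_by_noncoloop[OF _ _ _ noncoloop(7,8) u1 u2]) (use noncoloop in auto)
  have "err_bounded (Suc (card E - 1)) ?g"
    using g1 g2 ne by (intro err_bounded_sum_snd err_bounded_add err_bounded_shift) (simp_all add: minor_err_def)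
  moreover have "Suc (card E - 1) = card (insert e E) - 1" using ne fin noncoloop(4) by (simp add: card_gt_0_iff)
  ultimately have err: "minor_err (insert e E) ?g" by (simp add: minor_err_def)
  have "real (?u p q) \<le> minor_main F (insert e E) p q + ?g p q" for p q
  proof -
    \<comment> \<open>The deletion enters in t-degree p - 1. Its main term is nonnegative and
      increases with p, so the shift may be dropped in an upper bound.\<close>
    have 1: "real (if p = 0 then 0 else u1 (p - 1) q') \<le> minor_main F E p q' + shifted 1 0 g1 p q'" for q'
    proof (cases "p = 0")
      case True
      then show ?thesis using minor_main_nonneg[of E F p q'] noncoloop by (simp add: shifted_def)
    next
      case False
      have "minor_main F E (p - 1) q' \<le> minor_main F E p q'"
        by (rule minor_main_mono) (use noncoloop ne in auto)
      then show ?thesis using False le1[of "p - 1" q'] by (simp add: shifted_def)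
    qed
    have "real (?u p q) = (\<Sum>q'\<le>q. real (if p = 0 then 0 else u1 (p - 1) q') + real (u2 p q'))" by simp
    also have "\<dots> \<le> (\<Sum>q'\<le>q. (minor_main F E p q' + shifted 1 0 g1 p q') + (minor_main (insert e F) E p q' + g2 p q'))"
      by (intro sum_mono add_mono 1 le2)
    also have "\<dots> = (\<Sum>q'\<le>q. minor_main F E p q' + minor_main (insert e F) E p q') + ?g p q"
      by (simp add: sum.distrib)
    also have "(\<Sum>q'\<le>q. minor_main F E p q' + minor_main (insert e F) E p q') = minor_main F (insert e E) p q"
      by (rule minor_main_noncoloop[symmetric]) (use noncoloop in auto)
    finally show ?thesis .
  qed
  then show ?case using gen err
    by (intro exI[of _ ?u] exI[of _ ?g] conjI allI)
qed

section \<open>Logarithmic derivations\<close>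

text \<open>Restriction to lines replaces coordinates on V and makes directional derivatives
  available as coefficients of polynomials in one variable.\<close>

lemma poly_function_on_line:
  assumes "g \<in> poly_functions scl"
  shows "\<exists>P. \<forall>t. g (x + scl t v) = poly P t"
  using assms
proof induction
  case (const c)
  show ?case by (intro exI[of _ "[:c:]"]) simp
next
  case (linear \<phi>)
  then show ?case
    by (intro exI[of _ "[:\<phi> x, \<phi> v:]"]) (simp add: linear_form_add linear_form_scale)
next
  case (add g h)
  then obtain P Q where "\<forall>t. g (x + scl t v) = poly P t" "\<forall>t. h (x + scl t v) = poly Q t" by blast
  then show ?case by (intro exI[of _ "P + Q"]) simp
next
  case (mult g h)
  then obtain P Q where "\<forall>t. g (x + scl t v) = poly P t" "\<forall>t. h (x + scl t v) = poly Q t" by blast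
  then show ?case by (intro exI[of _ "P * Q"]) simp
qed

definition line_poly :: "('v \<Rightarrow> complex) \<Rightarrow> 'v \<Rightarrow> 'v \<Rightarrow> complex poly" where
  "line_poly g x v = (THE P. \<forall>t. g (x + scl t v) = poly P t)"

lemma line_poly_eq: "(\<And>t. g (x + scl t v) = poly P t) \<Longrightarrow> line_poly g x v = P"
  unfolding line_poly_def by (rule the_equality) (auto simp: poly_eq_poly_eq_iff fun_eq_iff simp flip: poly_eq_poly_eq_iff)

lemma poly_line_poly:
  assumes "g \<in> poly_functions scl"
  shows "poly (line_poly g x v) t = g (x + scl t v)"
  using poly_function_on_line[OF assms, of x v] line_poly_eq by metis

text \<open>\<open>vector_field c u\<close> is the derivation \<open>c \<partial>\<^sub>u\<close>, with the derivative read off the restriction to lines.\<close>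
definition vector_field :: "('v \<Rightarrow> complex) \<Rightarrow> ('v \<Rightarrow> 'v) \<Rightarrow> ('v \<Rightarrow> complex) \<Rightarrow> 'v \<Rightarrow> complex" where
  "vector_field c u g = (\<lambda>x. c x * coeff (line_poly g x (u x)) 1)"

lemma vector_field_const: "vector_field c u (\<lambda>_. a) = (\<lambda>_. 0)"
  unfolding vector_field_def by (subst line_poly_eq[of _ _ _ "[:a:]"]) auto

lemma vector_field_form:
  assumes "\<phi> \<in> linear_forms scl"
  shows "vector_field c u \<phi> = (\<lambda>x. c x * \<phi> (u x))"
proof
  fix x
  have "line_poly \<phi> x (u x) = [:\<phi> x, \<phi> (u x):]"
    by (rule line_poly_eq) (simp add: linear_form_add linear_form_scale assms)
  then show "vector_field c u \<phi> x = c x * \<phi> (u x)" by (simp add: vector_field_def)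
qed

lemma vector_field_add:
  assumes "g \<in> poly_functions scl" "h \<in> poly_functions scl"
  shows "vector_field c u (g + h) = vector_field c u g + vector_field c u h"
proof
  fix x
  have "line_poly (g + h) x (u x) = line_poly g x (u x) + line_poly h x (u x)"
    by (rule line_poly_eq) (simp add: poly_line_poly assms)
  then show "vector_field c u (g + h) x = (vector_field c u g + vector_field c u h) x"
    by (simp add: vector_field_def algebra_simps)
qed

lemma vector_field_mult:
  assumes "g \<in> poly_functions scl" "h \<in> poly_functions scl"
  shows "vector_field c u (g * h) = vector_field c u g * h + g * vector_field c u h"
proof
  fix x
  have "line_poly (g * h) x (u x) = line_poly g x (u x) * line_poly h x (u x)"
    by (rule line_poly_eq) (simp add: poly_line_poly assms)
  moreover have "coeff (line_poly g x (u x)) 0 = g x" "coeff (line_poly h x (u x)) 0 = h x"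
    using poly_line_poly[OF assms(1), of x "u x" 0] poly_line_poly[OF assms(2), of x "u x" 0]
    by (simp_all add: poly_0_coeff_0)
  ultimately show "vector_field c u (g * h) x = (vector_field c u g * h + g * vector_field c u h) x"
    by (simp add: vector_field_def coeff_mult algebra_simps)
qed

lemma vector_field_derivation:
  assumes "\<And>\<phi>. \<phi> \<in> linear_forms scl \<Longrightarrow> (\<lambda>x. c x * \<phi> (u x)) \<in> poly_functions scl"
  shows "vector_field c u \<in> derivations scl"
  unfolding derivations_def
proof (intro CollectI conjI ballI allI)
  show "vector_field c u g \<in> poly_functions scl" if "g \<in> poly_functions scl" for g
    using that
  proof induction
    case (const a)
    show ?case unfolding vector_field_const by (rule poly_functions.const)
  next
    case (linear \<phi>)
    then show ?case unfolding vector_field_form[OF linear] by (rule assms)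
  next
    case (add g h)
    then show ?case unfolding vector_field_add[OF add(1,2)] by (intro poly_functions.add)
  next
    case (mult g h)
    then show ?case unfolding vector_field_mult[OF mult(1,2)] by (intro poly_functions.add poly_functions.mult)
  qed
  show "vector_field c u (fun_scale a g) = fun_scale a (vector_field c u g)" if "g \<in> poly_functions scl" for a g
  proof -
    have eq: "fun_scale a g = (\<lambda>_. a) * g" for g :: "'v \<Rightarrow> complex" by (simp add: fun_scale_def fun_eq_iff)
    show ?thesis
      unfolding eq vector_field_mult[OF poly_functions.const that] vector_field_const by (simp add: fun_eq_iff)
  qed
qed (simp_all only: vector_field_add vector_field_mult)

text \<open>If every f_i is mapped to g_i f_i, the product rule multiplies the product of the f_i by
  \<Sum>i. g_i.\<close>

lemma vector_field_log_derivation: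
  assumes "\<And>\<phi>. \<phi> \<in> linear_forms scl \<Longrightarrow> (\<lambda>x. c x * \<phi> (u x)) \<in> poly_functions scl"
    and g: "\<And>i. i \<in> {1..n} \<Longrightarrow> g i \<in> poly_functions scl" "\<And>i. i \<in> {1..n} \<Longrightarrow> vector_field c u (f i) = g i * f i"
  shows "vector_field c u \<in> log_derivations scl n f"
proof -
  have "vector_field c u (\<Prod>i\<in>K. f i) = (\<Sum>i\<in>K. g i) * (\<Prod>i\<in>K. f i)" if "finite K" "K \<subseteq> {1..n}" for K
    using that
  proof (induction K rule: finite_induct)
    case empty
    have "vector_field c u (\<lambda>_. 1) = (\<lambda>_. 0)" by (rule vector_field_const)
    then show ?case by (simp add: one_fun_def zero_fun_def)
  next
    case (insert e K)
    have "vector_field c u (f e * (\<Prod>i\<in>K. f i)) = vector_field c u (f e) * (\<Prod>i\<in>K. f i) + f e * vector_field c u (\<Prod>i\<in>K. f i)"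
      using insert.prems by (intro vector_field_mult poly_functions_prod poly_functions.linear form) auto
    also have "\<dots> = (g e + (\<Sum>i\<in>K. g i)) * (f e * (\<Prod>i\<in>K. f i))"
      using insert g(2)[of e] by (simp only: insert_subset) (simp only: algebra_simps)
    finally show ?case unfolding prod.insert[OF insert(1,2)] sum.insert[OF insert(1,2)] .
  qed
  from this[of "{1..n}"] have "vector_field c u (\<Prod>i = 1..n. f i) = (\<Sum>i = 1..n. g i) * (\<Prod>i = 1..n. f i)"
    by simp
  moreover have "(\<Sum>i = 1..n. g i) \<in> poly_functions scl" using g(1) by (rule poly_functions_sum)
  ultimately show ?thesis
    unfolding log_derivations_def using vector_field_derivation[of c u, OF assms(1)] by blast
qed

lemma vector_field_contraction:
  assumes "\<And>\<phi>. \<phi> \<in> linear_forms scl \<Longrightarrow> (\<lambda>x. c x * \<phi> (u x)) \<in> poly_functions scl"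
    and g: "\<And>i. i \<in> {1..n} \<Longrightarrow> g i \<in> poly_functions scl" "\<And>i. i \<in> {1..n} \<Longrightarrow> vector_field c u (f i) = g i * f i"
  shows "(\<Sum>i = 1..n. av i * lin (g i)) \<in> I"
proof -
  have "(\<Sum>i = 1..n. av i * lin (g i)) = (\<Sum>i = 1..n. Poly_Mapping.single (Poly_Mapping.single i 1) (g i))"
    by (rule sum.cong[OF refl]) (simp only: av_def lin_def mult_single mult_1_left add_0_right)
  also have "\<dots> \<in> contractions scl n f"
    unfolding contractions_def using vector_field_log_derivation[OF assms] g by blast
  finally have c: "(\<Sum>i = 1..n. av i * lin (g i)) \<in> contractions scl n f" .
  have "1 * (\<Sum>i = 1..n. av i * lin (g i)) + 0 \<in> I"
    using one_mem_sdeg sdeg_subset_S_ring by (intro log_ideal.step c log_ideal.zero) blast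
  then show ?thesis by simp
qed

text \<open>The Euler derivation differentiates at x in direction x and fixes every linear form, so
  each quotient \<theta>(f_i)/f_i is 1.\<close>

lemma sum_av_mem_log_ideal: "(\<Sum>i = 1..n. av i) \<in> I"
proof -
  have "(\<Sum>i = 1..n. av i * lin 1) \<in> I"
  proof (rule vector_field_contraction[where c = "\<lambda>_. 1" and u = "\<lambda>x. x"])
    show "(\<lambda>x. 1 * \<phi> x) \<in> poly_functions scl" if "\<phi> \<in> linear_forms scl" for \<phi>
      using poly_functions.linear[OF that] by simp
    show "1 \<in> poly_functions scl" using poly_functions.const[of 1] by (simp add: one_fun_def)
    show "vector_field (\<lambda>_. 1) (\<lambda>x. x) (f i) = 1 * f i" if "i \<in> {1..n}" for i
      by (simp add: vector_field_form[OF form[OF that]])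
  qed
  then show ?thesis by (simp only: lin_1 mult_1_right)
qed

lemma lin_prod: "lin (\<Prod>j\<in>K. g j) = (\<Prod>j\<in>K. lin (g j))"
proof (induction K rule: infinite_finite_induct)
  case (insert k K)
  show ?case unfolding prod.insert[OF insert(1,2)] lin_mult insert(3) ..
qed (simp_all only: prod.infinite prod.empty lin_1 not_False_eq_True)

lemma contr_mem_log_ideal: "contr {1..n} v \<in> I"
proof -
  let ?D = "support {1..n} v"
  have fin: "finite ?D" and sub: "?D \<subseteq> {1..n}" by (auto simp: support_def)
  have poly: "(\<Prod>j\<in>K. f j) \<in> poly_functions scl" if "K \<subseteq> ?D" for K
    using that sub by (intro poly_functions_prod poly_functions.linear form) auto
  have prod_apply: "(\<Prod>j\<in>K. f j) x = (\<Prod>j\<in>K. f j x)" for K x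
    by (induction K rule: infinite_finite_induct) auto
  let ?g = "\<lambda>i. fun_scale (f i v) (\<Prod>j\<in>?D - {i}. f j)"
  have "(\<Sum>i = 1..n. av i * lin (?g i)) \<in> I"
  \<comment> \<open>The constant field v, multiplied by all forms not vanishing at v: these divide
    the factor, and the other forms have derivative 0.\<close>
  proof (rule vector_field_contraction[where c = "\<Prod>j\<in>?D. f j" and u = "\<lambda>_. v"])
    show "(\<lambda>x. (\<Prod>j\<in>?D. f j) x * \<phi> v) \<in> poly_functions scl" for \<phi>
      using poly_functions_scale[OF poly[of ?D], of "\<phi> v"] by (simp add: fun_scale_def mult.commute)
    show "?g i \<in> poly_functions scl" for i
      by (intro poly_functions_scale poly) auto
    show "vector_field (\<Prod>j\<in>?D. f j) (\<lambda>_. v) (f i) = ?g i * f i" if "i \<in> {1..n}" for i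
    proof (cases "i \<in> ?D")
      case True
      then show ?thesis
        using that by (simp only: vector_field_form[OF form] prod.remove[OF fin True]) (simp add: fun_eq_iff fun_scale_def)
    next
      case False
      then show ?thesis using that by (simp only: vector_field_form[OF form]) (simp add: support_def fun_eq_iff fun_scale_def)
    qed
  qed
  also have "(\<Sum>i = 1..n. av i * lin (?g i)) = (\<Sum>i\<in>?D. av i * lin (?g i))"
  proof (rule sum.mono_neutral_right)
    show "\<forall>i\<in>{1..n} - ?D. av i * lin (?g i) = 0"
      by (simp add: support_def lin_0)
  qed (use sub in auto)
  also have "\<dots> = contr {1..n} v"
    unfolding contr_def lin_fun_scale lin_prod mult_S_scale_right ..
  finally show ?thesis .
qed

lemma minor_ideal_subset_Ideg: "minor_ideal {} {1..n} p q \<subseteq> Ideg p q"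
proof (rule minor_ideal_subset)
  fix s g p0 q0 p1 q1
  assume g: "minor_gen {} {1..n} p0 q0 g" and s: "s \<in> sdeg p1 q1" and pq: "p = p1 + p0" "q = q1 + q0"
  have "g \<in> Ideg p0 q0"
    using g
  proof cases
    case (lform \<phi>)
    then have "\<phi> = 0" by (intro ext) (auto simp: flat_def)
    then have "g = 0" using lform by (simp only: lin_0)
    then show ?thesis by (simp add: S_space.subspace_0[OF Ideg_subspace])
  next
    case sum
    have "(\<Sum>i = 1..n. av i) \<in> sdeg 0 1"
      by (rule S_space.subspace_sum[OF sdeg_subspace]) (rule av_mem_sdeg)
    then show ?thesis using sum sum_av_mem_log_ideal by (simp add: Ideg_def)
  next
    case (contr v)
    have "contr {1..n} v \<in> sdeg (card (support {1..n} v) - 1) 1" by (rule contr_mem_sdeg) auto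
    then show ?thesis using contr contr_mem_log_ideal by (simp add: Ideg_def)
  qed simp
  then show "s * g \<in> Ideg p q" unfolding pq using s by (rule Ideg_mult)
qed (rule Ideg_subspace)

lemma quotient_dim_le_generated:
  assumes "generated_by {} {1..n} p q k"
  shows "quotient_dim scl n f p q \<le> k"
proof -
  obtain B where B: "finite B" "card B \<le> k" "sdeg p q \<subseteq> S_space.span (B \<union> minor_ideal {} {1..n} p q)"
    using assms unfolding generated_by_def covers_def by blast
  have "S_space.span (B \<union> minor_ideal {} {1..n} p q) \<subseteq> S_space.span (B \<union> Ideg p q)"
    using minor_ideal_subset_Ideg[of p q] by (intro S_space.span_mono) blast
  then have "quotient_dim scl n f p q \<le> card B" using B by (intro quotient_dim_le) auto
  then show ?thesis using B(2) by simp
qed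

end

section \<open>Lower bound\<close>

definition mval :: "(nat \<Rightarrow>\<^sub>0 nat) \<Rightarrow> (nat \<Rightarrow> complex) \<Rightarrow> complex" where
  "mval m a = (\<Prod>i\<in>Poly_Mapping.keys m. a i ^ Poly_Mapping.lookup m i)"

lemma mval_superset: "finite A \<Longrightarrow> Poly_Mapping.keys m \<subseteq> A \<Longrightarrow> mval m a = (\<Prod>i\<in>A. a i ^ Poly_Mapping.lookup m i)"
  unfolding mval_def by (intro prod.mono_neutral_left) (auto simp: in_keys_iff)

lemma mval_add: "mval (m + m') a = mval m a * mval m' a"
proof -
  let ?A = "Poly_Mapping.keys m \<union> Poly_Mapping.keys m'"
  have fin: "finite ?A" by simp
  have "mval (m + m') a = (\<Prod>i\<in>?A. a i ^ Poly_Mapping.lookup (m + m') i)"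
    by (rule mval_superset[OF fin keys_add])
  also have "\<dots> = (\<Prod>i\<in>?A. a i ^ Poly_Mapping.lookup m i) * (\<Prod>i\<in>?A. a i ^ Poly_Mapping.lookup m' i)"
    by (simp add: lookup_add power_add prod.distrib)
  finally show ?thesis using mval_superset[OF fin, of m a] mval_superset[OF fin, of m' a] by simp
qed

definition bival :: "'v bipoly \<Rightarrow> 'v \<Rightarrow> (nat \<Rightarrow> complex) \<Rightarrow> complex" where
  "bival s x a = (\<Sum>m\<in>Poly_Mapping.keys s. Poly_Mapping.lookup s m x * mval m a)"

lemma bival_superset:
  "finite A \<Longrightarrow> Poly_Mapping.keys s \<subseteq> A \<Longrightarrow> bival s x a = (\<Sum>m\<in>A. Poly_Mapping.lookup s m x * mval m a)"
  unfolding bival_def by (intro sum.mono_neutral_left) (auto simp: in_keys_iff)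

lemma bival_add: "bival (s + t) x a = bival s x a + bival t x a"
proof -
  let ?A = "Poly_Mapping.keys s \<union> Poly_Mapping.keys t"
  have fin: "finite ?A" by simp
  have "bival (s + t) x a = (\<Sum>m\<in>?A. Poly_Mapping.lookup (s + t) m x * mval m a)"
    by (rule bival_superset[OF fin keys_add])
  also have "\<dots> = (\<Sum>m\<in>?A. Poly_Mapping.lookup s m x * mval m a) + (\<Sum>m\<in>?A. Poly_Mapping.lookup t m x * mval m a)"
    by (simp add: lookup_add algebra_simps sum.distrib)
  finally show ?thesis using bival_superset[OF fin, of s x a] bival_superset[OF fin, of t x a] by simp
qed

lemma bival_0 [simp]: "bival 0 x a = 0"
  by (simp add: bival_def)

lemma bival_sum: "bival (\<Sum>k\<in>K. s k) x a = (\<Sum>k\<in>K. bival (s k) x a)"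
  by (induction K rule: infinite_finite_induct) (auto simp: bival_add)

lemma bival_single: "bival (Poly_Mapping.single m g) x a = g x * mval m a"
  by (subst bival_superset[of "{m}"]) auto

lemma bival_mult: "bival (s * t) x a = bival s x a * bival t x a"
proof -
  have "s * t = (\<Sum>k\<in>Poly_Mapping.keys s. \<Sum>l\<in>Poly_Mapping.keys t.
      Poly_Mapping.single (k + l) (Poly_Mapping.lookup s k * Poly_Mapping.lookup t l))"
    by (subst sum_single_lookup[of s, symmetric], subst sum_single_lookup[of t, symmetric])
      (simp only: sum_product mult_single)
  then have "bival (s * t) x a = (\<Sum>k\<in>Poly_Mapping.keys s. \<Sum>l\<in>Poly_Mapping.keys t.
      Poly_Mapping.lookup s k x * Poly_Mapping.lookup t l x * mval (k + l) a)"
    by (simp add: bival_sum bival_single)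
  also have "\<dots> = bival s x a * bival t x a"
    unfolding bival_def sum_product by (intro sum.cong) (auto simp: mval_add)
  finally show ?thesis .
qed

lemma bival_lin: "bival (lin g) x a = g x"
  by (simp add: lin_def bival_single mval_def)

lemma bival_av: "bival (av i) x a = a i"
  by (simp add: av_def bival_single mval_def)

lemma bival_S_scale: "bival (S_scale c s) x a = c * bival s x a"
  by (simp add: S_scale_eq_lin bival_mult bival_lin)

lemma bival_1: "bival 1 x a = 1"
  using bival_lin[of 1 x a] by (simp add: lin_1)

lemma bival_prod: "bival (\<Prod>k\<in>K. s k) x a = (\<Prod>k\<in>K. bival (s k) x a)"
  by (induction K rule: infinite_finite_induct) (auto simp: bival_mult bival_1)

lemma bival_diff: "bival (s - t) x a = bival s x a - bival t x a"
  using bival_add[of "s - t" t x a] by simp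

section \<open>Special points of a minor and functions polynomial along lines\<close>

context essential_arrangement
begin

definition relations :: "nat set \<Rightarrow> nat set \<Rightarrow> (nat \<Rightarrow> complex) set" where
  "relations F E = {b. (\<forall>i. i \<notin> E \<longrightarrow> b i = 0) \<and> (\<forall>x\<in>flat F. (\<Sum>i\<in>E. b i * f i x) = 0)}"

text \<open>The special points are parametrised by pairs (x, b) through a_i = b_i f_i(x). Both x and
  b range over vector spaces, which makes the parameter space irreducible.\<close>

definition val :: "'v bipoly \<Rightarrow> 'v \<Rightarrow> (nat \<Rightarrow> complex) \<Rightarrow> complex" where
  "val s x b = bival s x (\<lambda>i. b i * f i x)"

definition kernel :: "nat set \<Rightarrow> nat set \<Rightarrow> 'v bipoly set" where
  "kernel F E = {s. \<forall>x\<in>flat F. \<forall>b\<in>relations F E. val s x b = 0}"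

text \<open>A coordinate-free substitute for polynomial functions of (x, b): closed under sums and
  products, and polynomial in one variable on each line, which suffices for the domain
  property.\<close>

definition line_polynomial :: "('v \<Rightarrow> (nat \<Rightarrow> complex) \<Rightarrow> complex) \<Rightarrow> bool" where
  "line_polynomial G \<longleftrightarrow> (\<forall>x y b c. \<exists>P. \<forall>t. G (x + scl t y) (\<lambda>i. b i + t * c i) = poly P t)"

lemmas val_simps = bival_add bival_mult bival_lin bival_av bival_S_scale bival_1 bival_diff

lemma kernel_subspace: "S_space.subspace (kernel F E)"
  by (rule S_space.subspaceI) (auto simp: kernel_def val_def val_simps)

lemma line_polynomial_const: "line_polynomial (\<lambda>x b. c)"
  unfolding line_polynomial_def by (intro allI exI[of _ "[:c:]"]) simp

lemma line_polynomial_add: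
  assumes "line_polynomial G" "line_polynomial H"
  shows "line_polynomial (\<lambda>x b. G x b + H x b)"
  unfolding line_polynomial_def
proof (intro allI)
  fix x y b c
  obtain P Q where "\<forall>t. G (x + scl t y) (\<lambda>i. b i + t * c i) = poly P t" "\<forall>t. H (x + scl t y) (\<lambda>i. b i + t * c i) = poly Q t"
    using assms unfolding line_polynomial_def by meson
  then show "\<exists>P. \<forall>t. G (x + scl t y) (\<lambda>i. b i + t * c i) + H (x + scl t y) (\<lambda>i. b i + t * c i) = poly P t"
    by (intro exI[of _ "P + Q"]) simp
qed

lemma line_polynomial_mult:
  assumes "line_polynomial G" "line_polynomial H"
  shows "line_polynomial (\<lambda>x b. G x b * H x b)"
  unfolding line_polynomial_def
proof (intro allI)
  fix x y b c
  obtain P Q where "\<forall>t. G (x + scl t y) (\<lambda>i. b i + t * c i) = poly P t" "\<forall>t. H (x + scl t y) (\<lambda>i. b i + t * c i) = poly Q t"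
    using assms unfolding line_polynomial_def by meson
  then show "\<exists>P. \<forall>t. G (x + scl t y) (\<lambda>i. b i + t * c i) * H (x + scl t y) (\<lambda>i. b i + t * c i) = poly P t"
    by (intro exI[of _ "P * Q"]) simp
qed

lemma line_polynomial_form: "\<phi> \<in> linear_forms scl \<Longrightarrow> line_polynomial (\<lambda>x b. \<phi> x)"
  unfolding line_polynomial_def
proof (intro allI)
  fix x y assume "\<phi> \<in> linear_forms scl"
  then show "\<exists>P. \<forall>t. \<phi> (x + scl t y) = poly P t"
    by (intro exI[of _ "[:\<phi> x, \<phi> y:]"]) (simp add: linear_form_add linear_form_scale)
qed

lemma line_polynomial_coord: "line_polynomial (\<lambda>x b. b i)"
  unfolding line_polynomial_def
proof (intro allI)
  fix b c :: "nat \<Rightarrow> complex"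
  show "\<exists>P. \<forall>t. b i + t * c i = poly P t" by (intro exI[of _ "[:b i, c i:]"]) simp
qed

lemma line_polynomial_prod_forms:
  "finite D \<Longrightarrow> D \<subseteq> {1..n} \<Longrightarrow> line_polynomial (\<lambda>x b. \<Prod>j\<in>D. f j x)"
proof (induction D rule: finite_induct)
  case empty
  show ?case using line_polynomial_const[of 1] by simp
next
  case (insert e D)
  have "line_polynomial (\<lambda>x b. f e x * (\<Prod>j\<in>D. f j x))"
    by (rule line_polynomial_mult[OF line_polynomial_form[OF form] insert.IH]) (use insert.prems in auto)
  then show ?case using insert.hyps by simp
qed

lemma line_polynomial_val: "s \<in> sdeg p q \<Longrightarrow> line_polynomial (val s)"
proof (induction rule: sdeg_induct)
  case (zero p q)
  show ?case using line_polynomial_const[of 0] by (simp add: val_def[abs_def])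
next
  case (add p q c s t)
  then have "line_polynomial (\<lambda>x b. c * val s x b + val t x b)"
    by (intro line_polynomial_add line_polynomial_mult[OF line_polynomial_const])
  then show ?case by (simp add: val_def[abs_def] val_simps)
next
  case one
  show ?case using line_polynomial_const[of 1] by (simp add: val_def[abs_def] val_simps)
next
  case (lin p q s \<phi>)
  then have "line_polynomial (\<lambda>x b. \<phi> x * val s x b)"
    by (intro line_polynomial_mult line_polynomial_form)
  then show ?case by (simp add: val_def[abs_def] val_simps)
next
  case (av p q s i)
  then have "line_polynomial (\<lambda>x b. b i * f i x * val s x b)"
    by (intro line_polynomial_mult line_polynomial_form line_polynomial_coord form)
  then show ?case by (simp add: val_def[abs_def] val_simps)
qed

text \<open>
  Polynomial functions on \<open>flat F \<times> relations F E\<close> form a domain: restrict both factors to the line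
  through two points at which they do not vanish.
\<close>
lemma line_polynomial_domain:
  assumes G: "line_polynomial G" and H: "line_polynomial H" and F: "F \<subseteq> {1..n}"
    and zero: "\<And>x b. x \<in> flat F \<Longrightarrow> b \<in> relations F E \<Longrightarrow> G x b * H x b = 0"
    and x: "x \<in> flat F" "b \<in> relations F E" "G x b \<noteq> 0"
    and x': "x' \<in> flat F" "b' \<in> relations F E"
  shows "H x' b' = 0"
proof -
  let ?x = "\<lambda>t. x + scl t (x' - x)" and ?b = "\<lambda>t i. b i + t * (b' i - b i)"
  have on: "?x t \<in> flat F" "?b t \<in> relations F E" for t
  proof -
    have "f i (?x t) = 0" if "i \<in> F" for i
      using that F x(1) x'(1) form[of i] by (auto simp: flat_def linear_form_add linear_form_scale linear_form_diff)
    then show "?x t \<in> flat F" by (simp add: flat_def)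
    have "(\<Sum>i\<in>E. ?b t i * f i y) = (1 - t) * (\<Sum>i\<in>E. b i * f i y) + t * (\<Sum>i\<in>E. b' i * f i y)" for y
      by (simp add: sum_distrib_left algebra_simps sum.distrib sum_subtractf)
    then show "?b t \<in> relations F E" using x(2) x'(2) by (auto simp: relations_def)
  qed
  obtain P Q where P: "\<forall>t. G (?x t) (?b t) = poly P t" and Q: "\<forall>t. H (?x t) (?b t) = poly Q t"
    using G H unfolding line_polynomial_def by meson
  have "poly (P * Q) t = 0" for t using zero[OF on, of t t] P Q by simp
  then have "P * Q = 0" by (simp add: poly_all_0_iff_0[symmetric])
  moreover have "P \<noteq> 0" using P[rule_format, of 0] x(3) by auto
  ultimately have "Q = 0" by simp
  then show ?thesis using Q[rule_format, of 1] by simp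
qed

lemma zero_in_relations: "(\<lambda>_. 0) \<in> relations F E"
  by (simp add: relations_def)

lemma span_family:
  assumes "g \<in> fun_space.span (f ` A)" "finite A"
  shows "\<exists>c. \<forall>x. g x = (\<Sum>i\<in>A. c i * f i x)"
  using assms(1)
proof (induction rule: fun_space.span_induct_alt)
  case base
  show ?case by (intro exI[of _ "\<lambda>_. 0"]) simp
next
  case (step a y z)
  then obtain j c where j: "j \<in> A" "y = f j" and c: "\<forall>x. z x = (\<Sum>i\<in>A. c i * f i x)" by blast
  have "(fun_scale a y + z) x = (\<Sum>i\<in>A. ((if i = j then a else 0) + c i) * f i x)" for x
  proof -
    have "(\<Sum>i\<in>A. ((if i = j then a else 0) + c i) * f i x) = (\<Sum>i\<in>A. (if i = j then a * f j x else 0) + c i * f i x)"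
      by (intro sum.cong) (auto simp: algebra_simps)
    then show ?thesis using j assms(2) c by (simp add: fun_scale_apply sum.distrib)
  qed
  then show ?case by (intro exI[of _ "\<lambda>i. (if i = j then a else 0) + c i"] allI)
qed

lemma relations_deletion:
  assumes "finite E" "e \<notin> E"
  shows "relations F E \<subseteq> relations F (insert e E)"
  using assms by (auto simp: relations_def)

text \<open>On \<open>flat F\<close> the combination vanishes where f e = 0, so it is a multiple of
  \<open>f e\<close>; the coefficient at e is chosen to cancel it.\<close>

lemma relations_extend:
  assumes "finite E" "E \<subseteq> {1..n}" "F \<subseteq> {1..n}" "e \<in> {1..n}" "e \<notin> E" "v \<in> flat F" "f e v \<noteq> 0"
    and b: "b \<in> relations (insert e F) E"
  shows "\<exists>c. b(e := c) \<in> relations F (insert e E)"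
proof -
  let ?\<phi> = "\<lambda>x. \<Sum>i\<in>E. b i * f i x"
  have lf: "?\<phi> \<in> linear_forms scl"
  proof (rule linear_formI)
    show "?\<phi> (x + y) = ?\<phi> x + ?\<phi> y" for x y
      unfolding sum.distrib[symmetric] by (intro sum.cong) (use assms(2) form in \<open>auto simp: linear_form_add algebra_simps\<close>)
    show "?\<phi> (scl c x) = c * ?\<phi> x" for c x
      unfolding sum_distrib_left by (intro sum.cong) (use assms(2) form in \<open>auto simp: linear_form_scale algebra_simps\<close>)
  qed
  have van: "?\<phi> x = 0" if "x \<in> flat (insert e F)" for x using b that by (simp add: relations_def)
  have dec: "?\<phi> x = ?\<phi> v / f e v * f e x" if "x \<in> flat F" for x
    by (rule vanishing_insert_decompose[OF assms(3,4,6,7) lf van that])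
  let ?b = "b(e := - (?\<phi> v / f e v))"
  have "(\<Sum>i\<in>insert e E. ?b i * f i x) = 0" if "x \<in> flat F" for x
  proof -
    have "(\<Sum>i\<in>E. ?b i * f i x) = ?\<phi> x" using assms(5) by (intro sum.cong) auto
    then show ?thesis using dec[OF that] assms(1,5) by simp
  qed
  moreover have "?b i = 0" if "i \<notin> insert e E" for i using that b by (simp add: relations_def)
  ultimately have "?b \<in> relations F (insert e E)" by (simp only: relations_def mem_Collect_eq) blast
  then show ?thesis by blast
qed

text \<open>As the deletion is essential, \<open>f e\<close> is a combination of the forms in F
  \<union> E, and those in F vanish on \<open>flat F\<close>. So b e is not identically zero and can
  be cancelled in products.\<close>

lemma relations_nonzero:
  assumes "finite E" "E \<subseteq> {1..n}" "F \<subseteq> {1..n}" "e \<in> {1..n}" "e \<notin> E" "F \<inter> E = {}" "flat (F \<union> E) = {0}"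
  shows "\<exists>b\<in>relations F (insert e E). b e \<noteq> 0"
proof -
  have fin: "finite (F \<union> E)" using finite_subset[OF assms(3)] assms(1) by simp
  have "f e \<in> fun_space.span (f ` (F \<union> E))"
    using assms fin by (intro vanishing_form_in_span form) (auto simp: linear_form_zero form)
  then obtain c where c: "\<And>x. f e x = (\<Sum>i\<in>F \<union> E. c i * f i x)" using span_family[OF _ fin] by blast
  let ?b = "\<lambda>i. if i = e then - 1 else if i \<in> E then c i else 0"
  have "(\<Sum>i\<in>insert e E. ?b i * f i x) = 0" if "x \<in> flat F" for x
  proof -
    have "(\<Sum>i\<in>F \<union> E. c i * f i x) = (\<Sum>i\<in>F. c i * f i x) + (\<Sum>i\<in>E. c i * f i x)"
      using fin assms(6) by (intro sum.union_disjoint) auto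
    also have "(\<Sum>i\<in>F. c i * f i x) = 0" using that by (intro sum.neutral) (auto simp: flat_def)
    finally have "f e x = (\<Sum>i\<in>E. c i * f i x)" using c[of x] by simp
    moreover have "(\<Sum>i\<in>E. ?b i * f i x) = (\<Sum>i\<in>E. c i * f i x)" using assms(5) by (intro sum.cong) auto
    ultimately show ?thesis using assms(1,5) by simp
  qed
  then have "?b \<in> relations F (insert e E)" by (auto simp: relations_def)
  then show ?thesis by (intro bexI[of _ ?b]) auto
qed

lemma val_upd: "f e x = 0 \<Longrightarrow> val s x (b(e := c)) = val s x b"
proof -
  assume "f e x = 0"
  then have "(\<lambda>i. (b(e := c)) i * f i x) = (\<lambda>i. b i * f i x)" by (auto simp: fun_eq_iff)
  then show ?thesis by (simp only: val_def)
qed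

lemma kernel_deletion: "finite E \<Longrightarrow> e \<notin> E \<Longrightarrow> kernel F (insert e E) \<subseteq> kernel F E"
  using relations_deletion unfolding kernel_def by blast

text \<open>Where f e = 0 the coordinate b e does not affect values, and every relation of the
  contraction extends by a suitable b e. So the points of the contraction are among those of the
  minor.\<close>

lemma kernel_contraction:
  assumes "finite E" "E \<subseteq> {1..n}" "F \<subseteq> {1..n}" "e \<in> {1..n}" "e \<notin> E" "v \<in> flat F" "f e v \<noteq> 0"
  shows "kernel F (insert e E) \<subseteq> kernel (insert e F) E"
proof
  fix s assume s: "s \<in> kernel F (insert e E)"
  have "val s x b = 0" if x: "x \<in> flat (insert e F)" and b: "b \<in> relations (insert e F) E" for x b
  proof -
    obtain c where "b(e := c) \<in> relations F (insert e E)" using relations_extend[OF assms b] by blast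
    then have "val s x (b(e := c)) = 0" using s x by (simp add: kernel_def flat_insert)
    then show ?thesis using x by (simp add: val_upd flat_insert)
  qed
  then show "s \<in> kernel (insert e F) E" by (simp add: kernel_def)
qed

section \<open>Recursion for the number of independent elements\<close>

definition independent_count :: "nat set \<Rightarrow> nat set \<Rightarrow> nat \<Rightarrow> nat \<Rightarrow> nat \<Rightarrow> bool" where
  "independent_count F E p q k \<longleftrightarrow>
     (\<exists>B. finite B \<and> card B = k \<and> B \<subseteq> sdeg p q \<and> independent_mod S_scale (kernel F E) B)"

lemma independent_count_zero: "independent_count F E p q 0"
  unfolding independent_count_def by (intro exI[of _ "{}"]) (simp add: S_space.independent_mod_empty)

text \<open>A family independent on the points of the contraction is joined to \<open>f e\<close>
  times the family of t-degree one less. The latter vanishes on those points, and multiplication by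
  \<open>f e\<close> is injective by the domain property.\<close>

lemma independent_count_coloop:
  assumes E: "E \<subseteq> {1..n}" "F \<subseteq> {1..n}" "e \<in> {1..n}" "e \<notin> E" "v \<in> flat F" "f e v \<noteq> 0"
    and con: "\<And>p. independent_count (insert e F) E p q (u p)"
  shows "independent_count F (insert e E) p q (\<Sum>p'\<le>p. u p')"
proof (induction p)
  case 0
  have fin: "finite E" using finite_subset[OF E(1)] by simp
  obtain B where B: "finite B" "card B = u 0" "B \<subseteq> sdeg 0 q" "independent_mod S_scale (kernel (insert e F) E) B"
    using con unfolding independent_count_def by blast
  have "independent_mod S_scale (kernel F (insert e E)) B"
    using B(4) kernel_contraction[OF fin E] unfolding independent_mod_def by blast
  then show ?case using B unfolding independent_count_def by auto
next
  case (Suc p)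
  have fin: "finite E" using finite_subset[OF E(1)] by simp
  let ?K = "kernel F (insert e E)" and ?L = "kernel (insert e F) E"
  obtain B where B: "finite B" "card B = u (Suc p)" "B \<subseteq> sdeg (Suc p) q" "independent_mod S_scale ?L B"
    using con unfolding independent_count_def by blast
  obtain B' where B': "finite B'" "card B' = (\<Sum>p'\<le>p. u p')" "B' \<subseteq> sdeg p q" "independent_mod S_scale ?K B'"
    using Suc.IH unfolding independent_count_def by blast
  let ?C = "(*) (lin (f e)) ` B'"
  have "independent_mod S_scale ?K ?C \<and> card ?C = card B'"
  proof (rule independent_mod_mult[OF B'(4,1,3) sdeg_subspace kernel_subspace])
    fix s assume s: "s \<in> sdeg p q" "lin (f e) * s \<in> ?K"
    have "val s x' b' = 0" if "x' \<in> flat F" "b' \<in> relations F (insert e E)" for x' b'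
    proof (rule line_polynomial_domain[where G = "\<lambda>x b. f e x", OF _ line_polynomial_val[OF s(1)] E(2) _ E(5) zero_in_relations E(6) that])
      show "line_polynomial (\<lambda>x b. f e x)" by (intro line_polynomial_form form E)
      show "f e x * val s x b = 0" if "x \<in> flat F" "b \<in> relations F (insert e E)" for x b
        using s(2) that by (auto simp: kernel_def val_def val_simps)
    qed
    then show "s \<in> ?K" by (simp add: kernel_def)
  qed
  then have C: "independent_mod S_scale ?K ?C" "card ?C = card B'" by auto
  have "independent_mod S_scale ?K (B \<union> ?C) \<and> B \<inter> ?C = {}"
  proof (rule S_space.independent_mod_Un[OF B(1) finite_imageI[OF B'(1)] B(4) C(1) kernel_contraction[OF fin E] _ kernel_subspace])
    show "?C \<subseteq> ?L" by (auto simp: kernel_def val_def val_simps flat_insert)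
  qed
  moreover have "?C \<subseteq> sdeg (Suc p) q" using B'(3) lin_mult_mem_sdeg[OF form[OF E(3)]] by blast
  ultimately show ?case
    unfolding independent_count_def using B B' C
    by (intro exI[of _ "B \<union> ?C"]) (auto simp: card_Un_disjoint)
qed

text \<open>The relation evaluated at v gives \<Sum>i\<in>E. b_i f_i(v) = - b_e f_e(v); after
  substituting a_i = b_i f_i(x), all summands share the full product of forms.\<close>

lemma val_contr:
  assumes "finite E" "E \<subseteq> {1..n}" "e \<notin> E" "v \<in> flat F" "b \<in> relations F (insert e E)"
  shows "val (contr E v) x b = - (f e v * b e * (\<Prod>j\<in>support E v. f j x))"
proof -
  let ?D = "support E v"
  have fin: "finite ?D" using assms(1) by (simp add: support_def)
  have "val (contr E v) x b = (\<Sum>i\<in>?D. f i v * (b i * f i x * (\<Prod>j\<in>?D - {i}. f j x)))"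
    by (simp add: val_def contr_def bival_sum bival_prod val_simps)
  also have "\<dots> = (\<Sum>i\<in>?D. f i v * b i * (\<Prod>j\<in>?D. f j x))"
    by (intro sum.cong) (simp_all add: prod.remove[OF fin] algebra_simps)
  also have "\<dots> = (\<Sum>i\<in>?D. b i * f i v) * (\<Prod>j\<in>?D. f j x)"
    unfolding sum_distrib_right by (intro sum.cong) (simp_all add: mult.commute)
  also have "(\<Sum>i\<in>?D. b i * f i v) = (\<Sum>i\<in>E. b i * f i v)"
    using assms(1) by (intro sum.mono_neutral_left) (auto simp: support_def)
  also have "\<dots> = - (b e * f e v)"
  proof -
    have "(\<Sum>i\<in>insert e E. b i * f i v) = 0" using assms(4,5) by (simp add: relations_def)
    then show ?thesis using assms(1,3) by (simp add: add_eq_0_iff)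
  qed
  finally show ?thesis by (simp add: mult.commute)
qed

text \<open>The flat is irreducible, so finitely many forms that are nonzero on it are nonzero at a
  common point.\<close>

lemma prod_forms_nonzero:
  assumes "finite D" "D \<subseteq> {1..n}" "F \<subseteq> {1..n}" "\<And>j. j \<in> D \<Longrightarrow> \<exists>x\<in>flat F. f j x \<noteq> 0"
  shows "\<exists>x\<in>flat F. (\<Prod>j\<in>D. f j x) \<noteq> 0"
  using assms(1,2,4)
proof (induction D rule: finite_induct)
  case empty
  then show ?case using zero_in_flat[OF assms(3)] by auto
next
  case (insert e D)
  then obtain x where x: "x \<in> flat F" "(\<Prod>j\<in>D. f j x) \<noteq> 0" by auto
  obtain y where y: "y \<in> flat F" "f e y \<noteq> 0" using insert.prems by blast
  show ?case
  proof (rule ccontr)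
    assume neg: "\<not> ?thesis"
    have "(\<Prod>j\<in>D. f j x) = 0"
    proof (rule line_polynomial_domain[where G = "\<lambda>x b. f e x" and H = "\<lambda>x b. \<Prod>j\<in>D. f j x" and E = "{}", OF _ _ assms(3) _ y(1) zero_in_relations y(2) x(1) zero_in_relations])
      show "line_polynomial (\<lambda>x b. f e x)" using insert.prems by (intro line_polynomial_form form) auto
      show "line_polynomial (\<lambda>x b. \<Prod>j\<in>D. f j x)" using insert by (intro line_polynomial_prod_forms) auto
      show "f e x * (\<Prod>j\<in>D. f j x) = 0" if "x \<in> flat F" for x
        using neg that insert.hyps by auto
    qed
    then show False using x(2) by simp
  qed
qed

text \<open>Three layers. The family of the deletion counts modulo functions vanishing for b e = 0;
  z times the family of the contraction counts modulo \<open>M\<close>; and \<open>a e\<close> times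
  the family of u-degree one less counts modulo the kernel. The last two vanish for b e = 0. If the
  contraction has a loop, z may vanish on its points; by \<open>loop\<close> that layer is then
  empty.\<close>

lemma independent_count_noncoloop:
  assumes E: "E \<subseteq> {1..n}" "F \<subseteq> {1..n}" "e \<in> {1..n}" "e \<notin> E" "v \<in> flat F" "f e v \<noteq> 0"
    and disj: "F \<inter> E = {}" and flat0: "flat (F \<union> E) = {0}"
    and del: "\<And>q. independent_count F E p q (u1 q)"
    and con: "\<And>p' q. independent_count (insert e F) E p' q (u2 p' q)"
    and loop: "\<And>j p' q. j \<in> E \<Longrightarrow> (\<And>x. x \<in> flat (insert e F) \<Longrightarrow> f j x = 0) \<Longrightarrow> u2 p' q = 0"
  shows "independent_count F (insert e E) p q (\<Sum>q'\<le>q. u1 q' + shifted (card (support E v) - 1) 1 u2 p q')"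
proof (induction q)
  case 0
  have fin: "finite E" using finite_subset[OF E(1)] by simp
  obtain B where B: "finite B" "card B = u1 0" "B \<subseteq> sdeg p 0" "independent_mod S_scale (kernel F E) B"
    using del unfolding independent_count_def by blast
  have "independent_mod S_scale (kernel F (insert e E)) B"
    using B(4) kernel_deletion[OF fin E(4)] unfolding independent_mod_def by blast
  then show ?case using B unfolding independent_count_def by (auto simp: shifted_def)
next
  case (Suc q)
  have fin: "finite E" using finite_subset[OF E(1)] by simp
  have finF: "insert e F \<subseteq> {1..n}" using E by auto
  let ?K = "kernel F (insert e E)" and ?L = "kernel F E" and ?z = "contr E v"
  let ?p0 = "card (support E v) - 1"
  have zval: "val ?z x b = - (f e v * b e * (\<Prod>j\<in>support E v. f j x))" if "b \<in> relations F (insert e E)" for x b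
    by (rule val_contr[OF fin E(1,4,5) that])
  obtain B2 where B2: "finite B2" "card B2 = u1 (Suc q)" "B2 \<subseteq> sdeg p (Suc q)" "independent_mod S_scale ?L B2"
    using del unfolding independent_count_def by blast
  obtain B1 where B1: "finite B1" "card B1 = (\<Sum>q'\<le>q. u1 q' + shifted ?p0 1 u2 p q')" "B1 \<subseteq> sdeg p q" "independent_mod S_scale ?K B1"
    using Suc.IH unfolding independent_count_def by blast
  let ?C1 = "(*) (av e) ` B1"
  \<comment> \<open>\<open>M\<close> consists of the elements divisible by \<open>a e = b e f e\<close> as functions of \<open>x\<close> and \<open>b\<close>.
    It separates \<open>a e\<close> times \<open>S\<close> from \<open>z\<close> times the basis of the contraction, because \<open>z\<close> restricts to a
    multiple of \<open>b e\<close> that is nonzero where \<open>f e = 0\<close>.\<close>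
  define M where "M = {s. \<exists>r. line_polynomial r \<and> (\<forall>x\<in>flat F. \<forall>b\<in>relations F (insert e E). val s x b = b e * f e x * r x b)}"
  have M_sub: "S_space.subspace M"
  proof (rule S_space.subspaceI)
    show "0 \<in> M" unfolding M_def using line_polynomial_const[of 0] by (auto simp: val_def intro!: exI[of _ "\<lambda>_ _. 0"])
  next
    fix s t assume "s \<in> M" "t \<in> M"
    then obtain r r' where "line_polynomial r" "line_polynomial r'"
      "\<forall>x\<in>flat F. \<forall>b\<in>relations F (insert e E). val s x b = b e * f e x * r x b"
      "\<forall>x\<in>flat F. \<forall>b\<in>relations F (insert e E). val t x b = b e * f e x * r' x b" unfolding M_def by blast
    then show "s + t \<in> M" unfolding M_def
      by (intro CollectI exI[of _ "\<lambda>x b. r x b + r' x b"]) (auto simp: val_def val_simps line_polynomial_add distrib_left)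
  next
    fix c s assume "s \<in> M"
    then obtain r where "line_polynomial r"
      "\<forall>x\<in>flat F. \<forall>b\<in>relations F (insert e E). val s x b = b e * f e x * r x b" unfolding M_def by blast
    then show "S_scale c s \<in> M" unfolding M_def
      by (intro CollectI exI[of _ "\<lambda>x b. c * r x b"]) (auto simp: val_def val_simps line_polynomial_mult line_polynomial_const)
  qed
  have K_M: "?K \<subseteq> M"
    unfolding M_def kernel_def using line_polynomial_const[of 0] by (auto intro!: exI[of _ "\<lambda>_ _. 0"])
  have "independent_mod S_scale ?K ?C1 \<and> card ?C1 = card B1"
  proof (rule independent_mod_mult[OF B1(4,1,3) sdeg_subspace kernel_subspace])
    obtain b0 where b0: "b0 \<in> relations F (insert e E)" "b0 e \<noteq> 0"
      using relations_nonzero[OF fin E(1-4) disj flat0] by blast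
    fix s assume s: "s \<in> sdeg p q" "av e * s \<in> ?K"
    have "val s x' b' = 0" if "x' \<in> flat F" "b' \<in> relations F (insert e E)" for x' b'
    proof (rule line_polynomial_domain[where G = "\<lambda>x b. b e * f e x", OF _ line_polynomial_val[OF s(1)] E(2) _ E(5) b0(1) _ that])
      show "line_polynomial (\<lambda>x b. b e * f e x)" by (intro line_polynomial_mult line_polynomial_coord line_polynomial_form form E)
      show "b e * f e x * val s x b = 0" if "x \<in> flat F" "b \<in> relations F (insert e E)" for x b
        using s(2) that by (auto simp: kernel_def val_def val_simps)
      show "b0 e * f e v \<noteq> 0" using b0 E by simp
    qed
    then show "s \<in> ?K" by (simp add: kernel_def)
  qed
  then have C1: "independent_mod S_scale ?K ?C1" "card ?C1 = card B1" by auto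
  obtain C3 where C3: "finite C3" "card C3 = shifted ?p0 1 u2 p (Suc q)" "C3 \<subseteq> sdeg p (Suc q)" "C3 \<subseteq> ?L" "independent_mod S_scale M C3"
  proof (cases "shifted ?p0 1 u2 p (Suc q) = 0")
    case True
    then show ?thesis by (intro that[of "{}"]) (auto simp: S_space.independent_mod_empty)
  next
    case False
    then have p: "?p0 \<le> p" and u2: "shifted ?p0 1 u2 p (Suc q) = u2 (p - ?p0) q" "u2 (p - ?p0) q \<noteq> 0"
      by (auto simp: shifted_def split: if_splits)
    obtain B3 where B3: "finite B3" "card B3 = u2 (p - ?p0) q" "B3 \<subseteq> sdeg (p - ?p0) q" "independent_mod S_scale (kernel (insert e F) E) B3"
      using con unfolding independent_count_def by blast
    let ?C3 = "(*) ?z ` B3"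
    have "\<exists>x\<in>flat (insert e F). f j x \<noteq> 0" if "j \<in> E" for j
    proof (rule ccontr)
      assume "\<not> ?thesis"
      then have "u2 (p - ?p0) q = 0" by (intro loop[OF that]) blast
      then show False using u2(2) by simp
    qed
    \<comment> \<open>Without loops in the contraction, the forms in the support are simultaneously
      nonzero somewhere on its flat, so z can be cancelled there.\<close>
    then obtain y where y: "y \<in> flat (insert e F)" "(\<Prod>j\<in>support E v. f j y) \<noteq> 0"
      using prod_forms_nonzero[of "support E v" "insert e F"] fin E(1) finF by (auto simp: support_def)
    have "independent_mod S_scale M ?C3 \<and> card ?C3 = card B3"
    proof (rule independent_mod_mult[OF B3(4,1,3) sdeg_subspace M_sub])
      obtain b0 where b0: "b0 \<in> relations F (insert e E)" "b0 e \<noteq> 0"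
        using relations_nonzero[OF fin E(1-4) disj flat0] by blast
      fix s assume s: "s \<in> sdeg (p - ?p0) q" "?z * s \<in> M"
      then obtain r where r: "line_polynomial r"
        "\<And>x b. x \<in> flat F \<Longrightarrow> b \<in> relations F (insert e E) \<Longrightarrow> val (?z * s) x b = b e * f e x * r x b"
        unfolding M_def by blast
      let ?g = "\<lambda>x b. \<Prod>j\<in>support E v. f j x"
      let ?H = "\<lambda>x b. f e v * ?g x b * val s x b + f e x * r x b"
      have g_lp: "line_polynomial ?g" using fin E(1) by (intro line_polynomial_prod_forms) (auto simp: support_def)
      \<comment> \<open>Membership in \<open>M\<close> is an identity whose two sides both carry the
        factor b e, which is cancelled. On f e = 0 the term with \<open>r\<close> then
        disappears.\<close>
      have H: "?H x b = 0" if "x \<in> flat F" "b \<in> relations F (insert e E)" for x b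
      proof (rule line_polynomial_domain[where G = "\<lambda>x b. b e" and H = ?H, OF _ _ E(2) _ E(5) b0(1) b0(2) that])
        show "line_polynomial (\<lambda>x b. b e)" by (rule line_polynomial_coord)
        show "line_polynomial ?H"
          by (intro line_polynomial_add line_polynomial_mult line_polynomial_const line_polynomial_form form E r(1) g_lp
              line_polynomial_val[OF s(1)])
        show "b e * ?H x b = 0" if "x \<in> flat F" "b \<in> relations F (insert e E)" for x b
        proof -
          have "val (?z * s) x b = val ?z x b * val s x b" by (simp add: val_def val_simps)
          then have "b e * f e x * r x b = - (f e v * b e * ?g x b) * val s x b"
            using r(2)[OF that] zval[OF that(2), of x] by simp
          then show ?thesis by (simp add: distrib_left mult.assoc mult.left_commute)
        qed
      qed
      have "val s x' b' = 0" if "x' \<in> flat (insert e F)" "b' \<in> relations (insert e F) E" for x' b'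
      proof (rule line_polynomial_domain[where G = ?g, OF g_lp line_polynomial_val[OF s(1)] finF _ y(1) zero_in_relations y(2) that])
        fix x b assume x: "x \<in> flat (insert e F)" and b: "b \<in> relations (insert e F) E"
        obtain c where c: "b(e := c) \<in> relations F (insert e E)" using relations_extend[OF fin E b] by blast
        have xF: "x \<in> flat F" "f e x = 0" using x by (auto simp: flat_insert)
        have "f e v * ?g x (b(e := c)) * val s x (b(e := c)) = 0"
          using H[OF xF(1) c] xF(2) by (simp only: mult_zero_left add_0_right)
        then show "?g x b * val s x b = 0" using E(6) by (simp add: val_upd[OF xF(2)] del: fun_upd_apply)
      qed
      then show "s \<in> kernel (insert e F) E" by (simp add: kernel_def)
    qed
    then have C3: "independent_mod S_scale M ?C3" "card ?C3 = card B3" by auto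
    show ?thesis
    proof (rule that[of ?C3])
      show "?C3 \<subseteq> sdeg p (Suc q)"
      proof
        fix x assume "x \<in> ?C3"
        then obtain b where b: "x = ?z * b" "b \<in> sdeg (p - ?p0) q" using B3(3) by blast
        have "?z * b \<in> sdeg (?p0 + (p - ?p0)) (1 + q)" by (intro sdeg_mult contr_mem_sdeg fin E b)
        then show "x \<in> sdeg p (Suc q)" using p by (simp add: b)
      qed
      show "?C3 \<subseteq> ?L"
      proof
        fix x assume "x \<in> ?C3"
        then obtain s where s: "x = ?z * s" by blast
        have "val ?z y b = 0" if "b \<in> relations F E" for y b
        proof -
          have "b e = 0" using that E(4) by (simp add: relations_def)
          then show ?thesis using zval[of b y] relations_deletion[OF fin E(4)] that by auto
        qed
        then show "x \<in> ?L" by (simp add: kernel_def s val_def val_simps)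
      qed
    qed (use B3 C3 u2 in auto)
  qed
  have av_M: "?C1 \<subseteq> M"
  proof
    fix x assume "x \<in> ?C1"
    then obtain s where s: "x = av e * s" "s \<in> sdeg p q" using B1(3) by blast
    then show "x \<in> M" unfolding M_def using line_polynomial_val[OF s(2)]
      by (intro CollectI exI[of _ "val s"]) (simp add: val_def val_simps)
  qed
  have "independent_mod S_scale ?K (C3 \<union> ?C1) \<and> C3 \<inter> ?C1 = {}"
    by (rule S_space.independent_mod_Un[OF C3(1) finite_imageI[OF B1(1)] C3(5) C1(1) K_M av_M M_sub])
  then have C31: "independent_mod S_scale ?K (C3 \<union> ?C1)" "C3 \<inter> ?C1 = {}" by auto
  have "b e = 0" if "b \<in> relations F E" for b using that E(4) by (simp add: relations_def)
  then have C1_L: "?C1 \<subseteq> ?L" by (auto simp: kernel_def val_def val_simps)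
  have fin31: "finite (C3 \<union> ?C1)" using C3(1) B1(1) by simp
  have "independent_mod S_scale ?K (B2 \<union> (C3 \<union> ?C1)) \<and> B2 \<inter> (C3 \<union> ?C1) = {}"
    using C3(4) C1_L
    by (intro S_space.independent_mod_Un[OF B2(1) fin31 B2(4) C31(1) kernel_deletion[OF fin E(4)] _ kernel_subspace]) auto
  then have all: "independent_mod S_scale ?K (B2 \<union> (C3 \<union> ?C1))" "B2 \<inter> (C3 \<union> ?C1) = {}" by auto
  have "?C1 \<subseteq> sdeg p (Suc q)" using B1(3) av_mult_mem_sdeg[OF E(3)] by blast
  moreover have "card (B2 \<union> (C3 \<union> ?C1)) = (\<Sum>q'\<le>Suc q. u1 q' + shifted ?p0 1 u2 p q')"
    using all(2) C31(2) B2(1,2) C3(1,2) B1(1,2) C1(2) fin31 by (simp add: card_Un_disjoint)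
  ultimately show ?case
    unfolding independent_count_def using B2(1,3) C3(3) fin31 all(1)
    by (intro exI[of _ "B2 \<union> (C3 \<union> ?C1)"]) auto
qed

text \<open>At a_i = b_i f_i(x) the contraction becomes \<Sum>i. b_i \<theta>(f_i)(x), the value at
  x of \<theta> applied to \<Sum>i. b_i f_i, which is the zero function.\<close>

lemma log_ideal_subset_kernel: "I \<subseteq> kernel {} {1..n}"
proof
  fix s assume "s \<in> I"
  then show "s \<in> kernel {} {1..n}"
  proof (induction rule: log_ideal.induct)
    case zero
    show ?case by (rule S_space.subspace_0[OF kernel_subspace])
  next
    case (step s w z)
    from step(2) obtain g \<theta> where w: "w = (\<Sum>i = 1..n. Poly_Mapping.single (Poly_Mapping.single i 1) (g i))"
      and \<theta>: "\<theta> \<in> log_derivations scl n f" "\<forall>i\<in>{1..n}. g i \<in> poly_functions scl \<and> \<theta> (f i) = g i * f i"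
      unfolding contractions_def by blast
    have der: "\<theta> \<in> derivations scl" using \<theta>(1) by (simp add: log_derivations_def)
    have "val w x b = 0" if b: "b \<in> relations {} {1..n}" for x b
    proof -
      have lin_sum: "\<theta> (\<Sum>i\<in>A. fun_scale (b i) (f i)) = (\<Sum>i\<in>A. fun_scale (b i) (\<theta> (f i))) \<and> (\<Sum>i\<in>A. fun_scale (b i) (f i)) \<in> poly_functions scl"
        if "finite A" "A \<subseteq> {1..n}" for A
        using that
      proof (induction A rule: finite_induct)
        case empty
        have c: "(\<lambda>_. 0) \<in> poly_functions scl" by (rule poly_functions.const)
        then have "\<theta> (fun_scale 0 (\<lambda>_. 0)) = fun_scale 0 (\<theta> (\<lambda>_. 0))" using der unfolding derivations_def by blast
        then have "\<theta> (\<lambda>_. 0) = (\<lambda>_. 0)" by (simp add: fun_scale_def)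
        then show ?case using c by (simp add: zero_fun_def)
      next
        case (insert e A)
        have fe: "f e \<in> poly_functions scl" using insert.prems by (intro poly_functions.linear form) auto
        have se: "fun_scale (b e) (f e) \<in> poly_functions scl" by (rule poly_functions_scale[OF fe])
        have IH: "\<theta> (\<Sum>i\<in>A. fun_scale (b i) (f i)) = (\<Sum>i\<in>A. fun_scale (b i) (\<theta> (f i)))" "(\<Sum>i\<in>A. fun_scale (b i) (f i)) \<in> poly_functions scl"
          using insert by auto
        have "\<theta> (fun_scale (b e) (f e) + (\<Sum>i\<in>A. fun_scale (b i) (f i))) = \<theta> (fun_scale (b e) (f e)) + \<theta> (\<Sum>i\<in>A. fun_scale (b i) (f i))"
          using der se IH(2) unfolding derivations_def by blast
        moreover have "\<theta> (fun_scale (b e) (f e)) = fun_scale (b e) (\<theta> (f e))"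
          using der fe unfolding derivations_def by blast
        ultimately show ?case
          unfolding sum.insert[OF insert(1,2)] using IH poly_functions.add[OF se IH(2)] by (simp only: simp_thms)
      qed
      have sum_apply: "(\<Sum>i\<in>A. fun_scale (b i) (h i)) y = (\<Sum>i\<in>A. b i * h i y)" for A h y
        by (induction A rule: infinite_finite_induct) (auto simp: fun_scale_apply)
      have "(\<Sum>i = 1..n. fun_scale (b i) (f i)) = fun_scale 0 (\<lambda>_. 0)"
        using b by (intro ext) (simp add: sum_apply fun_scale_apply relations_def flat_def)
      then have "\<theta> (\<Sum>i = 1..n. fun_scale (b i) (f i)) = \<theta> (fun_scale 0 (\<lambda>_. 0))" by simp
      also have "\<dots> = fun_scale 0 (\<theta> (\<lambda>_. 0))"
        using der poly_functions.const[of 0] unfolding derivations_def by blast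
      finally have "(\<Sum>i = 1..n. fun_scale (b i) (\<theta> (f i))) x = 0"
        using lin_sum[of "{1..n}"] by (simp add: fun_scale_apply)
      then have "(\<Sum>i = 1..n. b i * (g i x * f i x)) = 0" using \<theta>(2) by (simp add: sum_apply)
      moreover have "val w x b = (\<Sum>i = 1..n. b i * (g i x * f i x))"
        unfolding w val_def bival_sum bival_single by (intro sum.cong) (auto simp: mval_def)
      ultimately show ?thesis by simp
    qed
    then show ?case using step(4) by (auto simp: kernel_def val_def val_simps)
  qed
qed

lemma quotient_dim_ge_independent:
  assumes "independent_count {} {1..n} p q k"
  shows "k \<le> quotient_dim scl n f p q"
proof -
  obtain B where B: "finite B" "card B = k" "B \<subseteq> sdeg p q" "independent_mod S_scale (kernel {} {1..n}) B"
    using assms unfolding independent_count_def by blast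
  have "independent_mod S_scale (Ideg p q) B"
    using B(4) log_ideal_subset_kernel unfolding independent_mod_def Ideg_def by blast
  then show ?thesis using quotient_dim_ge[OF B(1,3)] B(2) by simp
qed


text \<open>Nonzero coefficients occur only for 0 < i < |E|, so each contributing term has poles in
  both variables, and a shift changes it by lower order. One-sided errors may only be scaled by
  nonnegative numbers, hence the sign condition.\<close>

lemma minor_main_shift:
  assumes nonneg: "\<And>i. 0 \<le> coeff (minor_poly F E) i"
    and zero: "coeff (minor_poly F E) 0 = 0" "coeff (minor_poly F E) (card E) = 0"
  shows "err_bounded (card E - 1) (\<lambda>p q. minor_main F E p q - shifted a b (minor_main F E) p q)"
proof -
  let ?c = "\<lambda>i. real_of_int (coeff (minor_poly F E) i)"
  let ?G = "\<lambda>i p q. real (geo_coeff i p * geo_coeff (card E - i) q)"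
  have "minor_main F E p q - shifted a b (minor_main F E) p q = (\<Sum>i\<le>card E. ?c i * (?G i p q - shifted a b (?G i) p q))" for p q
    by (cases "a \<le> p \<and> b \<le> q") (auto simp: minor_main_def shifted_def sum_subtractf right_diff_distrib)
  moreover have "err_bounded (card E - 1) (\<lambda>p q. ?c i * (?G i p q - shifted a b (?G i) p q))" if "i \<le> card E" for i
  proof (cases "i = 0 \<or> i = card E")
    case True
    then have "?c i = 0" using zero by auto
    then show ?thesis by simp
  next
    case False
    then have "err_bounded (i + (card E - i) - 1) (\<lambda>p q. ?G i p q - shifted a b (?G i) p q)"
      using that by (intro err_bounded_geo_shift) auto
    then show ?thesis using that nonneg by (intro err_bounded_cmult) auto
  qed
  ultimately show ?thesis by (simp only:) (intro err_bounded_sum, simp)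
qed

theorem minor_lower_bound:
  assumes "E \<subseteq> {1..n}" "F \<subseteq> {1..n}" "F \<inter> E = {}" "flat (F \<union> E) = {0}"
  shows "\<exists>u g. (\<forall>p q. independent_count F E p q (u p q)) \<and> minor_err E g \<and> (\<forall>p q. minor_main F E p q \<le> real (u p q) + g p q)"
  using assms
proof (induction rule: minor_induct)
  case (loops F E)
  show ?case
  proof (cases "E = {}")
    case True
    have "independent_count F E p q (of_bool (p = 0 \<and> q = 0))" for p q
    proof (cases "p = 0 \<and> q = 0")
      case True
      have "independent_mod S_scale (kernel F E) {1}"
        using loops(4) zero_in_relations by (auto simp: independent_mod_def kernel_def val_def val_simps)
      then show ?thesis unfolding independent_count_def using True one_mem_sdeg by (intro exI[of _ "{1}"]) simp
    next
      case False
      then have "of_bool (p = 0 \<and> q = 0) = (0 :: nat)" by simp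
      then show ?thesis using independent_count_zero by metis
    qed
    then show ?thesis
      using True by (intro exI[of _ "\<lambda>p q. of_bool (p = 0 \<and> q = 0)"] exI[of _ "\<lambda>_ _. 0"]) (auto simp: minor_err_def minor_main_empty)
  next
    case False
    then show ?thesis
      using minor_main_all_loops[OF loops(1,2,4)] independent_count_zero
      by (intro exI[of _ "\<lambda>_ _. 0"]) (auto simp: minor_err_def)
  qed
next
  case (coloop F E e v)
  have fin: "finite E" using finite_subset[OF coloop(1)] by simp
  have v: "v \<in> flat F" using coloop(7) flat_mono[of F "F \<union> E"] by auto
  obtain u g where u: "\<And>p q. independent_count (insert e F) E p q (u p q)" and g: "minor_err E g"
      and le: "\<And>p q. minor_main (insert e F) E p q \<le> real (u p q) + g p q"
    using coloop(9) by blast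
  have "independent_count F (insert e E) p q (\<Sum>p'\<le>p. u p' q)" for p q
    by (rule independent_count_coloop[OF coloop(1-4) v coloop(8) u])
  moreover have "minor_err (insert e E) (\<lambda>p q. \<Sum>p'\<le>p. g p' q)"
    using coloop(4) fin g by (rule minor_err_sum_fst)
  moreover have "minor_main F (insert e E) p q \<le> real (\<Sum>p'\<le>p. u p' q) + (\<Sum>p'\<le>p. g p' q)" for p q
  proof -
    have "minor_main F (insert e E) p q = (\<Sum>p'\<le>p. minor_main (insert e F) E p' q)"
      by (rule minor_main_coloop) (use coloop in auto)
    then show ?thesis using sum_mono[of "{..p}", OF le] by (simp add: sum.distrib)
  qed
  ultimately show ?case
    by (intro exI[of _ "\<lambda>p q. \<Sum>p'\<le>p. u p' q"] exI[of _ "\<lambda>p q. \<Sum>p'\<le>p. g p' q"] conjI allI)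
next
  case (noncoloop F E e v)
  have fin: "finite E" using finite_subset[OF noncoloop(1)] by simp
  have ne: "E \<noteq> {}" by (rule flat_nonzero_imp_nonempty) (use noncoloop in auto)
  have flat_con: "flat (insert e F \<union> E) = {0}"
    using flat_mono[of "F \<union> E" "insert e F \<union> E"] zero_in_flat[of "insert e F \<union> E"] noncoloop by auto
  have eF: "insert e F \<subseteq> {1..n}" "insert e F \<inter> E = {}" using noncoloop by auto
  obtain u1 g1 where u1: "\<And>p q. independent_count F E p q (u1 p q)" and g1: "minor_err E g1"
      and le1: "\<And>p q. minor_main F E p q \<le> real (u1 p q) + g1 p q"
    using noncoloop(10) by blast
  \<comment> \<open>If the contraction has a loop, its bound is replaced by 0. This is no loss,
    because its main term vanishes, and it meets the condition on loops in
    \<open>independent_count_noncoloop\<close>.\<close>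
  obtain u2 g2 where u2: "\<And>p q. independent_count (insert e F) E p q (u2 p q)" and g2: "minor_err E g2"
      and le2: "\<And>p q. minor_main (insert e F) E p q \<le> real (u2 p q) + g2 p q"
      and loop: "\<And>j p q. j \<in> E \<Longrightarrow> (\<And>x. x \<in> flat (insert e F) \<Longrightarrow> f j x = 0) \<Longrightarrow> u2 p q = 0"
  proof (cases "\<exists>j\<in>E. \<forall>x\<in>flat (insert e F). f j x = 0")
    case True
    then obtain j where j: "j \<in> E" "\<forall>x\<in>flat (insert e F). f j x = 0" by blast
    have "minor_poly (insert e F) (insert j (E - {j})) = 0"
      using j fin noncoloop(1) eF by (intro minor_poly_loop) auto
    then have "minor_main (insert e F) E p q = 0" for p q using j(1) by (simp add: minor_main_def insert_absorb)
    then show ?thesis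
      using independent_count_zero ne by (intro that[of "\<lambda>_ _. 0" "\<lambda>_ _. 0"]) (auto simp: minor_err_def)
  next
    case False
    obtain u g where "\<And>p q. independent_count (insert e F) E p q (u p q)" "minor_err E g"
      "\<And>p q. minor_main (insert e F) E p q \<le> real (u p q) + g p q"
      using noncoloop(11) by blast
    then show ?thesis using False by (intro that[of u g]) blast+
  qed
  let ?p0 = "card (support E v) - 1"
  let ?m = "minor_main (insert e F) E"
  let ?u = "\<lambda>p q. \<Sum>q'\<le>q. u1 p q' + shifted ?p0 1 u2 p q'"
  let ?g = "\<lambda>p q. \<Sum>q'\<le>q. g1 p q' + ((?m p q' - shifted ?p0 1 ?m p q') + shifted ?p0 1 g2 p q')"
  have ind: "independent_count F (insert e E) p q (?u p q)" for p q
    by (rule independent_count_noncoloop[OF noncoloop(1-4,7,8,6,9) u1 u2 loop])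
  \<comment> \<open>The contraction has rank below |E|: adding e does not raise the rank of F
    \<union> E, but it does raise that of F.\<close>
  have "coeff (minor_poly (insert e F) E) (card E) = 0"
  proof (rule coeff_minor_poly_eq_0[OF eF(1) noncoloop(1)])
    have "rk (insert e (F \<union> E)) = rk (F \<union> E)"
      using noncoloop by (subst rk_insert) (auto intro!: linear_form_zero form)
    moreover have "rk (insert e F) = Suc (rk F)"
      using noncoloop by (subst rk_insert) auto
    moreover have "rk (F \<union> E) \<le> rk F + card E" by (rule rk_union_le[OF fin noncoloop(2,1)])
    moreover have "0 < card E" using ne fin by (simp add: card_gt_0_iff)
    ultimately show "rk (insert e F \<union> E) - rk (insert e F) < card E" by simp
  qed
  then have "err_bounded (card E - 1) (\<lambda>p q. ?m p q - shifted ?p0 1 ?m p q)"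
    using coeff_minor_poly[OF noncoloop(1) eF flat_con] ne by (intro minor_main_shift) auto
  then have "err_bounded (Suc (card E - 1)) ?g"
    using g1 g2 ne by (intro err_bounded_sum_snd err_bounded_add err_bounded_shift) (simp_all add: minor_err_def)
  moreover have "Suc (card E - 1) = card (insert e E) - 1" using ne fin noncoloop(4) by (simp add: card_gt_0_iff)
  ultimately have err: "minor_err (insert e E) ?g" by (simp add: minor_err_def)
  have "minor_main F (insert e E) p q \<le> real (?u p q) + ?g p q" for p q
  proof -
    have 1: "?m p q' \<le> shifted ?p0 1 (\<lambda>p q. real (u2 p q)) p q' + ((?m p q' - shifted ?p0 1 ?m p q') + shifted ?p0 1 g2 p q')" for q'
      using le2[of "p - ?p0" "q' - 1"] by (auto simp: shifted_def)
    have "minor_main F (insert e E) p q = (\<Sum>q'\<le>q. minor_main F E p q' + ?m p q')"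
      by (rule minor_main_noncoloop) (use noncoloop in auto)
    also have "\<dots> \<le> (\<Sum>q'\<le>q. (real (u1 p q') + g1 p q') + (shifted ?p0 1 (\<lambda>p q. real (u2 p q)) p q' + ((?m p q' - shifted ?p0 1 ?m p q') + shifted ?p0 1 g2 p q')))"
      by (intro sum_mono add_mono le1 1)
    also have "\<dots> = real (?u p q) + ?g p q"
    proof -
      have "shifted ?p0 1 (\<lambda>p q. real (u2 p q)) p q' = real (shifted ?p0 1 u2 p q')" for q' by (simp add: shifted_def)
      then show ?thesis
        unfolding of_nat_sum of_nat_add sum.distrib[symmetric] by (intro sum.cong) simp_all
    qed
    finally show ?thesis .
  qed
  then show ?case using ind err
    by (intro exI[of _ ?u] exI[of _ ?g] conjI allI)
qed

section \<open>The Hilbert series\<close>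

text \<open>Each form costs at most one additional vector. Applied to all forms, whose common flat
  is trivial, this yields a finite spanning set of V.\<close>

lemma finite_span_mod_flat:
  assumes "finite F" "F \<subseteq> {1..n}"
  shows "\<exists>C. finite C \<and> (\<forall>x. \<exists>c\<in>span C. x - c \<in> flat F)"
  using assms
proof (induction F rule: finite_induct)
  case empty
  show ?case by (intro exI[of _ "{}"]) (auto simp: flat_def)
next
  case (insert e F)
  then obtain C where C: "finite C" "\<And>x. \<exists>c\<in>span C. x - c \<in> flat F" by auto
  show ?case
  proof (cases "\<forall>x\<in>flat F. f e x = 0")
    case True
    then have "flat (insert e F) = flat F" by (auto simp: flat_insert)
    then show ?thesis using C by auto
  next
    case False
    then obtain v where v: "v \<in> flat F" "f e v \<noteq> 0" by blast
    have "\<exists>c\<in>span (insert v C). x - c \<in> flat (insert e F)" for x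
    proof -
      obtain c where c: "c \<in> span C" "x - c \<in> flat F" using C(2) by blast
      let ?a = "f e (x - c) / f e v"
      have "(x - c) - scl ?a v \<in> flat (insert e F)"
        using flat_diff_scale[of F "x - c" v ?a] c(2) v insert.prems form[of e]
        by (auto simp: flat_insert linear_form_diff linear_form_scale)
      moreover have "c + scl ?a v \<in> span (insert v C)"
        by (rule span_add[OF subsetD[OF span_mono c(1)] span_scale[OF span_base]]) auto
      ultimately show ?thesis by (metis diff_diff_eq)
    qed
    then show ?thesis using C(1) by (intro exI[of _ "insert v C"]) auto
  qed
qed

text \<open>V is finite-dimensional, and all forms lie in the span of the coordinate functions of a
  basis. As Tutte coefficients above the matroid rank vanish, this inequality lets the sum run up to
  the rank of the arrangement.\<close>

lemma rk_le_arrangement_rank: "rk {1..n} \<le> arrangement_rank scl n f"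
proof -
  obtain C where C: "finite C" "\<And>x. \<exists>c\<in>span C. x - c \<in> flat {1..n}"
    using finite_span_mod_flat[of "{1..n}"] by auto
  have spanC: "x \<in> span C" for x using C(2)[of x] flat_all by auto
  obtain B where B: "independent B" "UNIV \<subseteq> span B" "card B = dim UNIV"
    using basis_exists[of UNIV] by blast
  have finB: "finite B" using independent_span_bound[OF C(1) B(1)] spanC by blast
  let ?rep = "\<lambda>b x. representation B x b"
  have "f i \<in> fun_space.span (?rep ` B)" if "i \<in> {1..n}" for i
  proof -
    have sum_apply: "(\<Sum>b\<in>A. fun_scale (c b) (h b)) y = (\<Sum>b\<in>A. c b * h b y)" for A c h and y :: 'v
      by (induction A rule: infinite_finite_induct) (auto simp: fun_scale_apply)
    have "f i x = (\<Sum>b\<in>B. fun_scale (f i b) (?rep b)) x" for x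
    proof -
      have x: "x \<in> span B" using B(2) by blast
      have f_sum: "f i (\<Sum>b\<in>A. h b) = (\<Sum>b\<in>A. f i (h b))" for A and h :: "'v \<Rightarrow> 'v"
        by (induction A rule: infinite_finite_induct)
          (auto simp: linear_form_zero linear_form_add form[OF that])
      have "f i x = f i (\<Sum>b\<in>B. scl (?rep b x) b)"
        using sum_representation_eq[OF B(1) x finB order_refl] by simp
      then show ?thesis by (simp add: f_sum sum_apply linear_form_scale form[OF that] mult.commute)
    qed
    then have "f i = (\<Sum>b\<in>B. fun_scale (f i b) (?rep b))" by blast
    also have "\<dots> \<in> fun_space.span (?rep ` B)"
      by (intro fun_space.span_sum fun_space.span_scale fun_space.span_base) auto
    finally show ?thesis .
  qed
  then have "rk {1..n} \<le> card (?rep ` B)"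
    unfolding matroid_rank_def using finB by (intro fun_space.dim_le_card) auto
  also have "\<dots> \<le> card B" by (rule card_image_le[OF finB])
  finally have "rk {1..n} \<le> dim UNIV" using B(3) by simp
  moreover have "dim (center n f) = 0"
    using dim_le_card[of "center n f" "{}"] center by simp
  ultimately show ?thesis by (simp add: arrangement_rank_def)
qed

text \<open>Solving the relation for \<open>f e\<close> shows that the other n - 1 forms have the
  same rank. This makes the coefficient of x^n in T(x, 0) vanish.\<close>

lemma rk_less_if_dependent:
  assumes "(\<forall>v. (\<Sum>i = 1..n. c i * f i v) = 0)" "e \<in> {1..n}" "c e \<noteq> 0"
  shows "rk {1..n} < n"
proof -
  let ?E = "{1..n} - {e}"
  have "f e x = 0" if "x \<in> flat ?E" for x
  proof -
    have "(\<Sum>i = 1..n. c i * f i x) = c e * f e x + (\<Sum>i\<in>?E. c i * f i x)"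
      using assms(2) by (intro sum.remove) auto
    also have "(\<Sum>i\<in>?E. c i * f i x) = 0" using that by (intro sum.neutral) (auto simp: flat_def)
    finally show ?thesis using assms(1,3) by simp
  qed
  then have "rk (insert e ?E) = rk ?E" using assms(2) by (subst rk_insert) auto
  moreover have "insert e ?E = {1..n}" using assms(2) by auto
  moreover have "rk ?E \<le> card ?E" by (rule rk_le_card) simp
  moreover have "card ?E < n" using assms(2) by simp
  ultimately show ?thesis by simp
qed

theorem hilbert_series_top_poles:
  assumes nonzero: "\<And>i. i \<in> {1..n} \<Longrightarrow> f i \<noteq> 0" and dependent: "\<not> boolean_arrangement n f"
  shows "\<exists>Q. hilbert_series scl n f =
      (\<Sum>i = 1..arrangement_rank scl n f. of_int (tutte_coeff n f i 0) * pole i (n - i)) + Q \<and> pole_order_less n Q"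
proof -
  obtain c e where ce: "\<forall>v. (\<Sum>i = 1..n. c i * f i v) = 0" "e \<in> {1..n}" "c e \<noteq> 0"
    using dependent unfolding boolean_arrangement_def by blast
  have rk: "rk {1..n} < n" by (rule rk_less_if_dependent[OF ce])
  have "\<exists>x\<in>flat {}. f e x \<noteq> 0" using nonzero[OF ce(2)] by (auto simp: flat_def fun_eq_iff)
  then have "rk (insert e {}) = Suc (rk {})" using ce(2) by (subst rk_insert) auto
  moreover have "rk (insert e {}) \<le> rk {1..n}" using ce(2) by (intro rk_mono) auto
  \<comment> \<open>Some form is nonzero, so the rank is at least 1, and by dependence it is below
    n.\<close>
  ultimately have n2: "2 \<le> n" using rk by linarith
  let ?T = "\<lambda>i. tutte_coeff n f i 0"
  let ?H = "quotient_dim scl n f"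
  have M: "{1..n} \<subseteq> {1..n}" "{} \<subseteq> {1..n}" "{} \<inter> {1..n} = {}" "flat ({} \<union> {1..n}) = {0}"
    using flat_all by auto
  have T_zero: "?T i = 0" if "rk {1..n} < i" for i
    unfolding tutte_coeff_eq_minor using that by (intro coeff_minor_poly_eq_0) auto
  have T_0: "?T 0 = 0" using coeff_minor_poly[OF M] n2 by (simp add: tutte_coeff_eq_minor)
  \<comment> \<open>The end terms i = 0 and i = n vanish, so every remaining term has poles in both
    variables.\<close>
  have main: "minor_main {} {1..n} p q = (\<Sum>i = 1..<n. real_of_int (?T i) * real (geo_coeff i p * geo_coeff (n - i) q))" for p q
  proof -
    have "minor_main {} {1..n} p q = (\<Sum>i\<in>{..n}. real_of_int (?T i) * real (geo_coeff i p * geo_coeff (n - i) q))"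
      by (simp add: minor_main_def tutte_coeff_eq_minor)
    also have "\<dots> = (\<Sum>i = 1..<n. real_of_int (?T i) * real (geo_coeff i p * geo_coeff (n - i) q))"
    proof (rule sum.mono_neutral_right)
      show "\<forall>i\<in>{..n} - {1..<n}. real_of_int (?T i) * real (geo_coeff i p * geo_coeff (n - i) q) = 0"
      proof
        fix i assume "i \<in> {..n} - {1..<n}"
        then have "i = 0 \<or> i = n" by auto
        then have "?T i = 0" using T_0 T_zero rk by auto
        then show "real_of_int (?T i) * real (geo_coeff i p * geo_coeff (n - i) q) = 0" by simp
      qed
    qed auto
    finally show ?thesis .
  qed
  have upper: "err_bounded (n - 1) (\<lambda>p q. real (?H p q) - minor_main {} {1..n} p q)"
  proof -
    obtain u g where u: "\<And>p q. generated_by {} {1..n} p q (u p q)" and g: "minor_err {1..n} g"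
      and le: "\<And>p q. real (u p q) \<le> minor_main {} {1..n} p q + g p q"
      using minor_upper_bound[OF M] by blast
    have "real (?H p q) - minor_main {} {1..n} p q \<le> g p q" for p q
      using le[of p q] quotient_dim_le_generated[OF u, of p q] by linarith
    moreover have "err_bounded (n - 1) g" using g n2 by (simp add: minor_err_def)
    ultimately show ?thesis by (rule err_bounded_le[rotated])
  qed
  have lower: "err_bounded (n - 1) (\<lambda>p q. minor_main {} {1..n} p q - real (?H p q))"
  proof -
    obtain u g where u: "\<And>p q. independent_count {} {1..n} p q (u p q)" and g: "minor_err {1..n} g"
      and le: "\<And>p q. minor_main {} {1..n} p q \<le> real (u p q) + g p q"
      using minor_lower_bound[OF M] by blast
    have "minor_main {} {1..n} p q - real (?H p q) \<le> g p q" for p q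
      using le[of p q] quotient_dim_ge_independent[OF u, of p q] by linarith
    moreover have "err_bounded (n - 1) g" using g n2 by (simp add: minor_err_def)
    ultimately show ?thesis by (rule err_bounded_le[rotated])
  qed
  have "(\<Sum>i = 1..<n. of_int (?T i) * pole i (n - i)) = (\<Sum>i = 1..rk {1..n}. of_int (?T i) * pole i (n - i))"
    using rk T_zero by (intro sum.mono_neutral_right) auto
  also have "\<dots> = (\<Sum>i = 1..arrangement_rank scl n f. of_int (?T i) * pole i (n - i))"
    using rk_le_arrangement_rank T_zero by (intro sum.mono_neutral_left) auto
  finally show ?thesis
    using hilbert_series_from_bounds[OF n2 main upper lower quotient_dim_sum_of_pieces]
    unfolding hilbert_series_def by simp
qed

end

theorem theorem5p4:
  fixes scl :: "complex \<Rightarrow> 'v::ab_group_add \<Rightarrow> 'v"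
    and n l :: nat
    and f :: "nat \<Rightarrow> 'v \<Rightarrow> complex"
  assumes "central_arrangement scl n f"
    and "essential n f"
    and "l = arrangement_rank scl n f"
    and "\<not> boolean_arrangement n f"
  shows "\<exists>Q. hilbert_series scl n f =
      (\<Sum>i = 1..l. of_int (tutte_coeff n f i 0) *
        inverse ((1 - var_t) ^ i * (1 - var_u) ^ (n - i))) + Q \<and>
    pole_order_less n Q"
proof -
  have "essential_arrangement scl n f"
    using assms(1,2) by (intro essential_arrangement.intro) (auto simp: central_arrangement_def essential_def)
  from essential_arrangement.hilbert_series_top_poles[OF this _ assms(4)] assms(1,3)
  show ?thesis by (simp add: central_arrangement_def inverse_eq_pole)
qed

end
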